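(* Let $(G,\chi)$ be an augmented group with associated $\mathcal{R}_1$-module $\mathcal{M}$ and $0$th characteristic polynomial $\Delta$, and let $p$ be a prime. (i) If $\mathcal{M}$ has a square matrix presentation and $\Delta(t)\neq 0$, then the sequence $\{b_{r_k}\}$ of pure torsion numbers satisfies $$\lim_{r_k\to\infty}\bigl(b_{r_k}^{(p)}\bigr)^{1/r_k}=(\mathrm{content}\ \Delta)^{(p)}.$$ (ii) If $\mathcal{M}$ is a direct sum of cyclic modules, then the sequence of all torsion numbers satisfies $$\lim_{r\to\infty}\bigl(b_r^{(p)}\bigr)^{1/r}=(\mathrm{content}\ \Delta)^{(p)}.$$ (iii) If $\mathcal{M}$ is torsion free as an abelian group, then $$\lim_{r\to\infty}\bigl(b_r^{(p)}\bigr)^{1/r}=1.$$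
   Context: An augmented group is a pair $(G,\chi)$ where $G$ is a finitely generated group and $\chi:G\to\mathbb{Z}$ is an epimorphism. Let $\mathcal{R}_1=\mathbb{Z}[t,t^{-1}]$. The abelianization $\mathcal{M}$ of $\ker\chi$ is a finitely generated $\mathcal{R}_1$-module, with $t$ acting by conjugation by an element $x\in G$ with $\chi(x)=1$. Write $\mathcal{M}\cong \mathcal{R}_1^N/\mathcal{A}\mathcal{R}_1^M$ with $\mathcal{A}$ an $N\times M$ matrix over $\mathcal{R}_1$, $M\ge N$; $\mathcal{M}$ has a square matrix presentation if $\mathcal{A}$ can be chosen with $M=N$. The $0$th characteristic polynomial $\Delta$ is a greatest common divisor in $\mathcal{R}_1$ of the $N\times N$ minors of $\mathcal{A}$; it is well defined up to units of $\mathcal{R}_1$, and may be taken in $\mathbb{Z}[t]$. For a positive integer $r$ put $\mathcal{M}_r=\mathcal{M}/(t^r-1)\mathcal{M}$, a finitely generated abelian group. The Betti number $\beta_r$ is its rank and the torsion number $b_r$ is the order of its torsion subgroup; $b_r$ is called pure if $\beta_r=0$, and $\{b_{r_k}\}$ in (i) is the subsequence of $\{b_r\}$ consisting of the pure torsion numbers. For a positive integer $n$, the $p$-component $n^{(p)}$ is the largest power of $p$ that divides $n$. The content of a polynomial in $\mathbb{Z}[t]$ is the greatest common divisor of its coefficients.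
   Formalization: Part (ii) is stated with the additional assumption Δ ≠ 0, since for Δ = 0 the p-component of content Δ is undefined and no convention works: R₁ and R₁ ⊕ R₁/(p) both have Δ = 0, with limits 1 and p. *)

theory Defs
  imports
    Complex_Main
    "Jordan_Normal_Form.Determinant"
    "HOL-Algebra.AbelCoset"
    "HOL-Algebra.Elementary_Groups"
    "HOL-Algebra.Generated_Groups"
    "HOL-Algebra.Module"
    "HOL-Library.Poly_Mapping"
    "HOL-Library.Extended_Nat"
begin

subsection \<open>Laurent polynomials\<close>

text \<open>Finitely supported functions on the additive group of integers, with convolution as
  product, are the Laurent polynomials with integer coefficients: \<open>single n a\<close> is the
  monomial with coefficient \<open>a\<close> and exponent \<open>n\<close>.\<close>

type_synonym laurent = "int \<Rightarrow>\<^sub>0 int"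

definition laurent_t :: laurent where
  "laurent_t = Poly_Mapping.single 1 1"

definition laurent_of_poly :: "int poly \<Rightarrow> laurent" where
  "laurent_of_poly P = (\<Sum>i\<le>degree P. Poly_Mapping.single (int i) (coeff P i))"

definition laurent_ring :: "laurent ring" where
  "laurent_ring = \<lparr>carrier = UNIV, mult = (*), one = 1, zero = 0, add = (+)\<rparr>"

subsection \<open>Modules\<close>

text \<open>HOL-Algebra modules extend rings; the fields \<open>mult\<close> and \<open>one\<close> carry no meaning.\<close>

definition quot_module :: "('r, 'm, 'c) module_scheme \<Rightarrow> 'm set \<Rightarrow> ('r, 'm set) module" where
  "quot_module M H =
    \<lparr>carrier = a_rcosets\<^bsub>M\<^esub> H, mult = undefined, one = undefined,
     zero = H, add = (<+>\<^bsub>M\<^esub>),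
     module.smult = (\<lambda>r C. \<Union>c\<in>C. H +>\<^bsub>M\<^esub> (r \<odot>\<^bsub>M\<^esub> c))\<rparr>"

definition module_isomorphic ::
    "('r, 'x) ring_scheme \<Rightarrow> ('r, 'm, 'c) module_scheme \<Rightarrow> ('r, 'n, 'd) module_scheme \<Rightarrow> bool" where
  "module_isomorphic R M N \<longleftrightarrow>
    (\<exists>h. bij_betw h (carrier M) (carrier N) \<and>
      (\<forall>u\<in>carrier M. \<forall>v\<in>carrier M. h (u \<oplus>\<^bsub>M\<^esub> v) = h u \<oplus>\<^bsub>N\<^esub> h v) \<and>
      (\<forall>r\<in>carrier R. \<forall>u\<in>carrier M. h (r \<odot>\<^bsub>M\<^esub> u) = r \<odot>\<^bsub>N\<^esub> h u))"

definition cyclic_submodule :: "('r, 'x) ring_scheme \<Rightarrow> ('r, 'm, 'c) module_scheme \<Rightarrow> 'm \<Rightarrow> 'm set" where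
  "cyclic_submodule R M g = (\<lambda>r. r \<odot>\<^bsub>M\<^esub> g) ` carrier R"

text \<open>Internal direct sums. A finite index set loses nothing for finitely generated modules:
  only finitely many summands of such a module are nonzero.\<close>

definition direct_sum_of_cyclics :: "('r, 'x) ring_scheme \<Rightarrow> ('r, 'm, 'c) module_scheme \<Rightarrow> bool" where
  "direct_sum_of_cyclics R M \<longleftrightarrow>
    (\<exists>(n::nat) g. g \<in> {..<n} \<rightarrow> carrier M \<and>
      (\<forall>m\<in>carrier M. \<exists>!c. c \<in> (\<Pi>\<^sub>E i\<in>{..<n}. cyclic_submodule R M (g i)) \<and>
        m = (\<Oplus>\<^bsub>M\<^esub>i\<in>{..<n}. c i)))"

definition torsion_part :: "('r, 'm, 'c) module_scheme \<Rightarrow> 'm set" where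
  "torsion_part M = {m \<in> carrier M. \<exists>k::nat. 0 < k \<and> [k] \<cdot>\<^bsub>M\<^esub> m = \<zero>\<^bsub>M\<^esub>}"

definition abelian_torsion_free :: "('r, 'm, 'c) module_scheme \<Rightarrow> bool" where
  "abelian_torsion_free M \<longleftrightarrow> torsion_part M = {\<zero>\<^bsub>M\<^esub>}"

definition int_independent :: "('r, 'm, 'c) module_scheme \<Rightarrow> 'm set \<Rightarrow> bool" where
  "int_independent M S \<longleftrightarrow> finite S \<and> S \<subseteq> carrier M \<and>
    (\<forall>c::'m \<Rightarrow> int. (\<Oplus>\<^bsub>M\<^esub>s\<in>S. [c s] \<cdot>\<^bsub>M\<^esub> s) = \<zero>\<^bsub>M\<^esub> \<longrightarrow> (\<forall>s\<in>S. c s = 0))"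

text \<open>The rank of a finitely generated group is finite; \<open>enat\<close> only makes the supremum
  meaningful without that knowledge.\<close>

definition abelian_rank :: "('r, 'm, 'c) module_scheme \<Rightarrow> enat" where
  "abelian_rank M = (SUP S\<in>Collect (int_independent M). enat (card S))"

subsection \<open>Matrix presentations and the characteristic polynomial\<close>

definition coker_module :: "laurent mat \<Rightarrow> (laurent, laurent vec set) module" where
  "coker_module A = quot_module (module_vec TYPE(laurent) (dim_row A))
     ((\<lambda>v. A *\<^sub>v v) ` carrier_vec (dim_col A))"

definition presents :: "laurent mat \<Rightarrow> (laurent, 'm, 'c) module_scheme \<Rightarrow> bool" where
  "presents A M \<longleftrightarrow> module_isomorphic laurent_ring M (coker_module A)"

definition has_square_presentation :: "(laurent, 'm, 'c) module_scheme \<Rightarrow> bool" where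
  "has_square_presentation M \<longleftrightarrow> (\<exists>A. square_mat A \<and> presents A M)"

text \<open>The \<open>N \<times> N\<close> minors of an \<open>N \<times> M\<close> matrix: \<open>f\<close> selects \<open>N\<close> columns in increasing order.\<close>

definition maximal_minors :: "laurent mat \<Rightarrow> laurent set" where
  "maximal_minors A =
    {det (mat (dim_row A) (dim_row A) (\<lambda>(i, j). A $$ (i, f j))) | f.
      strict_mono_on {..<dim_row A} f \<and> f ` {..<dim_row A} \<subseteq> {..<dim_col A}}"

definition is_gcd_of :: "'r::comm_ring_1 \<Rightarrow> 'r set \<Rightarrow> bool" where
  "is_gcd_of d S \<longleftrightarrow> (\<forall>s\<in>S. d dvd s) \<and> (\<forall>e. (\<forall>s\<in>S. e dvd s) \<longrightarrow> e dvd d)"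

text \<open>A predicate, because the polynomial is determined only up to units of the Laurent ring.\<close>

definition zeroth_char_poly :: "(laurent, 'm, 'c) module_scheme \<Rightarrow> int poly \<Rightarrow> bool" where
  "zeroth_char_poly M D \<longleftrightarrow>
    (\<exists>A. dim_row A \<le> dim_col A \<and> presents A M \<and>
      is_gcd_of (laurent_of_poly D) (maximal_minors A))"

subsection \<open>Augmented groups\<close>

definition augmented_group :: "('a, 'b) monoid_scheme \<Rightarrow> ('a \<Rightarrow> int) \<Rightarrow> bool" where
  "augmented_group G \<chi> \<longleftrightarrow> group G \<and>
    (\<exists>S. finite S \<and> S \<subseteq> carrier G \<and> generate G S = carrier G) \<and>
    \<chi> \<in> epi G integer_group"

definition conj_image :: "('a, 'b) monoid_scheme \<Rightarrow> 'a \<Rightarrow> 'a set \<Rightarrow> 'a set" where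
  "conj_image G g C = (\<lambda>k. g \<otimes>\<^bsub>G\<^esub> k \<otimes>\<^bsub>G\<^esub> inv\<^bsub>G\<^esub> g) ` C"

definition kernel_abelianization ::
    "('a, 'b) monoid_scheme \<Rightarrow> ('a \<Rightarrow> int) \<Rightarrow> 'a set monoid" where
  "kernel_abelianization G \<chi> =
    (G\<lparr>carrier := kernel G integer_group \<chi>\<rparr>) Mod (derived G (kernel G integer_group \<chi>))"

text \<open>The abelianization of \<open>ker \<chi>\<close>, written additively, with \<open>t\<close> acting as conjugation by
  \<open>x\<close>; thus \<open>\<Sum> a\<^sub>n t\<^sup>n\<close> sends a class \<open>C\<close> to the product of the classes
  \<open>(x\<^sup>n C x\<^sup>-\<^sup>n)\<close> raised to the powers \<open>a\<^sub>n\<close>.\<close>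

definition augmentation_module ::
    "('a, 'b) monoid_scheme \<Rightarrow> ('a \<Rightarrow> int) \<Rightarrow> 'a \<Rightarrow> (laurent, 'a set) module" where
  "augmentation_module G \<chi> x =
    (let A = kernel_abelianization G \<chi> in
     \<lparr>carrier = carrier A, mult = undefined, one = undefined,
      zero = \<one>\<^bsub>A\<^esub>, add = (\<otimes>\<^bsub>A\<^esub>),
      module.smult = (\<lambda>f C. \<Otimes>\<^bsub>A\<^esub>n\<in>Poly_Mapping.keys f.
        conj_image G (x [^]\<^bsub>G\<^esub> n) C [^]\<^bsub>A\<^esub> Poly_Mapping.lookup f n)\<rparr>)"

subsection \<open>Betti and torsion numbers\<close>

definition reduced_module ::
    "(laurent, 'm, 'c) module_scheme \<Rightarrow> nat \<Rightarrow> (laurent, 'm set) module" where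
  "reduced_module M r = quot_module M ((\<lambda>m. (laurent_t ^ r - 1) \<odot>\<^bsub>M\<^esub> m) ` carrier M)"

definition betti_number :: "(laurent, 'm, 'c) module_scheme \<Rightarrow> nat \<Rightarrow> enat" where
  "betti_number M r = abelian_rank (reduced_module M r)"

definition torsion_number :: "(laurent, 'm, 'c) module_scheme \<Rightarrow> nat \<Rightarrow> nat" where
  "torsion_number M r = card (torsion_part (reduced_module M r))"

definition p_component :: "nat \<Rightarrow> nat \<Rightarrow> nat" where
  "p_component p n = p ^ multiplicity p n"

text \<open>The filter of \<open>r \<rightarrow> \<infinity>\<close> through the indices whose torsion number is pure. Limits along it are
  limits of the subsequence of pure torsion numbers, and hold vacuously if there are only finitely
  many of these.\<close>

definition pure_indices :: "(laurent, 'm, 'c) module_scheme \<Rightarrow> nat filter" where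
  "pure_indices M = inf sequentially (principal {r. 0 < r \<and> betti_number M r = 0})"

end

theory Submission
  imports Defs "HOL-Library.Function_Algebras" "HOL-Real_Asymp.Real_Asymp"
begin

text \<open>Let \<open>R\<close> be the ring of Laurent polynomials and write the module as \<open>F / L\<close> with \<open>F = R\<^sup>N\<close>. Put
  \<open>D = L + (t\<^sup>r - 1) F\<close> and let \<open>T \<supseteq> D\<close> consist of the vectors that some power of \<open>p\<close> sends into \<open>D\<close>.
  The \<open>p\<close>-component of the torsion number is the index \<open>[T : D]\<close>, and if \<open>p\<^sup>e\<close> annihilates \<open>T / D\<close>, it is
  \<open>[F : D + p\<^sup>e F] / [F : T + p\<^sup>e F]\<close>.

  Exponents \<open>e = c + v\<^sub>p(r)\<close> suffice, with \<open>c\<close> independent of \<open>r\<close>. For a module annihilated by some \<open>s\<close>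
  prime to \<open>p\<close> this holds because \<open>R / (p, s)\<close> is finite, so that some \<open>t\<^sup>g\<close> acts as
  \<open>1 + p\<^sup>2 a\<close>, and \<open>(1 + p\<^sup>2 a)\<^sup>r - 1\<close> is \<open>r p\<^sup>2 a\<close> times a factor prime to \<open>p\<close>; the torsion of the
  quotient by \<open>a\<close> has bounded exponent by the ascending chain condition.

  The indices are determined up to a factor \<open>C\<^sup>e\<close>, whose \<open>r\<close>-th root tends to \<open>1\<close>. If \<open>\<Delta> \<noteq> 0\<close>, some maximal
  minor is \<open>p\<^sup>l s\<close> with \<open>s\<close> prime to \<open>p\<close> and \<open>p\<^sup>l\<close> the \<open>p\<close>-component of the content of \<open>\<Delta>\<close>.
  Removing the factors \<open>p\<close> of the determinant one at a time bounds the index by \<open>p\<^sup>l\<^sup>r C\<^sup>e\<close>, and the same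
  bound for the adjugate matrix is a bound from below. If the module is torsion free, it is, up to a
  module annihilated by some \<open>s\<close> prime to \<open>p\<close>, free over \<open>R\<close>, and the contributions of the free part cancel.\<close>

subsection \<open>Indices of additive subgroups\<close>

text \<open>D itself may have infinite index in F, because the Betti number may be positive. Adding
  p^e F makes the index finite, and the index of T + p^e F removes what the free part contributes.
  The price is a loss of C^e in each comparison, which is harmless only because v_p(r) \<le>
  log_2(r) makes e grow more slowly than r. The chain condition alone would give an exponent for one
  r at a time; uniformity comes from the element a, which is chosen before r. The square in 1 + p^2
  a leaves a spare factor p in the second-order term of the binomial expansion, so that p = 2 is no
  exception. The main term p^(lr) comes from R / (p, t^r - 1), which has p^r elements, once for each
  factor p of the minor. The constants C count cosets of submodules s F + p F with s prime to p, in
  which r does not occur. Since R is not a principal ideal domain, matrices cannot be brought to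
  diagonal form; determinants, adjugates and Cramer's rule take the place of elementary
  divisors.\<close>

definition add_subgroup :: "'a::ab_group_add set \<Rightarrow> bool" where
  "add_subgroup H \<longleftrightarrow> 0 \<in> H \<and> (\<forall>x\<in>H. \<forall>y\<in>H. x - y \<in> H)"

definition translate :: "'a::ab_group_add set \<Rightarrow> 'a \<Rightarrow> 'a set" where
  "translate H x = (\<lambda>h. x + h) ` H"

text \<open>The value is \<open>0\<close> if there are infinitely many cosets.\<close>

definition sub_index :: "'a::ab_group_add set \<Rightarrow> 'a set \<Rightarrow> nat" where
  "sub_index K H = card (translate H ` K)"

definition finite_index :: "'a::ab_group_add set \<Rightarrow> 'a set \<Rightarrow> bool" where
  "finite_index K H \<longleftrightarrow> finite (translate H ` K)"

definition set_sum :: "'a::ab_group_add set \<Rightarrow> 'a set \<Rightarrow> 'a set" (infixl \<open>\<boxplus>\<close> 65) where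
  "A \<boxplus> B = {a + b | a b. a \<in> A \<and> b \<in> B}"

lemma set_sumI: "a \<in> A \<Longrightarrow> b \<in> B \<Longrightarrow> a + b \<in> A \<boxplus> B"
  unfolding set_sum_def by blast

lemma set_sumE:
  assumes "x \<in> A \<boxplus> B"
  obtains a b where "a \<in> A" "b \<in> B" "x = a + b"
  using assms unfolding set_sum_def by blast

lemma set_sum_mono: "A \<subseteq> A' \<Longrightarrow> B \<subseteq> B' \<Longrightarrow> A \<boxplus> B \<subseteq> A' \<boxplus> B'"
  unfolding set_sum_def by blast

lemma set_sum_assoc: "A \<boxplus> B \<boxplus> C = A \<boxplus> (B \<boxplus> C)"
proof (intro equalityI subsetI)
  fix x assume "x \<in> A \<boxplus> B \<boxplus> C"
  then obtain a b c where "a \<in> A" "b \<in> B" "c \<in> C" "x = (a + b) + c"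
    by (auto elim!: set_sumE)
  then show "x \<in> A \<boxplus> (B \<boxplus> C)"
    using set_sumI[of a A "b + c" "B \<boxplus> C"] set_sumI[of b B c C] by (simp add: add.assoc)
next
  fix x assume "x \<in> A \<boxplus> (B \<boxplus> C)"
  then obtain a b c where "a \<in> A" "b \<in> B" "c \<in> C" "x = a + (b + c)"
    by (auto elim!: set_sumE)
  then show "x \<in> A \<boxplus> B \<boxplus> C"
    using set_sumI[of "a + b" "A \<boxplus> B" c C] set_sumI[of a A b B] by (simp add: add.assoc)
qed

lemma set_sum_commute: "A \<boxplus> B = B \<boxplus> A"
proof -
  have "X \<boxplus> Y \<subseteq> Y \<boxplus> X" for X Y :: "'a set"
    by (auto elim!: set_sumE) (subst add.commute, rule set_sumI)
  then show ?thesis by blast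
qed

lemma add_subgroup_zero: "add_subgroup H \<Longrightarrow> 0 \<in> H"
  by (simp add: add_subgroup_def)

lemma add_subgroup_diff: "add_subgroup H \<Longrightarrow> x \<in> H \<Longrightarrow> y \<in> H \<Longrightarrow> x - y \<in> H"
  by (simp add: add_subgroup_def)

lemma add_subgroup_uminus: "add_subgroup H \<Longrightarrow> x \<in> H \<Longrightarrow> - x \<in> H"
  by (metis add_subgroup_zero add_subgroup_diff diff_0)

lemma add_subgroup_add: "add_subgroup H \<Longrightarrow> x \<in> H \<Longrightarrow> y \<in> H \<Longrightarrow> x + y \<in> H"
  by (metis add_subgroup_uminus add_subgroup_diff diff_minus_eq_add)

lemma add_subgroup_add_cancel: "add_subgroup H \<Longrightarrow> x + y \<in> H \<Longrightarrow> y \<in> H \<Longrightarrow> x \<in> H"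
  using add_subgroup_diff[of H "x + y" y] by simp

lemma add_subgroup_Int: "add_subgroup H \<Longrightarrow> add_subgroup K \<Longrightarrow> add_subgroup (H \<inter> K)"
  by (simp add: add_subgroup_def)

lemma add_subgroup_set_sum:
  assumes "add_subgroup H" "add_subgroup K"
  shows "add_subgroup (H \<boxplus> K)"
  unfolding add_subgroup_def
proof (intro conjI ballI)
  show "0 \<in> H \<boxplus> K"
    using set_sumI[OF add_subgroup_zero[OF assms(1)] add_subgroup_zero[OF assms(2)]] by simp
  fix x y assume "x \<in> H \<boxplus> K" "y \<in> H \<boxplus> K"
  then obtain a b c d where "a \<in> H" "b \<in> K" "c \<in> H" "d \<in> K" "x = a + b" "y = c + d"
    by (blast elim: set_sumE)
  then have "x - y = (a - c) + (b - d)" "a - c \<in> H" "b - d \<in> K"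
    using assms by (auto simp: add_subgroup_diff)
  then show "x - y \<in> H \<boxplus> K"
    by (simp add: set_sumI)
qed

lemma set_sum_upper1: "0 \<in> B \<Longrightarrow> A \<subseteq> A \<boxplus> B"
  using set_sumI[of _ A 0 B] by auto

lemma set_sum_upper2: "0 \<in> A \<Longrightarrow> B \<subseteq> A \<boxplus> B"
  using set_sumI[of 0 A _ B] by auto

lemma set_sum_least:
  assumes "A \<subseteq> K" "B \<subseteq> K" "add_subgroup K"
  shows "A \<boxplus> B \<subseteq> K"
  using assms by (auto elim!: set_sumE intro: add_subgroup_add)

lemma translate_eq_iff:
  assumes "add_subgroup H"
  shows "translate H x = translate H y \<longleftrightarrow> x - y \<in> H"
proof
  assume "translate H x = translate H y"
  moreover have "x \<in> translate H x"
    using add_subgroup_zero[OF assms] by (force simp: translate_def)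
  ultimately obtain h where "h \<in> H" "x = y + h"
    by (auto simp: translate_def)
  then show "x - y \<in> H" by simp
next
  assume "x - y \<in> H"
  have *: "translate H a \<subseteq> translate H b" if "a - b \<in> H" for a b
  proof
    fix z assume "z \<in> translate H a"
    then obtain h where "h \<in> H" "z = a + h" by (auto simp: translate_def)
    then have "z = b + ((a - b) + h)" "(a - b) + h \<in> H"
      using that assms by (auto simp: add_subgroup_add)
    then show "z \<in> translate H b" unfolding translate_def by blast
  qed
  show "translate H x = translate H y"
    using * \<open>x - y \<in> H\<close> add_subgroup_uminus[OF assms \<open>x - y \<in> H\<close>] by (auto simp: subset_antisym)
qed

text \<open>Cosets are counted by a complete invariant \<open>f\<close>, so that later index
  computations need neither representatives nor explicit bijections between sets of cosets.\<close>

lemma translate_classifier: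
  assumes "add_subgroup H"
    and "\<And>x y. x \<in> K \<Longrightarrow> y \<in> K \<Longrightarrow> f x = f y \<longleftrightarrow> x - y \<in> H"
  shows "sub_index K H = card (f ` K)" "finite_index K H \<longleftrightarrow> finite (f ` K)"
proof -
  define g where "g C = f (SOME y. y \<in> K \<and> translate H y = C)" for C
  have g: "g (translate H x) = f x" if "x \<in> K" for x
  proof -
    let ?y = "SOME y. y \<in> K \<and> translate H y = translate H x"
    have "?y \<in> K \<and> translate H ?y = translate H x"
      by (rule someI[of _ x]) (use that in auto)
    then show ?thesis
      unfolding g_def using assms that translate_eq_iff by metis
  qed
  have "bij_betw g (translate H ` K) (f ` K)"
    unfolding bij_betw_def
  proof
    show "inj_on g (translate H ` K)"
    proof (rule inj_onI)
      fix C D assume "C \<in> translate H ` K" "D \<in> translate H ` K" "g C = g D"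
      then obtain x y where "x \<in> K" "y \<in> K" "C = translate H x" "D = translate H y" "f x = f y"
        by (auto simp: g)
      then show "C = D"
        using assms(2) translate_eq_iff[OF assms(1)] by blast
    qed
    show "g ` translate H ` K = f ` K"
      using g by (auto simp: image_iff)
  qed
  then show "sub_index K H = card (f ` K)" "finite_index K H \<longleftrightarrow> finite (f ` K)"
    unfolding sub_index_def finite_index_def by (auto dest: bij_betw_same_card bij_betw_finite)
qed

lemma sub_index_pos: "finite_index K H \<Longrightarrow> x \<in> K \<Longrightarrow> 0 < sub_index K H"
  unfolding finite_index_def sub_index_def by (auto simp: card_gt_0_iff)

lemma index_tower:
  assumes "add_subgroup H" "add_subgroup G" "add_subgroup K" "H \<subseteq> G" "G \<subseteq> K"
  shows "sub_index K H = sub_index K G * sub_index G H"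
    and "finite_index K H \<longleftrightarrow> finite_index K G \<and> finite_index G H"
proof -
  define \<rho> where "\<rho> C = (SOME y. y \<in> K \<and> translate G y = C)" for C
  have \<rho>: "\<rho> (translate G x) \<in> K" "translate G (\<rho> (translate G x)) = translate G x" if "x \<in> K" for x
  proof -
    have "\<rho> (translate G x) \<in> K \<and> translate G (\<rho> (translate G x)) = translate G x"
      unfolding \<rho>_def by (rule someI[of _ x]) (use that in auto)
    then show "\<rho> (translate G x) \<in> K" "translate G (\<rho> (translate G x)) = translate G x" by auto
  qed
  \<comment> \<open>The coset of x modulo H is recorded as its coset modulo G together with the
    position of x relative to the chosen representative. This identifies the cosets with a product
    of two sets; infinite cardinalities count as 0, and the product formula survives that
    convention.\<close>
  define f where "f x = (translate G x, translate H (x - \<rho> (translate G x)))" for x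
  have f: "f x = f y \<longleftrightarrow> x - y \<in> H" for x y
  proof
    assume "f x = f y"
    then show "x - y \<in> H"
      by (auto simp: f_def translate_eq_iff[OF assms(1)])
  next
    assume "x - y \<in> H"
    then have "translate G x = translate G y"
      using assms translate_eq_iff by blast
    then show "f x = f y"
      using \<open>x - y \<in> H\<close> by (auto simp: f_def translate_eq_iff[OF assms(1)])
  qed
  have im: "f ` K = (translate G ` K) \<times> (translate H ` G)"
  proof (intro equalityI subsetI)
    fix z assume "z \<in> f ` K"
    then obtain x where x: "x \<in> K" "z = f x" by auto
    have "x - \<rho> (translate G x) \<in> G"
      using \<rho>[OF x(1)] translate_eq_iff[OF assms(2)] by metis
    then show "z \<in> (translate G ` K) \<times> (translate H ` G)"
      using x by (auto simp: f_def)
  next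
    fix z assume "z \<in> (translate G ` K) \<times> (translate H ` G)"
    then obtain x g where x: "x \<in> K" "g \<in> G" "z = (translate G x, translate H g)" by auto
    let ?y = "\<rho> (translate G x) + g"
    have "?y \<in> K" using \<rho>[OF x(1)] x assms add_subgroup_add by blast
    have "translate G ?y = translate G (\<rho> (translate G x))"
      using x by (simp add: translate_eq_iff[OF assms(2)])
    then have "translate G ?y = translate G x"
      using \<rho>[OF x(1)] by simp
    then have "f ?y = z"
      by (simp add: f_def x)
    then show "z \<in> f ` K" using \<open>?y \<in> K\<close> by blast
  qed
  have ne: "translate G ` K \<noteq> {}" "translate H ` G \<noteq> {}"
    using assms add_subgroup_zero by blast+
  show "sub_index K H = sub_index K G * sub_index G H"
    using translate_classifier(1)[OF assms(1) f, of K] im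
    by (simp add: card_cartesian_product sub_index_def)
  show "finite_index K H \<longleftrightarrow> finite_index K G \<and> finite_index G H"
    using translate_classifier(2)[OF assms(1) f, of K] im ne
    by (auto simp: finite_index_def finite_cartesian_product_iff)
qed

text \<open>The upper bounds for indices rest on this comparison: \<phi> induces a map from the
  cosets of H in K that reaches every coset of H' met by K'. It suffices that \<phi> is onto modulo
  H'.\<close>

lemma index_hom_image:
  assumes "add_subgroup H" "add_subgroup H'"
    and "\<And>x y. x \<in> K \<Longrightarrow> y \<in> K \<Longrightarrow> \<phi> (x - y) = \<phi> x - \<phi> y"
    and "\<And>x. x \<in> H \<Longrightarrow> \<phi> x \<in> H'"
    and "K' \<subseteq> \<phi> ` K \<boxplus> H'"
    and "finite_index K H"
  shows "finite_index K' H'" "sub_index K' H' \<le> sub_index K H"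
proof -
  define g where "g C = translate H' (\<phi> (SOME y. y \<in> K \<and> translate H y = C))" for C
  have g: "g (translate H x) = translate H' (\<phi> x)" if "x \<in> K" for x
  proof -
    let ?y = "SOME y. y \<in> K \<and> translate H y = translate H x"
    have y: "?y \<in> K \<and> translate H ?y = translate H x"
      by (rule someI[of _ x]) (use that in auto)
    then have "?y - x \<in> H"
      using translate_eq_iff[OF assms(1)] by blast
    then have "\<phi> ?y - \<phi> x \<in> H'"
      using assms(3,4) y that by metis
    then show ?thesis
      unfolding g_def using translate_eq_iff[OF assms(2)] by blast
  qed
  have sub: "translate H' ` K' \<subseteq> g ` (translate H ` K)"
  proof
    fix z assume "z \<in> translate H' ` K'"
    then obtain x where "x \<in> K'" "z = translate H' x" by auto
    then obtain k h where k: "k \<in> K" "h \<in> H'" "x = \<phi> k + h"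
      using assms(5) by (blast elim: set_sumE)
    then have "translate H' x = translate H' (\<phi> k)"
      by (simp add: translate_eq_iff[OF assms(2)])
    then show "z \<in> g ` (translate H ` K)"
      using g[OF k(1)] k \<open>z = _\<close> by force
  qed
  have fin: "finite (g ` (translate H ` K))"
    using assms(6) unfolding finite_index_def by blast
  show "finite_index K' H'"
    using fin sub finite_subset unfolding finite_index_def by blast
  have "card (translate H' ` K') \<le> card (g ` (translate H ` K))"
    using fin sub card_mono by blast
  also have "\<dots> \<le> card (translate H ` K)"
    using assms(6) unfolding finite_index_def by (rule card_image_le)
  finally show "sub_index K' H' \<le> sub_index K H"
    unfolding sub_index_def .
qed

lemma index_larger_sub:
  assumes "add_subgroup H" "add_subgroup H'" "H \<subseteq> H'" "finite_index K H"
  shows "finite_index K H'" "sub_index K H' \<le> sub_index K H"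
proof -
  have 1: "K \<subseteq> (\<lambda>x. x) ` K \<boxplus> H'"
    using set_sum_upper1[OF add_subgroup_zero[OF assms(2)], of K] by simp
  have 2: "x \<in> H'" if "x \<in> H" for x using that assms by auto
  show "finite_index K H'" "sub_index K H' \<le> sub_index K H"
    using index_hom_image[OF assms(1,2) _ 2 1 assms(4)] by auto
qed

lemma index_second_iso:
  assumes "add_subgroup K" "add_subgroup G"
  shows "sub_index K (K \<inter> G) = sub_index (K \<boxplus> G) G"
    "finite_index K (K \<inter> G) \<longleftrightarrow> finite_index (K \<boxplus> G) G"
proof -
  have f: "translate G x = translate G y \<longleftrightarrow> x - y \<in> K \<inter> G" if "x \<in> K" "y \<in> K" for x y
    using that assms by (simp add: translate_eq_iff add_subgroup_diff)
  have "translate G ` (K \<boxplus> G) = translate G ` K"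
  proof (intro equalityI subsetI)
    fix z assume "z \<in> translate G ` (K \<boxplus> G)"
    then obtain k g where "k \<in> K" "g \<in> G" "z = translate G (k + g)"
      by (blast elim: set_sumE)
    then have "z = translate G k"
      by (simp add: translate_eq_iff[OF assms(2)])
    then show "z \<in> translate G ` K" using \<open>k \<in> K\<close> by blast
  next
    fix z assume "z \<in> translate G ` K"
    then show "z \<in> translate G ` (K \<boxplus> G)"
      using set_sum_upper1[OF add_subgroup_zero[OF assms(2)]] by blast
  qed
  then show "sub_index K (K \<inter> G) = sub_index (K \<boxplus> G) G"
    "finite_index K (K \<inter> G) \<longleftrightarrow> finite_index (K \<boxplus> G) G"
    using translate_classifier[OF add_subgroup_Int[OF assms] f]
    by (simp_all add: sub_index_def finite_index_def)
qed

subsection \<open>Laurent polynomials\<close>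

alias lookup = Poly_Mapping.lookup

definition monom_t :: "int \<Rightarrow> laurent" where
  "monom_t k = Poly_Mapping.single k 1"

lemma monom_t_add: "monom_t (k + l) = monom_t k * monom_t l"
  by (simp add: monom_t_def mult_single)

lemma monom_t_0 [simp]: "monom_t 0 = 1"
  by (simp add: monom_t_def)

lemma laurent_t_power: "laurent_t ^ n = monom_t (int n)"
  by (induction n) (simp_all add: laurent_t_def monom_t_def mult_single)

lemma monom_t_power: "monom_t k ^ n = monom_t (k * int n)"
  by (induction n) (simp_all add: monom_t_add[symmetric] algebra_simps)

lemma monom_t_unit: "monom_t k * monom_t (- k) = 1"
  by (simp add: monom_t_add[symmetric])

text \<open>A Laurent polynomial is an element of the free abelian group on its exponents, so an
  additive statement has to be checked on monomials only.\<close>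

lemma laurent_induct [case_names zero monom diff]:
  assumes "P 0" "\<And>k. P (monom_t k)" "\<And>f g. P f \<Longrightarrow> P g \<Longrightarrow> P (f - g)"
  shows "P (f :: laurent)"
  using frag_induction[of f UNIV P] assms by (simp add: monom_t_def)

lemma lookup_monom_t_mult: "lookup (monom_t k * f) n = lookup f (n - k)"
proof (induction f rule: laurent_induct)
  case (monom l)
  then show ?case
    by (simp add: monom_t_add[symmetric]) (simp add: monom_t_def lookup_single when_def)
next
  case (diff f g)
  then show ?case by (simp add: right_diff_distrib lookup_minus)
qed simp

lemma lookup_of_int_mult: "lookup (of_int c * f :: laurent) n = c * lookup f n"
proof (induction f rule: laurent_induct)
  case (monom l)
  have "Poly_Mapping.single 0 (of_int c) = (of_int c :: laurent)"
    by (rule single_of_int)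
  then have "of_int c = (Poly_Mapping.single 0 c :: laurent)"
    by simp
  then show ?case
    by (simp add: monom_t_def mult_single lookup_single when_def)
next
  case (diff f g)
  then show ?case by (simp add: right_diff_distrib lookup_minus)
qed simp

lemma of_int_dvd_laurent_iff: "of_int c dvd (f :: laurent) \<longleftrightarrow> (\<forall>n. c dvd lookup f n)"
proof
  assume "of_int c dvd f"
  then show "\<forall>n. c dvd lookup f n"
    by (auto simp: lookup_of_int_mult elim!: dvdE)
next
  assume *: "\<forall>n. c dvd lookup f n"
  define g where "g = Poly_Mapping.map (\<lambda>a. a div c) f"
  have "lookup g n = lookup f n div c" for n
    by (simp add: g_def Poly_Mapping.map.rep_eq when_def)
  then have "f = of_int c * g"
    using * by (intro poly_mapping_eqI) (simp add: lookup_of_int_mult)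
  then show "of_int c dvd f" by simp
qed

lemma laurent_of_poly_coeff: "lookup (laurent_of_poly P) n = (if n < 0 then 0 else coeff P (nat n))"
proof -
  have "lookup (laurent_of_poly P) n = (\<Sum>i\<le>degree P. if n = int i then coeff P i else 0)"
    by (simp add: laurent_of_poly_def lookup_sum lookup_single when_def eq_commute)
  also have "\<dots> = (\<Sum>i\<le>degree P. if i = nat n then (if n < 0 then 0 else coeff P i) else 0)"
    by (rule sum.cong) auto
  also have "\<dots> = (if n < 0 then 0 else coeff P (nat n))"
    by (auto simp: sum.delta coeff_eq_0)
  finally show ?thesis .
qed

lemma laurent_of_poly_add: "laurent_of_poly (P + Q) = laurent_of_poly P + laurent_of_poly Q"
  by (rule poly_mapping_eqI) (simp add: laurent_of_poly_coeff lookup_add)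

lemma laurent_of_poly_smult: "laurent_of_poly (smult c P) = of_int c * laurent_of_poly P"
  by (rule poly_mapping_eqI) (simp add: laurent_of_poly_coeff lookup_of_int_mult)

lemma laurent_of_poly_pCons: "laurent_of_poly (pCons a P) = of_int a + monom_t 1 * laurent_of_poly P"
  by (rule poly_mapping_eqI)
    (auto simp: laurent_of_poly_coeff lookup_monom_t_mult lookup_add lookup_of_int coeff_pCons
      nat_diff_distrib' when_def split: nat.splits)

lemma laurent_of_poly_0 [simp]: "laurent_of_poly 0 = 0"
  by (rule poly_mapping_eqI) (simp add: laurent_of_poly_coeff)

lemma laurent_of_poly_mult: "laurent_of_poly (P * Q) = laurent_of_poly P * laurent_of_poly Q"
proof (induction P)
  case (pCons a P)
  have "laurent_of_poly (pCons a P * Q) = of_int a * laurent_of_poly Q + monom_t 1 * laurent_of_poly (P * Q)"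
    by (simp add: laurent_of_poly_add laurent_of_poly_smult laurent_of_poly_pCons)
  then show ?case
    using pCons by (simp add: laurent_of_poly_pCons algebra_simps)
qed simp

text \<open>Powers of t are units, so divisibility questions can be moved into the polynomial
  ring.\<close>

lemma laurent_eq_shifted_poly: "\<exists>k P. f = monom_t k * laurent_of_poly P"
proof (induction f rule: laurent_induct)
  case zero
  show ?case by (rule exI, rule exI[of _ 0]) simp
next
  case (monom k)
  have "laurent_of_poly [:1:] = 1"
    by (simp add: laurent_of_poly_pCons)
  then show ?case by (intro exI[of _ k] exI[of _ "[:1:]"]) simp
next
  case (diff f g)
  then obtain k P l Q where f: "f = monom_t k * laurent_of_poly P" and g: "g = monom_t l * laurent_of_poly Q"
    by auto
  have up: "\<exists>Q'. monom_t (a + int n) * laurent_of_poly Q = monom_t a * laurent_of_poly Q'" for a n Q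
  proof (induction n arbitrary: Q)
    case (Suc n)
    have "monom_t (a + int (Suc n)) * laurent_of_poly Q = monom_t (a + int n) * laurent_of_poly (pCons 0 Q)"
      by (simp add: laurent_of_poly_pCons monom_t_add algebra_simps)
    then show ?case using Suc by metis
  qed auto
  obtain P' where P': "f = monom_t (min k l) * laurent_of_poly P'"
    using up[of "min k l" "nat (k - min k l)" P] f by auto
  obtain Q' where Q': "g = monom_t (min k l) * laurent_of_poly Q'"
    using up[of "min k l" "nat (l - min k l)" Q] g by auto
  have "laurent_of_poly (P' - Q') = laurent_of_poly P' - laurent_of_poly Q'"
    by (rule poly_mapping_eqI) (simp add: laurent_of_poly_coeff lookup_minus)
  then have "f - g = monom_t (min k l) * laurent_of_poly (P' - Q')"
    using P' Q' by (simp only: right_diff_distrib)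
  then show ?case by blast
qed

lemma of_int_dvd_monom_t_mult: "of_int c dvd monom_t k * f \<longleftrightarrow> of_int c dvd (f :: laurent)"
  by (metis (no_types, lifting) dvd_mult dvd_mult_left mult.assoc mult.commute mult.right_neutral monom_t_unit dvd_trans dvd_triv_left)

lemma of_int_dvd_laurent_of_poly: "of_int c dvd laurent_of_poly P \<longleftrightarrow> [:c:] dvd P"
proof -
  have "(\<forall>n. c dvd lookup (laurent_of_poly P) n) \<longleftrightarrow> (\<forall>n. c dvd coeff P n)"
  proof
    assume *: "\<forall>n. c dvd lookup (laurent_of_poly P) n"
    show "\<forall>n. c dvd coeff P n"
    proof
      fix n show "c dvd coeff P n"
        using *[rule_format, of "int n"] by (simp add: laurent_of_poly_coeff)
    qed
  qed (auto simp: laurent_of_poly_coeff)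
  then show ?thesis
    by (simp add: of_int_dvd_laurent_iff const_poly_dvd_iff)
qed

text \<open>Gauss's lemma: a prime number stays prime in Z[t], and shifting by units brings both
  factors there.\<close>

lemma prime_dvd_laurent_mult:
  assumes "prime (p :: int)" "of_int p dvd (f * g :: laurent)"
  shows "of_int p dvd f \<or> of_int p dvd g"
proof -
  obtain k P l Q where f: "f = monom_t k * laurent_of_poly P" and g: "g = monom_t l * laurent_of_poly Q"
    using laurent_eq_shifted_poly by metis
  have "f * g = monom_t (k + l) * laurent_of_poly (P * Q)"
    by (simp add: f g laurent_of_poly_mult monom_t_add algebra_simps)
  then have "[:p:] dvd P * Q"
    using assms(2) by (simp add: of_int_dvd_monom_t_mult of_int_dvd_laurent_of_poly)
  moreover have "prime_elem [:p:]"
    using assms(1) by (intro lift_prime_elem_poly prime_imp_prime_elem)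
  ultimately have "[:p:] dvd P \<or> [:p:] dvd Q"
    using prime_elem_dvd_mult_iff by blast
  then show ?thesis
    by (simp add: f g of_int_dvd_monom_t_mult of_int_dvd_laurent_of_poly)
qed

lemma not_prime_dvd_binomial:
  assumes "prime (p :: int)" "0 < r"
  shows "\<not> of_int p dvd (laurent_t ^ r - 1)"
proof
  assume "of_int p dvd (laurent_t ^ r - 1)"
  then have "p dvd lookup (laurent_t ^ r - 1) (int r)"
    by (simp add: of_int_dvd_laurent_iff)
  then show False
    using assms not_prime_unit[of p]
    by (simp add: laurent_t_power monom_t_def lookup_minus lookup_one when_def)
qed

lemma prime_power_dvd_laurent_mult:
  assumes "prime (p :: int)" "of_int p ^ n dvd (f * g :: laurent)" "\<not> of_int p dvd f"
  shows "of_int p ^ n dvd g"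
  using assms(2)
proof (induction n)
  case (Suc n)
  have "of_int p ^ n dvd f * g" 
    using Suc.prems by (metis dvd_mult_right power_Suc)
  then obtain h where h: "g = of_int p ^ n * h"
    using Suc.IH by (auto elim: dvdE)
  have "of_int p ^ n * of_int p dvd of_int p ^ n * (f * h)"
    using Suc.prems by (simp add: h algebra_simps)
  moreover have "p \<noteq> 0"
    using assms(1) by auto
  ultimately have "of_int p dvd f * h"
    by simp
  then have "of_int p dvd h"
    using prime_dvd_laurent_mult[OF assms(1)] assms(3) by blast
  then show ?case
    by (auto simp: h mult.commute intro: mult_dvd_mono)
qed simp

text \<open>The combinations of 1, ..., t^(d-1) with coefficients in {0..<m} represent all cosets,
  since m annihilates the quotient by H.\<close>

lemma finite_index_if_generated:
  fixes H :: "laurent set"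
  assumes H: "add_subgroup H" and m: "0 < m" "\<And>f. of_int m * f \<in> H"
    and gen: "\<And>f. \<exists>c. f - (\<Sum>i<d. of_int (c i) * monom_t (int i)) \<in> H"
  shows "finite_index UNIV H"
proof -
  define S where "S = (\<lambda>c. \<Sum>i<d. of_int (c i) * monom_t (int i)) ` ({..<d} \<rightarrow>\<^sub>E {0..<m})"
  have "finite S"
    unfolding S_def by (intro finite_imageI finite_PiE) auto
  have "translate H ` UNIV \<subseteq> translate H ` S"
  proof
    fix C assume "C \<in> translate H ` UNIV"
    then obtain f where f: "C = translate H f" by auto
    obtain c where c: "f - (\<Sum>i<d. of_int (c i) * monom_t (int i)) \<in> H" using gen by blast
    define e where "e = restrict (\<lambda>i. c i mod m) {..<d}"
    have "of_int (c i) = of_int (c i mod m) + of_int m * (of_int (c i div m) :: laurent)" for i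
      by (metis add.commute mod_mult_div_eq of_int_add of_int_mult)
    then have "(\<Sum>i<d. of_int (c i) * monom_t (int i)) - (\<Sum>i<d. of_int (e i) * monom_t (int i))
      = of_int m * (\<Sum>i<d. of_int (c i div m) * monom_t (int i))"
      by (simp add: e_def sum_subtractf[symmetric] sum_distrib_left algebra_simps)
    then have "(\<Sum>i<d. of_int (c i) * monom_t (int i)) - (\<Sum>i<d. of_int (e i) * monom_t (int i)) \<in> H"
      using m by simp
    then have "f - (\<Sum>i<d. of_int (e i) * monom_t (int i)) \<in> H"
      using add_subgroup_add[OF H c] by fastforce
    then have "C = translate H (\<Sum>i<d. of_int (e i) * monom_t (int i))"
      using f translate_eq_iff[OF H] by blast
    moreover have "e \<in> {..<d} \<rightarrow>\<^sub>E {0..<m}"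
      using m by (auto simp: e_def)
    ultimately show "C \<in> translate H ` S" unfolding S_def by blast
  qed
  then show ?thesis
    unfolding finite_index_def using \<open>finite S\<close> finite_subset by blast
qed


section \<open>Ideals with two generators and their finite quotients\<close>

definition ideal2 :: "'a::comm_ring_1 \<Rightarrow> 'a \<Rightarrow> 'a set" where
  "ideal2 u v = {u * a + v * b | a b. True}"

lemma ideal2I: "u * a + v * b \<in> ideal2 u v"
  unfolding ideal2_def by blast

lemma ideal2_snd: "v * b \<in> ideal2 u v"
  using ideal2I[of u 0 v b] by simp

lemma ideal2_mult:
  assumes "x \<in> ideal2 u v"
  shows "c * x \<in> ideal2 u v"
proof -
  obtain a b where "x = u * a + v * b"
    using assms unfolding ideal2_def by blast
  then have "c * x = u * (c * a) + v * (c * b)"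
    by (simp add: algebra_simps)
  then show ?thesis by (simp only: ideal2I)
qed

lemma add_subgroup_ideal2: "add_subgroup (ideal2 u v)"
  unfolding add_subgroup_def
proof (intro conjI ballI)
  show "0 \<in> ideal2 u v" using ideal2I[of u 0 v 0] by simp
  fix x y assume "x \<in> ideal2 u v" "y \<in> ideal2 u v"
  then obtain a b c d where "x = u * a + v * b" "y = u * c + v * d"
    unfolding ideal2_def by blast
  then have "x - y = u * (a - c) + v * (b - d)" by (simp add: algebra_simps)
  then show "x - y \<in> ideal2 u v" by (simp add: ideal2I)
qed

text \<open>Modulo p the lowest and the highest surviving coefficients of s are invertible. Solving
  the relation s = 0 for either extreme monomial shows that 1, ..., t^(d-1) span a subgroup stable
  under t and its inverse, where d is the distance between the two exponents.\<close>

lemma finite_index_prime_ideal2: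
  assumes p: "prime (p :: int)" and s: "\<not> of_int p dvd (s :: laurent)"
  shows "finite_index UNIV (ideal2 s (of_int p))"
proof -
  let ?H = "ideal2 s (of_int p)"
  note H = add_subgroup_ideal2[of s "of_int p"]
  define K where "K = {n. \<not> p dvd lookup s n}"
  have "K \<subseteq> Poly_Mapping.keys s"
    by (auto simp: K_def in_keys_iff)
  then have "finite K" by (rule finite_subset) simp
  have "K \<noteq> {}" using s by (auto simp: K_def of_int_dvd_laurent_iff)
  define lo hi where "lo = Min K" and "hi = Max K"
  have lohi: "lo \<in> K" "hi \<in> K" "\<And>n. n \<in> K \<Longrightarrow> lo \<le> n \<and> n \<le> hi"
    using \<open>finite K\<close> \<open>K \<noteq> {}\<close> by (auto simp: lo_def hi_def)
  define d where "d = nat (hi - lo)"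
  have hi: "hi = lo + int d" using lohi(3)[OF lohi(1)] by (simp add: d_def)
  define \<sigma> where "\<sigma> i = lookup s (lo + int i)" for i
  have coprime_ends: "\<exists>a u. a * \<sigma> i = 1 + p * u" if "i = 0 \<or> i = d" for i
  proof -
    have "\<not> p dvd \<sigma> i" using that lohi(1,2) hi by (auto simp: K_def \<sigma>_def)
    then have "coprime p (\<sigma> i)" using p by (simp add: prime_imp_coprime)
    then obtain x y where "x * p + y * \<sigma> i = 1"
      by (metis bezout_int coprime_iff_gcd_eq_1)
    then have "y * \<sigma> i = 1 + p * (- x)" by (simp add: algebra_simps)
    then show ?thesis by blast
  qed
  \<comment> \<open>Cutting s off outside the range from \<open>lo\<close> to \<open>hi\<close>
    removes only multiples of p; a power of t then moves the relation to any exponent k.\<close>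
  have rel: "(\<Sum>i\<le>d. of_int (\<sigma> i) * monom_t (k + int i)) \<in> ?H" for k
  proof -
    have "of_int p dvd s - (\<Sum>i\<le>d. of_int (\<sigma> i) * monom_t (lo + int i))"
      unfolding of_int_dvd_laurent_iff
    proof
      fix n
      have "lookup (\<Sum>i\<le>d. of_int (\<sigma> i) * monom_t (lo + int i)) n
        = (\<Sum>i\<le>d. if lo + int i = n then lookup s n else 0)"
        by (auto simp: lookup_sum lookup_of_int_mult monom_t_def \<sigma>_def intro!: sum.cong)
      also have "\<dots> = (\<Sum>i\<le>d. if i = nat (n - lo) then (if lo \<le> n then lookup s n else 0) else 0)"
        by (rule sum.cong) auto
      also have "\<dots> = (if lo \<le> n \<and> n \<le> hi then lookup s n else 0)"
        using hi by (auto simp: sum.delta)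
      finally show "p dvd lookup (s - (\<Sum>i\<le>d. of_int (\<sigma> i) * monom_t (lo + int i))) n"
        using lohi(3)[of n] by (auto simp: lookup_minus K_def)
    qed
    then obtain u where "s - (\<Sum>i\<le>d. of_int (\<sigma> i) * monom_t (lo + int i)) = of_int p * u"
      by (auto elim: dvdE)
    then have "(\<Sum>i\<le>d. of_int (\<sigma> i) * monom_t (lo + int i)) = s * 1 + of_int p * (- u)"
      by (simp add: algebra_simps)
    then have "monom_t (k - lo) * (\<Sum>i\<le>d. of_int (\<sigma> i) * monom_t (lo + int i)) \<in> ?H"
      using ideal2I ideal2_mult by metis
    moreover have "monom_t (k - lo) * (\<Sum>i\<le>d. of_int (\<sigma> i) * monom_t (lo + int i))
      = (\<Sum>i\<le>d. of_int (\<sigma> i) * monom_t (k + int i))"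
      unfolding sum_distrib_left
      by (rule sum.cong) (auto simp: monom_t_add[symmetric] mult.left_commute[of "monom_t _"])
    ultimately show ?thesis by simp
  qed
  define T where "T = {f. \<exists>c. f - (\<Sum>i<d. of_int (c i) * monom_t (int i)) \<in> ?H}"
  have T_H: "f \<in> T" if "f \<in> ?H" for f
    unfolding T_def using that by (auto intro!: exI[of _ "\<lambda>_. 0"])
  have T: "add_subgroup T"
    unfolding add_subgroup_def
  proof (intro conjI ballI)
    show "0 \<in> T" using T_H add_subgroup_zero[OF H] by blast
    fix f g assume "f \<in> T" "g \<in> T"
    then obtain c e where "f - (\<Sum>i<d. of_int (c i) * monom_t (int i)) \<in> ?H"
      "g - (\<Sum>i<d. of_int (e i) * monom_t (int i)) \<in> ?H"
      unfolding T_def by blast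
    from add_subgroup_diff[OF H this]
    have "(f - g) - (\<Sum>i<d. of_int (c i - e i) * monom_t (int i)) \<in> ?H"
      by (simp add: algebra_simps sum_subtractf)
    then show "f - g \<in> T"
      unfolding T_def mem_Collect_eq by (rule exI[of _ "\<lambda>i. c i - e i"])
  qed
  have T_int: "of_int a * f \<in> T" if "f \<in> T" for f a
  proof -
    from that obtain c where "f - (\<Sum>i<d. of_int (c i) * monom_t (int i)) \<in> ?H"
      by (auto simp: T_def)
    from ideal2_mult[OF this, of "of_int a"]
    have "of_int a * f - (\<Sum>i<d. of_int (a * c i) * monom_t (int i)) \<in> ?H"
      by (simp add: right_diff_distrib sum_distrib_left mult.assoc)
    then show ?thesis unfolding T_def by (blast intro: exI[of _ "\<lambda>i. a * c i"])
  qed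
  have T_sum: "sum g A \<in> T" if "\<And>i. i \<in> A \<Longrightarrow> g i \<in> T" for g :: "nat \<Rightarrow> laurent" and A
    using that
    by (induction A rule: infinite_finite_induct) (auto simp: add_subgroup_zero[OF T] add_subgroup_add[OF T])
  have T_base: "monom_t (int i) \<in> T" if "i < d" for i
  proof -
    have "(\<Sum>j<d. of_int (if j = i then 1 else 0) * monom_t (int j)) = (\<Sum>j<d. if j = i then monom_t (int j) else 0)"
      by (rule sum.cong) auto
    then have "monom_t (int i) - (\<Sum>j<d. of_int (if j = i then 1 else 0) * monom_t (int j)) = 0"
      using that by (simp add: sum.delta)
    then show ?thesis unfolding T_def
      by (intro CollectI exI[of _ "\<lambda>j. if j = i then 1 else 0"]) (simp add: add_subgroup_zero[OF H])
  qed
  \<comment> \<open>The extreme coefficient is inverted modulo p by a, and the multiple of p that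
    arises lies in the ideal. The case i = d yields stability under t, the case i = 0 under its
    inverse.\<close>
  have ends: "monom_t (k + int i) \<in> T"
    if i: "i = 0 \<or> i = d" and others: "\<And>j. j \<le> d \<Longrightarrow> j \<noteq> i \<Longrightarrow> monom_t (k + int j) \<in> T" for i k
  proof -
    obtain a u where au: "a * \<sigma> i = 1 + p * u" using coprime_ends[OF i] by blast
    have "i \<le> d" using i by auto
    then have "(\<Sum>j\<le>d. of_int (\<sigma> j) * monom_t (k + int j))
      = of_int (\<sigma> i) * monom_t (k + int i) + (\<Sum>j\<in>{..d} - {i}. of_int (\<sigma> j) * monom_t (k + int j))"
      by (subst sum.remove[of _ i]) auto
    then have "of_int (\<sigma> i) * monom_t (k + int i)
      + (\<Sum>j\<in>{..d} - {i}. of_int (\<sigma> j) * monom_t (k + int j)) \<in> T"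
      using T_H[OF rel[of k]] by simp
    moreover have "(\<Sum>j\<in>{..d} - {i}. of_int (\<sigma> j) * monom_t (k + int j)) \<in> T"
      using others by (intro T_sum T_int) auto
    ultimately have "of_int (\<sigma> i) * monom_t (k + int i) \<in> T"
      by (rule add_subgroup_add_cancel[OF T])
    then have "of_int (a * \<sigma> i) * monom_t (k + int i) \<in> T"
      using T_int[of _ a] by (simp add: mult.assoc)
    then have "monom_t (k + int i) + of_int p * (of_int u * monom_t (k + int i)) \<in> T"
      by (simp add: au algebra_simps)
    moreover have "of_int p * (of_int u * monom_t (k + int i)) \<in> T"
      by (rule T_H[OF ideal2_snd])
    ultimately show ?thesis
      by (rule add_subgroup_add_cancel[OF T])
  qed
  have "monom_t (int d) \<in> T"
    using ends[of d 0] T_base by auto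
  then have T_le: "monom_t (int i) \<in> T" if "i \<le> d" for i
    using T_base that by (cases "i = d") auto
  have shift: "monom_t l * f \<in> T" if "f \<in> T" and l: "\<And>i. i < d \<Longrightarrow> monom_t (l + int i) \<in> T" for f l
  proof -
    from that(1) obtain c where c: "f - (\<Sum>i<d. of_int (c i) * monom_t (int i)) \<in> ?H"
      by (auto simp: T_def)
    have e: "monom_t l * f = monom_t l * (f - (\<Sum>i<d. of_int (c i) * monom_t (int i)))
       + (\<Sum>i<d. of_int (c i) * monom_t (l + int i))"
      by (simp add: right_diff_distrib sum_distrib_left monom_t_add mult.left_commute[of "monom_t _"])
    have "(\<Sum>i<d. of_int (c i) * monom_t (l + int i)) \<in> T"
      using l by (intro T_sum T_int) auto
    then show ?thesis
      by (subst e) (rule add_subgroup_add[OF T T_H[OF ideal2_mult[OF c]]])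
  qed
  have up: "monom_t 1 * f \<in> T" if "f \<in> T" for f
  proof (rule shift[OF that])
    fix i assume "i < d"
    then show "monom_t (1 + int i) \<in> T" using T_le[of "Suc i"] by simp
  qed
  have "monom_t (- 1) \<in> T"
  proof -
    have "monom_t (- 1 + int 0) \<in> T"
    proof (rule ends)
      fix j assume "j \<le> d" "j \<noteq> 0"
      then have "- 1 + int j = int (j - 1)" "j - 1 \<le> d" by auto
      then show "monom_t (- 1 + int j) \<in> T" using T_le[of "j - 1"] by (simp only:)
    qed simp
    then show ?thesis by simp
  qed
  have down: "monom_t (- 1) * f \<in> T" if "f \<in> T" for f
  proof (rule shift[OF that])
    fix i assume "i < d"
    show "monom_t (- 1 + int i) \<in> T"
    proof (cases "i = 0")
      case False
      then have "- 1 + int i = int (i - 1)" "i - 1 \<le> d" using \<open>i < d\<close> by auto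
      then show ?thesis using T_le[of "i - 1"] by (simp only:)
    qed (use \<open>monom_t (- 1) \<in> T\<close> in simp)
  qed
  have pos: "monom_t (int n) \<in> T" for n
  proof (induction n)
    case 0 then show ?case using T_le[of 0] by simp
  next
    case (Suc n) then show ?case using up[OF Suc] by (simp add: monom_t_add)
  qed
  have neg: "monom_t (- int n) \<in> T" for n
  proof (induction n)
    case 0 then show ?case using T_le[of 0] by simp
  next
    case (Suc n)
    have "monom_t (- int (Suc n)) = monom_t (- 1) * monom_t (- int n)"
      by (simp add: monom_t_add[symmetric])
    then show ?case using down[OF Suc] by simp
  qed
  have "f \<in> T" for f
  proof (induction f rule: laurent_induct)
    case (monom k)
    then show ?case using pos neg by (cases k rule: int_cases2) auto
  qed (auto simp: add_subgroup_zero[OF T] add_subgroup_diff[OF T])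
  then show ?thesis
    using finite_index_if_generated[OF H, of p d] prime_gt_0_int[OF p] ideal2_snd
    by (force simp: T_def)
qed

lemma monom_t_minus_one_dvd: "\<exists>a. monom_t (k * q) - 1 = (monom_t k - 1) * a"
proof -
  have nat: "\<exists>a. monom_t (k * int n) - 1 = (monom_t k - 1) * a" for n
    using power_diff_1_eq[of "monom_t k" n] by (auto simp: monom_t_power)
  show ?thesis
  proof (cases q rule: int_cases2)
    case (nonneg n) then show ?thesis using nat by simp
  next
    case (nonpos n)
    obtain a where a: "monom_t (k * int n) - 1 = (monom_t k - 1) * a" using nat by blast
    have "monom_t (k * q) - 1 = - monom_t (k * q) * (monom_t (k * int n) - 1)"
      by (simp add: nonpos right_diff_distrib monom_t_add[symmetric])
    also have "\<dots> = (monom_t k - 1) * (- monom_t (k * q) * a)"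
      by (simp only: a) (simp add: algebra_simps)
    finally show ?thesis by blast
  qed
qed

text \<open>The quotient is the group ring over Z/m of the cyclic group of order r, hence has m^r
  elements. With m = p this is where the growth p^r for each factor p originates.\<close>

lemma index_binomial_ideal2:
  assumes r: "0 < r" and m: "0 < (m :: int)"
  shows "finite_index UNIV (ideal2 (laurent_t ^ r - 1) (of_int m))"
    "sub_index UNIV (ideal2 (laurent_t ^ r - 1) (of_int m)) = nat m ^ r"
proof -
  let ?b = "laurent_t ^ r - 1"
  \<comment> \<open>Exponents are reduced modulo r, additively over the free abelian group on the
    exponents. This is a normal form for t^r = 1: \<rho> changes f by a multiple of t^r - 1 and
    vanishes on all such multiples.\<close>
  define \<rho> where "\<rho> = frag_extend (\<lambda>k. monom_t (k mod int r))"
  have \<rho>_diff: "\<rho> (f - g) = \<rho> f - \<rho> g" for f g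
    by (simp add: \<rho>_def frag_extend_diff)
  have \<rho>_0 [simp]: "\<rho> 0 = 0" by (simp add: \<rho>_def)
  have \<rho>_monom: "\<rho> (monom_t k) = monom_t (k mod int r)" for k
    by (simp add: \<rho>_def monom_t_def)
  have \<rho>_int: "\<rho> (of_int c * f) = of_int c * \<rho> f" for c f
  proof (induction f rule: laurent_induct)
    case (monom k)
    have "of_int c * monom_t k = frag_cmul c (monom_t k)"
      by (rule poly_mapping_eqI) (simp add: lookup_of_int_mult)
    moreover have "frag_cmul c (\<rho> (monom_t k)) = of_int c * \<rho> (monom_t k)"
      by (rule poly_mapping_eqI) (simp add: lookup_of_int_mult)
    ultimately show ?case by (simp add: \<rho>_def frag_extend_cmul)
  qed (simp_all add: right_diff_distrib \<rho>_diff)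
  have \<rho>_cong: "\<exists>a. f - \<rho> f = ?b * a" for f
  proof (induction f rule: laurent_induct)
    case (monom k)
    obtain a where a: "monom_t (int r * (k div int r)) - 1 = (monom_t (int r) - 1) * a"
      using monom_t_minus_one_dvd by blast
    have "monom_t k = monom_t (k mod int r) * monom_t (int r * (k div int r))"
      by (simp add: monom_t_add[symmetric])
    then have "monom_t k - \<rho> (monom_t k) = monom_t (k mod int r) * (monom_t (int r * (k div int r)) - 1)"
      unfolding \<rho>_monom right_diff_distrib by simp
    then show ?case
      by (auto simp: a laurent_t_power intro!: exI[of _ "monom_t (k mod int r) * a"])
  next
    case (diff f g)
    then obtain a b where ab: "f - \<rho> f = ?b * a" "g - \<rho> g = ?b * b" by auto
    have "(f - g) - \<rho> (f - g) = ?b * (a - b)"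
      unfolding \<rho>_diff right_diff_distrib by (simp only: ab [symmetric]) (simp add: algebra_simps)
    then show ?case by blast
  qed (auto intro: exI[of _ 0])
  have \<rho>_kill: "\<rho> (?b * f) = 0" for f
  proof (induction f rule: laurent_induct)
    case (monom k)
    then show ?case
      by (simp add: laurent_t_power left_diff_distrib \<rho>_diff monom_t_add[symmetric] \<rho>_monom)
  qed (simp_all only: right_diff_distrib \<rho>_diff mult_zero_right \<rho>_0 diff_self)
  have \<rho>_supp: "lookup (\<rho> f) n = 0" if "n < 0 \<or> int r \<le> n" for f n
  proof (induction f rule: laurent_induct)
    case (monom k)
    have "0 \<le> k mod int r" "k mod int r < int r" using r by auto
    then show ?case using that unfolding \<rho>_monom by (auto simp: monom_t_def)
  qed (simp_all add: \<rho>_diff lookup_minus)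
  have mem: "f \<in> ideal2 ?b (of_int m) \<longleftrightarrow> (\<forall>j<r. m dvd lookup (\<rho> f) (int j))" for f
  proof
    assume "f \<in> ideal2 ?b (of_int m)"
    then obtain a b where "f = ?b * a - of_int m * b"
      unfolding ideal2_def by (auto) (metis diff_minus_eq_add mult_minus_right)
    then have "\<rho> f = of_int m * (- \<rho> b)"
      by (simp add: \<rho>_diff \<rho>_kill \<rho>_int)
    then show "\<forall>j<r. m dvd lookup (\<rho> f) (int j)"
      by (simp only: lookup_of_int_mult dvd_triv_left) simp
  next
    assume *: "\<forall>j<r. m dvd lookup (\<rho> f) (int j)"
    have "of_int m dvd \<rho> f"
      unfolding of_int_dvd_laurent_iff
    proof
      fix n show "m dvd lookup (\<rho> f) n"
      proof (cases "n < 0 \<or> int r \<le> n")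
        case False
        then show ?thesis using *[rule_format, of "nat n"] by auto
      qed (simp add: \<rho>_supp)
    qed
    then obtain b where "\<rho> f = of_int m * b" by (auto elim: dvdE)
    moreover obtain a where "f - \<rho> f = ?b * a" using \<rho>_cong by blast
    ultimately have "f = ?b * a + of_int m * b" by (simp add: algebra_simps)
    then show "f \<in> ideal2 ?b (of_int m)" by (simp only: ideal2I)
  qed
  define cl where "cl f = restrict (\<lambda>j. lookup (\<rho> f) (int j) mod m) {..<r}" for f
  have cl: "cl f = cl g \<longleftrightarrow> f - g \<in> ideal2 ?b (of_int m)" for f g
  proof -
    have "cl f = cl g \<longleftrightarrow> (\<forall>j<r. lookup (\<rho> f) (int j) mod m = lookup (\<rho> g) (int j) mod m)"
      by (auto simp: cl_def fun_eq_iff restrict_def)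
    also have "\<dots> \<longleftrightarrow> (\<forall>j<r. m dvd lookup (\<rho> (f - g)) (int j))"
      by (simp add: \<rho>_diff lookup_minus mod_eq_dvd_iff)
    finally show ?thesis by (simp add: mem)
  qed
  have im: "cl ` UNIV = ({..<r} \<rightarrow>\<^sub>E {0..<m})"
  proof (intro equalityI subsetI)
    fix e assume "e \<in> cl ` UNIV"
    then show "e \<in> {..<r} \<rightarrow>\<^sub>E {0..<m}" using m by (auto simp: cl_def split: if_splits)
  next
    fix e assume e: "e \<in> {..<r} \<rightarrow>\<^sub>E {0..<m}"
    define f where "f = (\<Sum>j<r. of_int (e j) * monom_t (int j))"
    have \<rho>_sum: "\<rho> (sum g A) = (\<Sum>j\<in>A. \<rho> (g j))" if "finite A" for A and g :: "nat \<Rightarrow> laurent"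
      using that by (simp add: \<rho>_def frag_extend_sum comp_def)
    have "\<rho> f = f"
      by (auto simp: f_def \<rho>_sum \<rho>_int \<rho>_monom intro!: sum.cong)
    have "lookup f (int i) = e i" if "i < r" for i
    proof -
      have "lookup f (int i) = (\<Sum>j<r. e j * (if i = j then 1 else 0))"
        by (simp add: f_def lookup_sum lookup_of_int_mult monom_t_def)
      also have "\<dots> = (\<Sum>j<r. if j = i then e j else 0)"
        by (rule sum.cong) auto
      finally have "lookup f (int i) = (\<Sum>j<r. if j = i then e j else 0)" .
      then show ?thesis using that by (simp add: sum.delta)
    qed
    then have "cl f = e"
      using e \<open>\<rho> f = f\<close> by (auto simp: cl_def fun_eq_iff restrict_def PiE_def extensional_def Pi_def)
    then show "e \<in> cl ` UNIV" by blast
  qed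
  show "finite_index UNIV (ideal2 ?b (of_int m))"
    using translate_classifier(2)[OF add_subgroup_ideal2 cl, of UNIV] im
    by (simp add: finite_PiE)
  show "sub_index UNIV (ideal2 ?b (of_int m)) = nat m ^ r"
    using translate_classifier(1)[OF add_subgroup_ideal2 cl, of UNIV] im
    by (simp add: card_PiE)
qed

subsection \<open>Submodules of free modules\<close>

definition scale :: "'a::comm_ring_1 \<Rightarrow> (nat \<Rightarrow> 'a) \<Rightarrow> nat \<Rightarrow> 'a" (infixr \<open>\<star>\<close> 75) where
  "c \<star> f = (\<lambda>i. c * f i)"

lemma scale_apply [simp]: "(c \<star> f) i = c * f i"
  by (simp add: scale_def)

interpretation fvec: Modules.module "scale :: 'a::comm_ring_1 \<Rightarrow> _"
  by unfold_locales (auto simp: scale_def fun_eq_iff algebra_simps)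

abbreviation submodule :: "(nat \<Rightarrow> 'a::comm_ring_1) set \<Rightarrow> bool" where
  "submodule \<equiv> fvec.subspace"

lemma add_subgroup_submodule: "submodule S \<Longrightarrow> add_subgroup S"
  by (simp add: add_subgroup_def fvec.subspace_0 fvec.subspace_diff)

lemma submodule_set_sum:
  assumes "submodule S" "submodule T"
  shows "submodule (S \<boxplus> T)"
proof (rule fvec.subspaceI)
  show "0 \<in> S \<boxplus> T"
    using assms add_subgroup_set_sum add_subgroup_submodule add_subgroup_zero by blast
  show "x + y \<in> S \<boxplus> T" if "x \<in> S \<boxplus> T" "y \<in> S \<boxplus> T" for x y
    using that assms add_subgroup_set_sum add_subgroup_submodule add_subgroup_add by blast
  show "c \<star> x \<in> S \<boxplus> T" if "x \<in> S \<boxplus> T" for c x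
  proof -
    obtain a b where "a \<in> S" "b \<in> T" "x = a + b" using \<open>x \<in> S \<boxplus> T\<close> by (rule set_sumE)
    then show ?thesis
      using assms by (simp add: fvec.scale_right_distrib set_sumI fvec.subspace_scale)
  qed
qed

lemma submodule_scale_image:
  assumes "submodule S"
  shows "submodule ((\<star>) c ` S)"
proof (rule fvec.subspaceI)
  show "0 \<in> (\<star>) c ` S"
    using fvec.subspace_0[OF assms] by (intro image_eqI[of _ _ 0]) auto
  show "x + y \<in> (\<star>) c ` S" if "x \<in> (\<star>) c ` S" "y \<in> (\<star>) c ` S" for x y
  proof -
    obtain a b where "a \<in> S" "b \<in> S" "x = c \<star> a" "y = c \<star> b"
      using \<open>x \<in> (\<star>) c ` S\<close> \<open>y \<in> (\<star>) c ` S\<close> by auto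
    then have "x + y = c \<star> (a + b)" "a + b \<in> S"
      using assms by (simp_all add: fvec.scale_right_distrib fvec.subspace_add)
    then show ?thesis by simp
  qed
  show "d \<star> x \<in> (\<star>) c ` S" if x: "x \<in> (\<star>) c ` S" for d x
  proof -
    obtain y where "y \<in> S" "x = c \<star> y" using x by auto
    then have eq: "d \<star> x = c \<star> (d \<star> y)"
      by (simp add: mult.commute)
    show ?thesis
      unfolding eq using fvec.subspace_scale[OF assms \<open>y \<in> S\<close>] by (rule imageI)
  qed
qed

lemma scale_image_subset: "submodule S \<Longrightarrow> (\<star>) c ` S \<subseteq> S"
  by (auto intro: fvec.subspace_scale)

text \<open>The free module of rank N is modelled as \<open>supported {..<N}\<close> inside all
  functions on the naturals, so that free modules of different ranks and their coordinate submodules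
  share one type.\<close>

definition supported :: "nat set \<Rightarrow> (nat \<Rightarrow> 'a::zero) set" where
  "supported I = {f. \<forall>i. i \<notin> I \<longrightarrow> f i = 0}"

lemma submodule_supported: "submodule (supported I)"
  by (rule fvec.subspaceI) (auto simp: supported_def)

lemma supported_mono: "I \<subseteq> I' \<Longrightarrow> supported I \<subseteq> supported I'"
  by (auto simp: supported_def)

lemma index_coordinatewise:
  fixes H :: "'a::ab_group_add set"
  assumes H: "add_subgroup H" and I: "finite (I :: nat set)" and fin: "finite_index UNIV H"
  shows "finite_index (supported I) {f \<in> supported I. \<forall>i. f i \<in> H}"
    "sub_index (supported I) {f \<in> supported I. \<forall>i. f i \<in> H} = sub_index UNIV H ^ card I"
proof -
  let ?K = "{f \<in> supported I. \<forall>i. f i \<in> H}"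
  define cl where "cl f = restrict (\<lambda>i. translate H (f i)) I" for f
  have K: "add_subgroup ?K"
    using H by (auto simp: add_subgroup_def supported_def)
  have cl: "cl f = cl g \<longleftrightarrow> f - g \<in> ?K" if "f \<in> supported I" "g \<in> supported I" for f g
  proof -
    have "cl f = cl g \<longleftrightarrow> (\<forall>i\<in>I. f i - g i \<in> H)"
      by (auto simp: cl_def fun_eq_iff restrict_def translate_eq_iff[OF H])
    also have "\<dots> \<longleftrightarrow> f - g \<in> ?K"
      using that add_subgroup_zero[OF H] by (auto simp: supported_def)
    finally show ?thesis .
  qed
  have im: "cl ` supported I = (I \<rightarrow>\<^sub>E translate H ` UNIV)"
  proof (intro equalityI subsetI)
    fix e assume "e \<in> I \<rightarrow>\<^sub>E translate H ` UNIV"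
    then have e: "\<And>i. i \<in> I \<Longrightarrow> e i \<in> range (translate H)" "\<And>i. i \<notin> I \<Longrightarrow> e i = undefined"
      by (auto simp: PiE_def extensional_def)
    define f where "f i = (if i \<in> I then inv_into UNIV (translate H) (e i) else 0)" for i
    have "cl f = e"
      using e by (auto simp: cl_def f_def fun_eq_iff restrict_def f_inv_into_f)
    moreover have "f \<in> supported I" by (simp add: f_def supported_def)
    ultimately show "e \<in> cl ` supported I" by blast
  qed (auto simp: cl_def)
  show "finite_index (supported I) ?K"
    using translate_classifier(2)[OF K cl] im fin I
    by (simp add: finite_PiE finite_index_def)
  show "sub_index (supported I) ?K = sub_index UNIV H ^ card I"
    using translate_classifier(1)[OF K cl] im I
    by (simp add: card_PiE sub_index_def)
qed

lemma scale_set_sum_supported: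
  "(\<star>) c ` supported I \<boxplus> (\<star>) d ` supported I = {f \<in> supported I. \<forall>i. f i \<in> ideal2 c d}"
proof (intro equalityI subsetI)
  fix f assume "f \<in> (\<star>) c ` supported I \<boxplus> (\<star>) d ` supported I"
  then show "f \<in> {f \<in> supported I. \<forall>i. f i \<in> ideal2 c d}"
    by (auto elim!: set_sumE simp: supported_def ideal2I)
next
  fix f assume f: "f \<in> {f \<in> supported I. \<forall>i. f i \<in> ideal2 c d}"
  then have "\<forall>i. \<exists>a b. f i = c * a + d * b"
    by (auto simp: ideal2_def)
  then obtain a b where ab: "f i = c * a i + d * b i" for i by metis
  define a' where "a' = (\<lambda>i. if i \<in> I then a i else 0)"
  define b' where "b' = (\<lambda>i. if i \<in> I then b i else 0)"
  have "f = c \<star> a' + d \<star> b'"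
    using f by (auto simp: fun_eq_iff a'_def b'_def ab supported_def)
  moreover have "a' \<in> supported I" "b' \<in> supported I"
    by (auto simp: a'_def b'_def supported_def)
  ultimately show "f \<in> (\<star>) c ` supported I \<boxplus> (\<star>) d ` supported I"
    by (auto intro: set_sumI)
qed

subsection \<open>The ascending chain condition\<close>

lemma add_subgroup_int_mult:
  assumes "add_subgroup (H :: int set)" "a \<in> H"
  shows "k * a \<in> H"
proof (induction k rule: int_induct[of _ 0])
  case base then show ?case using add_subgroup_zero[OF assms(1)] by simp
next
  case (step1 i) then show ?case
    using add_subgroup_add[OF assms(1) _ assms(2)] by (simp add: distrib_right)
next
  case (step2 i) then show ?case
    using add_subgroup_diff[OF assms(1) _ assms(2)] by (simp add: left_diff_distrib)
qed

text \<open>A member that contains the least positive integer occurring in any member is maximal: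
  division with remainder in a larger member would otherwise produce a smaller positive
  integer.\<close>

lemma int_subgroups_maximal:
  assumes "\<F> \<noteq> {}" "\<And>H. H \<in> \<F> \<Longrightarrow> add_subgroup (H :: int set)"
  shows "\<exists>H\<in>\<F>. \<forall>K\<in>\<F>. H \<subseteq> K \<longrightarrow> K = H"
proof (cases "\<forall>H\<in>\<F>. H = {0}")
  case True
  obtain H where "H \<in> \<F>" using assms(1) by auto
  then show ?thesis using True by metis
next
  case False
  define P where "P = (\<lambda>(H, n). H \<in> \<F> \<and> 0 < n \<and> int n \<in> H)"
  obtain H where "H \<in> \<F>" "H \<noteq> {0}"
    using False by auto
  moreover from this have "0 \<in> H"
    using assms(2) by (simp add: add_subgroup_zero)
  ultimately obtain a where "a \<in> H" "a \<noteq> 0"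
    by auto
  then have "int (nat \<bar>a\<bar>) \<in> H"
    using add_subgroup_uminus[OF assms(2)[OF \<open>H \<in> \<F>\<close>] \<open>a \<in> H\<close>] by (auto simp: abs_if)
  then have "P (H, nat \<bar>a\<bar>)"
    using \<open>H \<in> \<F>\<close> \<open>a \<noteq> 0\<close> by (simp add: P_def)
  then obtain H n where Hn: "P (H, n)" and least: "\<And>K m. P (K, m) \<Longrightarrow> n \<le> m"
    using ex_has_least_nat[of P _ snd] by (metis prod.collapse snd_conv)
  show ?thesis
  proof (rule bexI[of _ H], intro ballI impI)
    fix K assume K: "K \<in> \<F>" "H \<subseteq> K"
    note grp = assms(2)[OF K(1)]
    have n: "0 < n" "int n \<in> H" "H \<in> \<F>" using Hn by (auto simp: P_def)
    have "K \<subseteq> H"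
    proof
      fix k assume "k \<in> K"
      have "k mod int n = k - k div int n * int n"
        by (simp add: minus_div_mult_eq_mod)
      then have "k mod int n \<in> K"
        using add_subgroup_diff[OF grp \<open>k \<in> K\<close>] add_subgroup_int_mult[OF grp] n K by auto
      have "k mod int n = 0"
      proof (rule ccontr)
        assume "k mod int n \<noteq> 0"
        then have "0 < k mod int n" using n pos_mod_sign[of "int n" k] by linarith
        then have "P (K, nat (k mod int n))"
          using K \<open>k mod int n \<in> K\<close> by (simp add: P_def)
        then have "n \<le> nat (k mod int n)" by (rule least)
        moreover have "k mod int n < int n" using n by simp
        ultimately show False using \<open>0 < k mod int n\<close> by linarith
      qed
      then have "k = (k div int n) * int n" by (metis add.right_neutral div_mult_mod_eq)
      then show "k \<in> H"
        using add_subgroup_int_mult[OF assms(2)[OF n(3)] n(2)] by metis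
    qed
    then show "K = H" using K by blast
  qed (use Hn in \<open>simp add: P_def\<close>)
qed

lemma int_subgroup_family_maximal:
  assumes "\<And>j. add_subgroup (H j :: int set)"
  shows "\<exists>j. \<forall>k. H j \<subseteq> H k \<longrightarrow> H k = H j"
  using int_subgroups_maximal[of "range H"] assms by auto

text \<open>The coefficients of a vector of \<open>N\<close> Laurent polynomials, ordered first by exponent and
  then by coordinate, so that multiplication by \<open>t\<close> shifts the index by \<open>N\<close>.\<close>

definition flat_coeff :: "nat \<Rightarrow> (nat \<Rightarrow> laurent) \<Rightarrow> nat \<Rightarrow> int" where
  "flat_coeff N f m = lookup (f (m mod N)) (int (m div N))"

definition no_negative_exponents :: "(nat \<Rightarrow> laurent) \<Rightarrow> bool" where
  "no_negative_exponents f \<longleftrightarrow> (\<forall>i k. k < 0 \<longrightarrow> lookup (f i) k = 0)"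

text \<open>These are the subgroups of leading coefficients from the proof of Hilbert's basis
  theorem, one for each flat index. The coefficient at m may be 0, which makes the set closed under
  subtraction.\<close>

definition leading_coeffs :: "nat \<Rightarrow> (nat \<Rightarrow> laurent) set \<Rightarrow> nat \<Rightarrow> int set" where
  "leading_coeffs N S m = {flat_coeff N f m | f.
     f \<in> S \<and> no_negative_exponents f \<and> (\<forall>m'>m. flat_coeff N f m' = 0)}"

lemma add_subgroup_leading_coeffs:
  assumes "submodule S"
  shows "add_subgroup (leading_coeffs N S m)"
  unfolding add_subgroup_def
proof (intro conjI ballI)
  show "0 \<in> leading_coeffs N S m"
    unfolding leading_coeffs_def
    by (intro CollectI exI[of _ 0])
      (simp add: flat_coeff_def no_negative_exponents_def fvec.subspace_0[OF assms])
  fix x y assume "x \<in> leading_coeffs N S m" "y \<in> leading_coeffs N S m"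
  then obtain f g where fg: "x = flat_coeff N f m" "f \<in> S" "no_negative_exponents f" "\<forall>m'>m. flat_coeff N f m' = 0"
    "y = flat_coeff N g m" "g \<in> S" "no_negative_exponents g" "\<forall>m'>m. flat_coeff N g m' = 0"
    unfolding leading_coeffs_def by auto
  then show "x - y \<in> leading_coeffs N S m"
    unfolding leading_coeffs_def
    by (intro CollectI exI[of _ "f - g"])
      (auto simp: flat_coeff_def no_negative_exponents_def lookup_minus fvec.subspace_diff[OF assms])
qed

lemma leading_coeffs_mono: "S \<subseteq> S' \<Longrightarrow> leading_coeffs N S m \<subseteq> leading_coeffs N S' m"
  unfolding leading_coeffs_def by blast

lemma leading_coeffs_shift:
  assumes "submodule S" "0 < N"
  shows "leading_coeffs N S m \<subseteq> leading_coeffs N S (m + d * N)"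
proof (induction d)
  case (Suc d)
  have "leading_coeffs N S n \<subseteq> leading_coeffs N S (n + N)" for n
  proof
    fix x assume "x \<in> leading_coeffs N S n"
    then obtain f where f: "x = flat_coeff N f n" "f \<in> S" "no_negative_exponents f" "\<forall>m'>n. flat_coeff N f m' = 0"
      unfolding leading_coeffs_def by auto
    have up: "flat_coeff N (monom_t 1 \<star> f) (k + N) = flat_coeff N f k" for k
      using assms(2) by (simp add: flat_coeff_def lookup_monom_t_mult)
    have "flat_coeff N (monom_t 1 \<star> f) k = 0" if "n + N < k" for k
      using up[of "k - N"] f(4) that by auto
    moreover have "no_negative_exponents (monom_t 1 \<star> f)"
      using f(3) by (simp add: no_negative_exponents_def lookup_monom_t_mult)
    ultimately show "x \<in> leading_coeffs N S (n + N)"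
      unfolding leading_coeffs_def mem_Collect_eq using f(1,2) up fvec.subspace_scale[OF assms(1)]
      by (intro exI[of _ "monom_t 1 \<star> f"]) simp
  qed
  from this[of "m + d * N"] show ?case using Suc by (simp add: algebra_simps)
qed simp

text \<open>An element of S' loses its top coefficient when a suitable element of S is subtracted.
  The descent stops because exponents are nonnegative, and multiplication by a power of the unit t
  brings every vector into that situation.\<close>

lemma submodule_eq_if_leading_coeffs_eq:
  assumes S: "submodule S" "submodule S'" "S \<subseteq> S'" "S' \<subseteq> supported {..<N}" and N: "0 < N"
    and eq: "\<And>m. leading_coeffs N S' m = leading_coeffs N S m"
  shows "S' = S"
proof -
  have bound: "g \<in> S" if "g \<in> S'" "no_negative_exponents g" "\<forall>m\<ge>B. flat_coeff N g m = 0" for g B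
    using that
  proof (induction B arbitrary: g)
    case 0
    have "g i = 0" for i
    proof (cases "i < N")
      case True
      have "lookup (g i) k = 0" for k
      proof (cases "k < 0")
        case False
        have "flat_coeff N g (nat k * N + i) = lookup (g i) k"
          using True False by (simp add: flat_coeff_def)
        then show ?thesis using 0 by simp
      qed (use 0 in \<open>simp add: no_negative_exponents_def\<close>)
      then show ?thesis by (simp add: poly_mapping_eqI)
    next
      case False
      then show ?thesis using 0 S(4) by (auto simp: supported_def)
    qed
    then have "g = 0" by (simp add: fun_eq_iff)
    then show ?case using fvec.subspace_0[OF S(1)] by (simp only:)
  next
    case (Suc B)
    have "flat_coeff N g B \<in> leading_coeffs N S' B"
      unfolding leading_coeffs_def using Suc.prems by (force simp: Suc_le_eq)
    then have "flat_coeff N g B \<in> leading_coeffs N S B" using eq by simp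
    then obtain h where h: "flat_coeff N g B = flat_coeff N h B" "h \<in> S" "no_negative_exponents h"
      "\<forall>m'>B. flat_coeff N h m' = 0"
      unfolding leading_coeffs_def by auto
    have "g - h \<in> S"
    proof (rule Suc.IH)
      show "g - h \<in> S'" using Suc.prems h S fvec.subspace_diff by blast
      show "no_negative_exponents (g - h)"
        using Suc.prems(2) h(3) by (simp add: no_negative_exponents_def lookup_minus)
      show "\<forall>m\<ge>B. flat_coeff N (g - h) m = 0"
      proof (intro allI impI)
        fix m assume "B \<le> m"
        then show "flat_coeff N (g - h) m = 0"
          using h Suc.prems(3) by (cases "m = B") (auto simp: flat_coeff_def lookup_minus)
      qed
    qed
    then have "(g - h) + h \<in> S" using h fvec.subspace_add[OF S(1)] by blast
    then show ?case by simp
  qed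
  have "f \<in> S" if f: "f \<in> S'" for f
  proof -
    have fin: "finite (\<Union>i<N. Poly_Mapping.keys (f i))" by simp
    obtain b where b: "\<And>k. k \<in> (\<Union>i<N. Poly_Mapping.keys (f i)) \<Longrightarrow> \<bar>k\<bar> \<le> b"
      using fin finite_imageI[OF fin, of abs] by (meson Max_ge image_eqI)
    have supp: "lookup (f i) k = 0" if "b < \<bar>k\<bar>" for i k
    proof (cases "i < N")
      case True
      then show ?thesis using b[of k] that by (force simp: in_keys_iff)
    next
      case False
      then show ?thesis using f S(4) by (auto simp: supported_def)
    qed
    \<comment> \<open>All exponents of f lie between -b and b, so after the shift they lie between 0
      and 2b; hence the bound 2 |b| + 1 below. The absolute value covers f = 0, where b is
      arbitrary.\<close>
    define g where "g = monom_t \<bar>b\<bar> \<star> f"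
    have "g \<in> S'" unfolding g_def using f S(2) by (simp add: fvec.subspace_scale)
    moreover have "no_negative_exponents g"
      unfolding no_negative_exponents_def g_def by (auto simp: lookup_monom_t_mult intro!: supp)
    moreover have "\<forall>m\<ge>nat (2 * \<bar>b\<bar> + 1) * N. flat_coeff N g m = 0"
    proof (intro allI impI)
      fix m assume "nat (2 * \<bar>b\<bar> + 1) * N \<le> m"
      then have "nat (2 * \<bar>b\<bar> + 1) \<le> m div N" using N by (simp add: less_eq_div_iff_mult_less_eq)
      then show "flat_coeff N g m = 0"
        unfolding g_def flat_coeff_def by (auto simp: lookup_monom_t_mult intro!: supp)
    qed
    ultimately have "g \<in> S" by (rule bound)
    then have "monom_t (- \<bar>b\<bar>) \<star> g \<in> S" using S(1) by (simp add: fvec.subspace_scale)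
    moreover have "monom_t (- \<bar>b\<bar>) \<star> g = f"
      by (simp add: g_def monom_t_add[symmetric])
    ultimately show ?thesis by simp
  qed
  then show ?thesis using S(3) by blast
qed

text \<open>Hilbert's argument in two directions: the leading subgroups grow with n and, within a
  residue class of flat indices modulo N, with the exponent. Each of the N classes is constant
  beyond some pair, which leaves finitely many flat indices to stabilize one by one.\<close>

lemma ascending_chain_stabilizes:
  fixes S :: "nat \<Rightarrow> (nat \<Rightarrow> laurent) set"
  assumes sub: "\<And>n. submodule (S n)" and supp: "\<And>n. S n \<subseteq> supported {..<N}"
    and mono: "\<And>n. S n \<subseteq> S (Suc n)"
  shows "\<exists>n0. \<forall>n\<ge>n0. S n = S n0"
proof (cases "N = 0")
  case True
  have "S n = {0}" for n
  proof
    show "S n \<subseteq> {0}"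
      using supp[of n] True by (auto simp: supported_def fun_eq_iff)
    show "{0} \<subseteq> S n"
      using fvec.subspace_0[OF sub] by simp
  qed
  then show ?thesis by blast
next
  case False
  have S_mono: "S n \<subseteq> S n'" if "n \<le> n'" for n n'
    using that by (rule lift_Suc_mono_le[of S, OF mono])
  let ?l = "\<lambda>n m. leading_coeffs N (S n) m"
  have "\<exists>n d. \<forall>n'\<ge>n. \<forall>d'\<ge>d. ?l n' (i + d' * N) = ?l n (i + d * N)" for i
  proof -
    \<comment> \<open>A maximal member only rules out strictly larger ones; monotonicity in both
      indices makes every later member comparable with it.\<close>
    have "\<exists>k. \<forall>k'. ?l (fst k) (i + snd k * N) \<subseteq> ?l (fst k') (i + snd k' * N)
        \<longrightarrow> ?l (fst k') (i + snd k' * N) = ?l (fst k) (i + snd k * N)"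
      by (rule int_subgroup_family_maximal) (rule add_subgroup_leading_coeffs[OF sub])
    then obtain n d where max': "\<forall>k'. ?l n (i + d * N) \<subseteq> ?l (fst k') (i + snd k' * N)
        \<longrightarrow> ?l (fst k') (i + snd k' * N) = ?l n (i + d * N)"
      by auto
    have max: "?l n (i + d * N) \<subseteq> ?l n' (i + d' * N) \<Longrightarrow> ?l n' (i + d' * N) = ?l n (i + d * N)" for n' d'
      using max'[rule_format, of "(n', d')"] by simp
    show ?thesis
    proof (intro exI allI impI)
      fix n' d' assume "n \<le> n'" "d \<le> d'"
      have "?l n (i + d * N) \<subseteq> ?l n' (i + d * N)"
        by (rule leading_coeffs_mono) (rule S_mono[OF \<open>n \<le> n'\<close>])
      also have "\<dots> \<subseteq> ?l n' (i + d * N + (d' - d) * N)"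
        by (rule leading_coeffs_shift) (use False sub in auto)
      also have "i + d * N + (d' - d) * N = i + d' * N"
        using \<open>d \<le> d'\<close> by (simp add: add.assoc distrib_right[symmetric])
      finally show "?l n' (i + d' * N) = ?l n (i + d * N)" by (rule max)
    qed
  qed
  then obtain nn dd where nd: "\<And>i n' d'. nn i \<le> n' \<Longrightarrow> dd i \<le> d' \<Longrightarrow> ?l n' (i + d' * N) = ?l (nn i) (i + dd i * N)"
    by metis
  have "\<exists>n. \<forall>n'\<ge>n. ?l n' m = ?l n m" for m
  proof -
    obtain n where max: "\<And>n'. ?l n m \<subseteq> ?l n' m \<Longrightarrow> ?l n' m = ?l n m"
      using int_subgroup_family_maximal[of "\<lambda>n. ?l n m"] add_subgroup_leading_coeffs[OF sub] by auto
    then show ?thesis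
      by (intro exI[of _ n] allI impI max leading_coeffs_mono S_mono)
  qed
  then obtain kk where kk: "\<And>m n'. kk m \<le> n' \<Longrightarrow> ?l n' m = ?l (kk m) m"
    by metis
  define d0 where "d0 = Max (dd ` {..<N})"
  define n0 where "n0 = Max (nn ` {..<N} \<union> kk ` {..<d0 * N} \<union> {0})"
  have n0: "i < N \<Longrightarrow> nn i \<le> n0" "i < N \<Longrightarrow> dd i \<le> d0" "m < d0 * N \<Longrightarrow> kk m \<le> n0" for i m
    by (auto simp: n0_def d0_def)
  show ?thesis
  proof (intro exI allI impI)
    fix n assume n: "n0 \<le> n"
    show "S n = S n0"
    proof (rule submodule_eq_if_leading_coeffs_eq)
      fix m
      show "?l n m = ?l n0 m"
      proof (cases "m < d0 * N")
        case True
        then show ?thesis using kk[of m n] kk[of m n0] n0(3)[OF True] n by simp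
      next
        case ge: False
        let ?i = "m mod N" let ?d = "m div N"
        have "m = ?i + ?d * N" by simp
        moreover have "?i < N" using False by simp
        moreover have "dd ?i \<le> ?d"
          using n0(2)[OF \<open>?i < N\<close>] ge False
          by (meson div_le_mono le_trans less_eq_div_iff_mult_less_eq not_le_imp_less not_less neq0_conv)
        ultimately show ?thesis
          using nd[of ?i n ?d] nd[of ?i n0 ?d] n0(1)[of ?i] n by (metis le_trans)
      qed
    qed (use sub supp S_mono[OF n] False in auto)
  qed
qed

subsection \<open>The exponent of the primary torsion\<close>

lemma one_plus_power_expansion: "\<exists>c. (1 + z) ^ n = 1 + of_nat n * z + z\<^sup>2 * (c :: 'a::comm_ring_1)"
proof (induction n)
  case (Suc n)
  then obtain c where "(1 + z) ^ n = 1 + of_nat n * z + z\<^sup>2 * c" by blast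
  then have "(1 + z) ^ Suc n = 1 + of_nat (Suc n) * z + z\<^sup>2 * (c + of_nat n + z * c)"
    by (simp add: algebra_simps power2_eq_square)
  then show ?case by blast
qed (auto intro: exI[of _ 0])

lemma power_add_multiple: "\<exists>c. (x + s * w) ^ n = x ^ n + s * (c :: 'a::comm_ring_1)"
proof (induction n)
  case (Suc n)
  then obtain c where "(x + s * w) ^ n = x ^ n + s * c" by blast
  then have "(x + s * w) ^ Suc n = x ^ Suc n + s * (x * c + w * x ^ n + w * s * c)"
    by (simp add: algebra_simps)
  then show ?case by blast
qed (auto intro: exI[of _ 0])

text \<open>Multiplying the defect \<open>p ^ (v + 2) * e\<close> of \<open>1 + p\<^sup>2 e\<close> by \<open>p\<close> for every factor \<open>p\<close> of
  the exponent plays the role of the \<open>p\<close>-adic logarithm.\<close>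

lemma one_plus_prime_power:
  fixes e :: "'a::comm_ring_1"
  shows "\<exists>h. (1 + of_nat p ^ 2 * e) ^ (p ^ v) = 1 + of_nat p ^ (v + 2) * e * (1 + of_nat p * h)"
proof (induction v)
  case (Suc v)
  let ?P = "of_nat p :: 'a"
  obtain h where h: "(1 + ?P ^ 2 * e) ^ (p ^ v) = 1 + ?P ^ (v + 2) * e * (1 + ?P * h)"
    using Suc by blast
  define z where "z = ?P ^ (v + 2) * e * (1 + ?P * h)"
  obtain c where c: "(1 + z) ^ p = 1 + of_nat p * z + z\<^sup>2 * c"
    using one_plus_power_expansion by blast
  have "(1 + ?P ^ 2 * e) ^ (p ^ Suc v) = ((1 + ?P ^ 2 * e) ^ (p ^ v)) ^ p"
    by (simp add: power_mult[symmetric] mult.commute)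
  also have "\<dots> = 1 + ?P * z + z\<^sup>2 * c"
    using h c by (simp add: z_def)
  \<comment> \<open>The square of z carries p^(2v + 4) e^2, at least one factor p more than p^(v +
    3) e, and the surplus goes into the new h. Starting from 1 + p e would leave no surplus at v =
    0.\<close>
  also have "\<dots> = 1 + ?P ^ (Suc v + 2) * e * (1 + ?P * (h + (1 + ?P * h) * (?P ^ v * e * (1 + ?P * h) * c)))"
    by (simp add: z_def algebra_simps power2_eq_square)
  finally show ?case by blast
qed (auto intro: exI[of _ 0] simp: power2_eq_square)

text \<open>Write r = p^v a with a prime to p. The exponent p^v multiplies the defect by p^v, the
  exponent a by a, both up to a factor that is 1 modulo p.\<close>

lemma one_plus_power_minus_one:
  fixes e :: "'a::comm_ring_1"
  assumes p: "prime p" and r: "0 < r"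
  shows "\<exists>a h. \<not> p dvd a \<and>
    (1 + of_nat p ^ 2 * e) ^ r - 1 = of_nat p ^ (multiplicity p r + 2) * e * (of_nat a + of_nat p * h)"
proof -
  let ?P = "of_nat p :: 'a" and ?v = "multiplicity p r"
  obtain a where a: "r = p ^ ?v * a" "\<not> p dvd a"
    using multiplicity_decompose'[of r p] p r by (metis not_gr_zero not_prime_unit)
  obtain h where h: "(1 + ?P ^ 2 * e) ^ (p ^ ?v) = 1 + ?P ^ (?v + 2) * e * (1 + ?P * h)"
    using one_plus_prime_power by blast
  define z where "z = ?P ^ (?v + 2) * e * (1 + ?P * h)"
  obtain c where c: "(1 + z) ^ a = 1 + of_nat a * z + z\<^sup>2 * c"
    using one_plus_power_expansion by blast
  have "(1 + ?P ^ 2 * e) ^ r = ((1 + ?P ^ 2 * e) ^ (p ^ ?v)) ^ a"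
    by (metis a(1) power_mult)
  also have "\<dots> - 1 = of_nat a * z + z\<^sup>2 * c"
    using h c by (simp add: z_def)
  also have "\<dots> = ?P ^ (?v + 2) * e * (of_nat a + ?P * (of_nat a * h + (1 + ?P * h) * (?P ^ (?v + 1) * e * (1 + ?P * h) * c)))"
    by (simp add: z_def algebra_simps power2_eq_square)
  finally show ?thesis using a(2) by blast
qed

text \<open>What is invertible modulo p is invertible modulo every power of p; one factor p is
  gained at each induction step from the Bezout relation of a and p.\<close>

lemma coprime_mod_prime_power:
  fixes h :: "'a::comm_ring_1"
  assumes p: "prime p" and a: "\<not> p dvd a"
  shows "\<exists>\<alpha> \<beta>. \<alpha> * of_nat p ^ b + \<beta> * (of_nat a + of_nat p * h) = 1"
proof -
  let ?P = "of_nat p :: 'a"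
  have "coprime p a"
    using p a by (rule prime_imp_coprime)
  then have "coprime (int a) (int p)"
    by (simp add: coprime_commute)
  then obtain x y where "x * int a + y * int p = 1"
    by (metis bezout_int coprime_iff_gcd_eq_1)
  then have xy: "of_int x * of_nat a + of_int y * ?P = 1"
    by (metis of_int_1 of_int_add of_int_mult of_int_of_nat_eq)
  define \<theta> where "\<theta> = of_nat a + ?P * h"
  have "\<exists>\<alpha> \<beta>. \<alpha> * ?P ^ b + \<beta> * \<theta> = 1"
  proof (induction b)
    case 0 then show ?case by (intro exI[of _ 1] exI[of _ 0]) simp
  next
    case (Suc b)
    then obtain \<alpha> \<beta> where ab: "\<alpha> * ?P ^ b + \<beta> * \<theta> = 1" by blast
    have one: "(of_int y - of_int x * h) * ?P + of_int x * \<theta> = 1"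
      using xy by (simp add: \<theta>_def algebra_simps)
    have "\<alpha> * ?P ^ b = \<alpha> * ?P ^ b * ((of_int y - of_int x * h) * ?P + of_int x * \<theta>)"
      unfolding one by simp
    also have "\<dots> = \<alpha> * (of_int y - of_int x * h) * ?P ^ Suc b + (\<alpha> * ?P ^ b * of_int x) * \<theta>"
      by (simp add: algebra_simps)
    finally have split: "\<alpha> * ?P ^ b = \<alpha> * (of_int y - of_int x * h) * ?P ^ Suc b + (\<alpha> * ?P ^ b * of_int x) * \<theta>" .
    have "\<alpha> * (of_int y - of_int x * h) * ?P ^ Suc b + (\<beta> + \<alpha> * ?P ^ b * of_int x) * \<theta>
      = (\<alpha> * (of_int y - of_int x * h) * ?P ^ Suc b + (\<alpha> * ?P ^ b * of_int x) * \<theta>) + \<beta> * \<theta>"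
      by (simp add: algebra_simps)
    also have "\<dots> = 1" unfolding split[symmetric] by (rule ab)
    finally show ?case by blast
  qed
  then show ?thesis by (simp add: \<theta>_def)
qed

text \<open>The powers of t fall into finitely many classes modulo (s, p), so two of them agree and,
  t being a unit, some power of t is 1 modulo (s, p). Its p-th power is 1 modulo (s, p^2).\<close>

lemma laurent_t_power_congruent_one:
  assumes p: "prime p" and s: "\<not> of_nat p dvd (s :: laurent)"
  shows "\<exists>g e w. 0 < g \<and> laurent_t ^ g = 1 + of_nat p ^ 2 * e + s * w"
proof -
  let ?P = "of_nat p :: laurent"
  let ?H = "ideal2 s ?P"
  have "finite_index UNIV ?H"
    using finite_index_prime_ideal2[of "int p" s] p s by simp
  then have "finite (translate ?H ` range (\<lambda>n. laurent_t ^ n))"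
    unfolding finite_index_def by (rule finite_subset[rotated]) auto
  then have "\<not> inj (\<lambda>n. translate ?H (laurent_t ^ n))"
    by (metis finite_imageD image_image infinite_UNIV_nat)
  then obtain i j where "i \<noteq> j" "translate ?H (laurent_t ^ i) = translate ?H (laurent_t ^ j)"
    unfolding inj_def by auto
  then obtain i j where "i < j" "translate ?H (laurent_t ^ j) = translate ?H (laurent_t ^ i)"
    by (metis linorder_neqE_nat)
  then have "laurent_t ^ j - laurent_t ^ i \<in> ?H"
    using translate_eq_iff[OF add_subgroup_ideal2] by blast
  then have "monom_t (- int i) * (laurent_t ^ j - laurent_t ^ i) \<in> ?H"
    by (rule ideal2_mult)
  moreover have "monom_t (- int i) * (laurent_t ^ j - laurent_t ^ i) = laurent_t ^ (j - i) - 1"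
    using \<open>i < j\<close> by (simp add: laurent_t_power right_diff_distrib monom_t_add[symmetric] of_nat_diff)
  ultimately obtain w e where "laurent_t ^ (j - i) - 1 = s * w + ?P * e"
    unfolding ideal2_def by auto
  then have g: "laurent_t ^ (j - i) = (1 + ?P * e) + s * w"
    by (simp add: algebra_simps)
  obtain c where c: "(1 + ?P * e + s * w) ^ p = (1 + ?P * e) ^ p + s * c"
    using power_add_multiple by blast
  obtain d where d: "(1 + ?P * e) ^ p = 1 + of_nat p * (?P * e) + (?P * e)\<^sup>2 * d"
    using one_plus_power_expansion by blast
  have "laurent_t ^ ((j - i) * p) = 1 + ?P ^ 2 * (e + e\<^sup>2 * d) + s * c"
    unfolding power_mult g c d by (simp add: algebra_simps power2_eq_square)
  moreover have "0 < (j - i) * p"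
    using \<open>i < j\<close> p by (simp add: prime_gt_0_nat)
  ultimately show ?thesis by blast
qed

text \<open>The elements of W that q^i sends into V ascend with i; the stage at which they become
  constant is a common exponent for all of them.\<close>

lemma torsion_exponent_bounded:
  assumes W: "submodule W" "W \<subseteq> supported {..<N}" and V: "submodule V"
  shows "\<exists>c. \<forall>y\<in>W. \<forall>b. (q :: laurent) ^ b \<star> y \<in> V \<longrightarrow> q ^ c \<star> y \<in> V"
proof -
  define S where "S i = {y \<in> W. q ^ i \<star> y \<in> V}" for i
  have "submodule (S i)" for i
  proof (rule fvec.subspaceI)
    show "0 \<in> S i" using fvec.subspace_0[OF W(1)] fvec.subspace_0[OF V] by (simp add: S_def)
    show "x + y \<in> S i" if "x \<in> S i" "y \<in> S i" for x y
      using that W V by (simp add: S_def fvec.scale_right_distrib fvec.subspace_add)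
    show "c \<star> x \<in> S i" if "x \<in> S i" for c x
    proof -
      have "q ^ i \<star> (c \<star> x) = c \<star> (q ^ i \<star> x)" by (simp add: mult.commute)
      then show ?thesis
        using that W V by (simp add: S_def fvec.subspace_scale del: fvec.scale_scale)
    qed
  qed
  moreover have "S i \<subseteq> supported {..<N}" for i using W(2) by (auto simp: S_def)
  moreover have mono: "S i \<subseteq> S (Suc i)" for i
  proof
    fix y assume "y \<in> S i"
    moreover have "q ^ Suc i \<star> y = q \<star> (q ^ i \<star> y)" by simp
    ultimately show "y \<in> S (Suc i)"
      using V by (simp add: S_def fvec.subspace_scale del: fvec.scale_scale power_Suc)
  qed
  ultimately obtain c where c: "\<forall>n\<ge>c. S n = S c"
    using ascending_chain_stabilizes[of S N] by auto
  have "q ^ c \<star> y \<in> V" if "y \<in> W" "q ^ b \<star> y \<in> V" for y b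
  proof -
    have "y \<in> S b" using that by (simp add: S_def)
    then have "y \<in> S (max b c)"
      using lift_Suc_mono_le[of S b "max b c", OF mono] by auto
    moreover have "S (max b c) = S c" by (rule c[rule_format]) simp
    ultimately have "y \<in> S c" by (simp only:)
    then show ?thesis by (simp add: S_def)
  qed
  then show ?thesis by blast
qed

text \<open>Since s maps W into L, scalars act on W modulo L only through their class modulo s. This
  is what replaces t^(rg) - 1 by an explicit multiple of e.\<close>

lemma scale_image_mod_cong:
  assumes L: "submodule L" and sW: "\<And>w. w \<in> W \<Longrightarrow> s \<star> w \<in> L" and u: "u = u' + s * c"
  shows "(\<star>) u ` W \<boxplus> L \<subseteq> (\<star>) u' ` W \<boxplus> L"
proof
  fix x assume "x \<in> (\<star>) u ` W \<boxplus> L"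
  then obtain w l where w: "w \<in> W" "l \<in> L" "x = u \<star> w + l"
    by (auto elim!: set_sumE)
  have "x = u' \<star> w + (c \<star> (s \<star> w) + l)"
    by (simp add: w u fun_eq_iff algebra_simps)
  moreover have "c \<star> (s \<star> w) + l \<in> L"
    by (rule fvec.subspace_add[OF L fvec.subspace_scale[OF L sW[OF w(1)]] w(2)])
  ultimately show "x \<in> (\<star>) u' ` W \<boxplus> L"
    using w(1) by (simp only: set_sumI imageI)
qed

text \<open>Modulo s the scalar t^(rg) - 1 is u = p^(v+2) e \<theta> with \<theta> comaximal with
  every power of p. So p-torsion modulo u W + L is, up to p^(v+2), p-torsion modulo e W + L, and the
  chain condition is applied to the latter, which does not involve r.\<close>

lemma torsion_exponent_killed_aux:
  assumes p: "prime p" and W: "submodule W" "W \<subseteq> supported {..<N}" and L: "submodule L" "L \<subseteq> W"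
    and sW: "\<And>w. w \<in> W \<Longrightarrow> s \<star> w \<in> L"
    and g: "laurent_t ^ g = 1 + of_nat p ^ 2 * e + s * w0"
  shows "\<exists>c. \<forall>r>0. \<forall>y\<in>W. \<forall>b. of_nat p ^ b \<star> y \<in> (\<star>) (laurent_t ^ (r * g) - 1) ` W \<boxplus> L \<longrightarrow>
    of_nat p ^ (c + multiplicity p r) \<star> y \<in> (\<star>) (laurent_t ^ (r * g) - 1) ` W \<boxplus> L"
proof -
  let ?P = "of_nat p :: laurent"
  have eW: "submodule ((\<star>) e ` W \<boxplus> L)"
    using W L by (intro submodule_set_sum submodule_scale_image)
  obtain c where c: "\<And>y b. y \<in> W \<Longrightarrow> ?P ^ b \<star> y \<in> (\<star>) e ` W \<boxplus> L \<Longrightarrow> ?P ^ c \<star> y \<in> (\<star>) e ` W \<boxplus> L"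
    using torsion_exponent_bounded[OF W eW, of ?P] by blast
  have "?P ^ (c + 2 + multiplicity p r) \<star> y \<in> (\<star>) (laurent_t ^ (r * g) - 1) ` W \<boxplus> L"
    if r: "0 < r" and y: "y \<in> W" and b: "?P ^ b \<star> y \<in> (\<star>) (laurent_t ^ (r * g) - 1) ` W \<boxplus> L" for r y b
  proof -
    let ?v = "multiplicity p r"
    obtain a h where a: "\<not> p dvd a"
      and ah: "(1 + ?P ^ 2 * e) ^ r - 1 = ?P ^ (?v + 2) * e * (of_nat a + ?P * h)"
      using one_plus_power_minus_one[OF p r] by blast
    define \<theta> where "\<theta> = of_nat a + ?P * h"
    define B Q C where "B = ?P ^ b" and "Q = ?P ^ (?v + 2)" and "C = ?P ^ c"
    define u where "u = Q * e * \<theta>"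
    obtain \<alpha> \<beta> where ab: "\<alpha> * B + \<beta> * \<theta> = 1"
      using coprime_mod_prime_power[OF p a] unfolding \<theta>_def B_def by blast
    obtain w1 where w1: "(1 + ?P ^ 2 * e + s * w0) ^ r = (1 + ?P ^ 2 * e) ^ r + s * w1"
      using power_add_multiple by blast
    have "laurent_t ^ (r * g) = (laurent_t ^ g) ^ r"
      by (simp add: power_mult[symmetric] mult.commute)
    then have tu: "laurent_t ^ (r * g) - 1 = u + s * w1"
      using ah by (simp add: g w1 u_def \<theta>_def Q_def)
    then have ut: "u = (laurent_t ^ (r * g) - 1) + s * (- w1)"
      by (simp add: algebra_simps)
    have "B \<star> y \<in> (\<star>) u ` W \<boxplus> L"
      unfolding B_def using b scale_image_mod_cong[OF L(1) sW tu] by blast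
    then obtain y1 l where y1: "y1 \<in> W" "l \<in> L" and eq1: "B \<star> y = u \<star> y1 + l"
      by (auto elim!: set_sumE)
    \<comment> \<open>Modulo L, y2 is y divided by \<theta>, and \<kappa> measures the failure of B
      y2 = Q e y1. Since \<theta> sends \<kappa> into L, replacing y2 by y3 keeps \<theta> y3 = y
      modulo L and makes B y3 = e Q y1 modulo L, because 1 - \<alpha> B = \<beta> \<theta>.\<close>
    define y2 where "y2 = \<beta> \<star> y + (\<alpha> * Q * e) \<star> y1"
    define \<kappa> where "\<kappa> = B \<star> y2 - (Q * e) \<star> y1"
    define y3 where "y3 = y2 - \<alpha> \<star> \<kappa>"
    have "y2 \<in> W"
      unfolding y2_def using W(1) y y1 by (intro fvec.subspace_add fvec.subspace_scale)
    moreover from this have "\<kappa> \<in> W"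
      unfolding \<kappa>_def using W(1) y1 by (intro fvec.subspace_diff fvec.subspace_scale)
    ultimately have "y3 \<in> W"
      unfolding y3_def using W(1) by (intro fvec.subspace_diff fvec.subspace_scale)
    have eq2: "\<theta> * y2 i = y i - \<alpha> * l i" for i
    proof -
      have "\<theta> * y2 i = (\<alpha> * B + \<beta> * \<theta>) * y i - \<alpha> * (B * y i - u * y1 i)"
        by (simp add: y2_def u_def algebra_simps)
      moreover have "B * y i = u * y1 i + l i" using eq1 by (simp add: fun_eq_iff)
      ultimately show ?thesis by (simp add: ab)
    qed
    have eq3: "\<theta> * \<kappa> i = l i - \<alpha> * B * l i" for i
    proof -
      have "\<theta> * \<kappa> i = B * (\<theta> * y2 i) - u * y1 i"
        by (simp add: \<kappa>_def u_def algebra_simps)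
      moreover have "u * y1 i = B * y i - l i" using eq1 by (simp add: fun_eq_iff)
      ultimately show ?thesis by (simp add: eq2 algebra_simps)
    qed
    have y3: "y3 i = y2 i - \<alpha> * \<kappa> i" for i
      by (simp add: y3_def)
    have "B * y3 i = e * (Q * y1 i) + \<beta> * (l i - \<alpha> * B * l i)" for i
    proof -
      have "B * y3 i = (1 - \<alpha> * B) * \<kappa> i + e * (Q * y1 i)"
        by (simp add: y3 \<kappa>_def algebra_simps)
      also have "1 - \<alpha> * B = \<beta> * \<theta>" using ab by (simp add: algebra_simps)
      finally show ?thesis by (simp add: mult.assoc eq3)
    qed
    then have eq4: "B \<star> y3 = e \<star> (Q \<star> y1) + \<beta> \<star> (l - (\<alpha> * B) \<star> l)"
      by (simp add: fun_eq_iff)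
    have "B \<star> y3 \<in> (\<star>) e ` W \<boxplus> L"
      unfolding eq4 using y1 W(1) L(1)
      by (intro set_sumI imageI fvec.subspace_scale fvec.subspace_diff)
    then have "C \<star> y3 \<in> (\<star>) e ` W \<boxplus> L"
      unfolding B_def C_def by (rule c[OF \<open>y3 \<in> W\<close>])
    then obtain y4 l' where y4: "y4 \<in> W" "l' \<in> L" "C \<star> y3 = e \<star> y4 + l'"
      by (auto elim!: set_sumE)
    \<comment> \<open>Multiplying the relation for C y3 by Q \<theta> turns y3 into y and e into u,
      up to elements of L.\<close>
    have "C * Q * y i = u * y4 i + (Q * \<theta> * l' i + C * Q * \<alpha> * (l i + (l i - \<alpha> * B * l i)))" for i
    proof -
      have "\<theta> * y3 i = y i - \<alpha> * (l i + (l i - \<alpha> * B * l i))"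
        using eq2[of i] eq3[of i] by (simp add: y3 right_diff_distrib distrib_left mult.left_commute[of \<theta>])
      then have y: "y i = \<theta> * y3 i + \<alpha> * (l i + (l i - \<alpha> * B * l i))"
        by simp
      have "C * Q * y i = Q * \<theta> * (C * y3 i) + C * Q * \<alpha> * (l i + (l i - \<alpha> * B * l i))"
        by (subst y) (simp only: distrib_left ac_simps)
      also have "C * y3 i = e * y4 i + l' i" using y4(3) by (simp add: fun_eq_iff)
      finally show ?thesis by (simp add: u_def algebra_simps)
    qed
    then have eq5: "(C * Q) \<star> y = u \<star> y4
        + ((Q * \<theta>) \<star> l' + (C * Q * \<alpha>) \<star> (l + (l - (\<alpha> * B) \<star> l)))"
      by (simp add: fun_eq_iff)
    have "(C * Q) \<star> y \<in> (\<star>) u ` W \<boxplus> L"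
      unfolding eq5 using y1 y4 L(1)
      by (intro set_sumI imageI fvec.subspace_add fvec.subspace_scale fvec.subspace_diff)
    moreover have "C * Q = ?P ^ (c + 2 + ?v)"
      by (simp add: C_def Q_def power_add)
    ultimately show ?thesis
      using scale_image_mod_cong[OF L(1) sW ut] by auto
  qed
  then show ?thesis by blast
qed

text \<open>Two reductions lead to \<open>torsion_exponent_killed_aux\<close>. The module W' = p^l W
  + L is annihilated modulo L by s, at the price of p^l; and t^r - 1 is replaced by its multiple
  t^(rg) - 1, at the price of the p-part of g.\<close>

lemma torsion_exponent_killed:
  assumes p: "prime p" and s: "\<not> of_nat p dvd s"
    and W: "submodule W" "W \<subseteq> supported {..<N}" and L: "submodule L" "L \<subseteq> W"
    and kill: "\<And>w. w \<in> W \<Longrightarrow> (of_nat p ^ l * s) \<star> w \<in> L"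
  shows "\<exists>c. \<forall>r>0. \<forall>x\<in>W. \<forall>b. of_nat p ^ b \<star> x \<in> (\<star>) (laurent_t ^ r - 1) ` W \<boxplus> L \<longrightarrow>
    of_nat p ^ (c + multiplicity p r) \<star> x \<in> (\<star>) (laurent_t ^ r - 1) ` W \<boxplus> L"
proof -
  let ?P = "of_nat p :: laurent"
  define W' where "W' = (\<star>) (?P ^ l) ` W \<boxplus> L"
  have W': "submodule W'"
    unfolding W'_def by (rule submodule_set_sum[OF submodule_scale_image[OF W(1)] L(1)])
  have LW': "L \<subseteq> W'"
    unfolding W'_def by (rule set_sum_upper2[OF fvec.subspace_0[OF submodule_scale_image[OF W(1)]]])
  have W'W: "W' \<subseteq> W"
    unfolding W'_def
    by (rule set_sum_least[OF scale_image_subset[OF W(1)] L(2) add_subgroup_submodule[OF W(1)]])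
  have kill': "s \<star> w \<in> L" if "w \<in> W'" for w
  proof -
    from that obtain y l' where y: "y \<in> W" "l' \<in> L" "w = ?P ^ l \<star> y + l'"
      unfolding W'_def by (auto elim!: set_sumE)
    have "s \<star> w = (?P ^ l * s) \<star> y + s \<star> l'"
      by (simp add: y fun_eq_iff algebra_simps)
    then show ?thesis
      using kill y L(1) by (simp add: fvec.subspace_add fvec.subspace_scale)
  qed
  obtain g e w0 where g: "0 < g" "laurent_t ^ g = 1 + ?P ^ 2 * e + s * w0"
    using laurent_t_power_congruent_one[OF p s] by blast
  obtain c where c: "\<And>r y b. 0 < r \<Longrightarrow> y \<in> W' \<Longrightarrow>
      ?P ^ b \<star> y \<in> (\<star>) (laurent_t ^ (r * g) - 1) ` W' \<boxplus> L \<Longrightarrow>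
      ?P ^ (c + multiplicity p r) \<star> y \<in> (\<star>) (laurent_t ^ (r * g) - 1) ` W' \<boxplus> L"
    using torsion_exponent_killed_aux[OF p W' subset_trans[OF W'W W(2)] L(1) LW' kill' g(2)] by blast
  obtain g' where g': "g = p ^ multiplicity p g * g'" "\<not> p dvd g'"
    using multiplicity_decompose'[of g p] p g(1) by (metis not_gr_zero not_prime_unit)
  have "?P ^ (c + l + multiplicity p g + multiplicity p r) \<star> x \<in> (\<star>) (laurent_t ^ r - 1) ` W \<boxplus> L"
    if r: "0 < r" and x: "x \<in> W" and b: "?P ^ b \<star> x \<in> (\<star>) (laurent_t ^ r - 1) ` W \<boxplus> L" for r x b
  proof -
    let ?b = "laurent_t ^ r - 1" and ?v = "multiplicity p r"
    let ?D = "(\<star>) ?b ` W \<boxplus> L"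
    have D: "submodule ?D" using W L by (intro submodule_set_sum submodule_scale_image)
    define \<Phi> where "\<Phi> = (\<Sum>j<g. (laurent_t ^ r) ^ j)"
    have \<Phi>: "laurent_t ^ (r * g) - 1 = ?b * \<Phi>"
      unfolding \<Phi>_def power_mult by (rule power_diff_1_eq)
    \<comment> \<open>Modulo t^r - 1 every summand of \<Phi> is 1, so \<Phi> agrees there with the
      integer g, for which it is exchanged in the end.\<close>
    have "\<exists>\<psi>. of_nat n - (\<Sum>j<n. (laurent_t ^ r) ^ j) = ?b * \<psi>" for n
    proof (induction n)
      case 0 then show ?case by (auto intro: exI[of _ 0])
    next
      case (Suc n)
      then obtain \<psi> where \<psi>: "of_nat n - (\<Sum>j<n. (laurent_t ^ r) ^ j) = ?b * \<psi>" by blast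
      have pow: "(laurent_t ^ r) ^ n - 1 = ?b * (\<Sum>j<n. (laurent_t ^ r) ^ j)"
        by (rule power_diff_1_eq)
      have "of_nat (Suc n) - (\<Sum>j<Suc n. (laurent_t ^ r) ^ j)
         = (of_nat n - (\<Sum>j<n. (laurent_t ^ r) ^ j)) - ((laurent_t ^ r) ^ n - 1)"
        by simp
      also have "\<dots> = ?b * (\<psi> - (\<Sum>j<n. (laurent_t ^ r) ^ j))"
        by (simp only: \<psi> pow right_diff_distrib[of ?b])
      finally show ?case by blast
    qed
    then obtain \<psi> where \<psi>: "of_nat g - \<Phi> = ?b * \<psi>" unfolding \<Phi>_def by blast
    define B Q K G where "B = ?P ^ b" and "Q = ?P ^ l" and "K = ?P ^ (c + ?v)" and "G = ?P ^ multiplicity p g"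
    obtain w l1 where w: "w \<in> W" "l1 \<in> L" "B \<star> x = ?b \<star> w + l1"
      using b unfolding B_def by (auto elim!: set_sumE)
    define y where "y = (Q * \<Phi>) \<star> x"
    have "y = Q \<star> (\<Phi> \<star> x) + 0" by (simp add: y_def)
    moreover have "Q \<star> (\<Phi> \<star> x) + 0 \<in> W'"
      unfolding W'_def Q_def using W(1) x fvec.subspace_0[OF L(1)]
      by (intro set_sumI imageI fvec.subspace_scale)
    ultimately have yW: "y \<in> W'" by simp
    have "B * y i = (laurent_t ^ (r * g) - 1) * (Q * w i) + Q * \<Phi> * l1 i" for i
    proof -
      have "B * y i = Q * \<Phi> * (B * x i)" by (simp add: y_def algebra_simps)
      also have "B * x i = ?b * w i + l1 i" using w(3) by (simp add: fun_eq_iff)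
      finally show ?thesis unfolding \<Phi> by (simp add: algebra_simps)
    qed
    then have eq: "B \<star> y = (laurent_t ^ (r * g) - 1) \<star> (Q \<star> w + 0) + (Q * \<Phi>) \<star> l1"
      by (simp add: fun_eq_iff)
    have "Q \<star> w + 0 \<in> W'"
      unfolding W'_def Q_def using w(1) fvec.subspace_0[OF L(1)] by (intro set_sumI imageI)
    then have "B \<star> y \<in> (\<star>) (laurent_t ^ (r * g) - 1) ` W' \<boxplus> L"
      unfolding eq using w(2) L(1) by (intro set_sumI imageI fvec.subspace_scale)
    then have "K \<star> y \<in> (\<star>) (laurent_t ^ (r * g) - 1) ` W' \<boxplus> L"
      unfolding B_def K_def by (rule c[OF r yW])
    then obtain w' l2 where w': "w' \<in> W'" "l2 \<in> L" "K \<star> y = (laurent_t ^ (r * g) - 1) \<star> w' + l2"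
      by (auto elim!: set_sumE)
    \<comment> \<open>\<Phi> maps z into L, and g z differs from \<Phi> z by a multiple of t^r - 1;
      hence g z lies in \<open>?D\<close>, and with it g K Q x.\<close>
    define z where "z = (K * Q) \<star> x - ?b \<star> w'"
    have "w' \<in> W" using w'(1) W'W by blast
    then have "z \<in> W"
      unfolding z_def using W x by (intro fvec.subspace_diff fvec.subspace_scale)
    have "of_nat g * (K * Q * x i) = ?b * (of_nat g * w' i + \<psi> * z i) + l2 i" for i
    proof -
      have "K * y i = ?b * \<Phi> * w' i + l2 i"
        using w'(3) unfolding \<Phi> by (simp add: fun_eq_iff)
      then have "\<Phi> * z i = l2 i"
        by (simp add: z_def y_def algebra_simps)
      moreover have "of_nat g * (K * Q * x i) = (of_nat g - \<Phi>) * z i + \<Phi> * z i + ?b * (of_nat g * w' i)"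
        by (simp add: z_def algebra_simps)
      ultimately show ?thesis unfolding \<psi> by (simp only: distrib_left mult.assoc ac_simps)
    qed
    then have eq': "(of_nat g * (K * Q)) \<star> x = ?b \<star> (of_nat g \<star> w' + \<psi> \<star> z) + l2"
      by (simp add: fun_eq_iff mult.assoc)
    have gD: "(of_nat g * (K * Q)) \<star> x \<in> ?D"
      unfolding eq' using W(1) \<open>w' \<in> W\<close> \<open>z \<in> W\<close> w'(2)
      by (intro set_sumI imageI fvec.subspace_add fvec.subspace_scale)
    \<comment> \<open>The factor g' of g prime to p is removed by Bezout against B = p^b, since B x
      lies in \<open>?D\<close> already.\<close>
    obtain \<alpha> \<beta> where ab: "\<alpha> * B + \<beta> * (of_nat g' + ?P * 0) = 1"
      using coprime_mod_prime_power[OF p g'(2)] unfolding B_def by blast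
    have G: "(of_nat g :: laurent) = G * of_nat g'"
      unfolding G_def using g'(1) by (metis of_nat_mult of_nat_power)
    have "G * K * Q * x i = \<alpha> * G * K * Q * (B * x i) + \<beta> * (of_nat g * (K * Q) * x i)" for i
    proof -
      have "(\<alpha> * B + \<beta> * (of_nat g' + ?P * 0)) * (G * K * Q * x i)
        = \<alpha> * G * K * Q * (B * x i) + \<beta> * (of_nat g * (K * Q) * x i)"
        by (simp add: G algebra_simps)
      then show ?thesis unfolding ab by simp
    qed
    then have eq'': "(G * K * Q) \<star> x = (\<alpha> * G * K * Q) \<star> (B \<star> x) + \<beta> \<star> ((of_nat g * (K * Q)) \<star> x)"
      by (simp add: fun_eq_iff mult.assoc)
    have "(G * K * Q) \<star> x \<in> ?D"
      unfolding eq''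
      by (rule fvec.subspace_add[OF D fvec.subspace_scale[OF D b[folded B_def]] fvec.subspace_scale[OF D gD]])
    moreover have "G * K * Q = ?P ^ (c + l + multiplicity p g + ?v)"
      by (simp add: G_def K_def Q_def power_add mult.assoc mult.commute mult.left_commute)
    ultimately show ?thesis by simp
  qed
  then show ?thesis by blast
qed

subsection \<open>Square matrices acting on the free module\<close>

definition mat_apply :: "'a::comm_ring_1 mat \<Rightarrow> (nat \<Rightarrow> 'a) \<Rightarrow> nat \<Rightarrow> 'a" where
  "mat_apply A f = (\<lambda>i. if i < dim_row A then \<Sum>j<dim_col A. A $$ (i, j) * f j else 0)"

definition unit_fun :: "nat \<Rightarrow> nat \<Rightarrow> 'a::comm_ring_1" where
  "unit_fun i = (\<lambda>j. if j = i then 1 else 0)"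

definition col_fun :: "'a::comm_ring_1 mat \<Rightarrow> nat \<Rightarrow> nat \<Rightarrow> 'a" where
  "col_fun A j = (\<lambda>i. if i < dim_row A then A $$ (i, j) else 0)"

lemma mat_apply_add: "mat_apply A (f + g) = mat_apply A f + mat_apply A g"
  by (simp add: mat_apply_def fun_eq_iff distrib_left sum.distrib)

lemma mat_apply_diff: "mat_apply A (f - g) = mat_apply A f - mat_apply A g"
  by (simp add: mat_apply_def fun_eq_iff right_diff_distrib sum_subtractf)

lemma mat_apply_scale: "mat_apply A (c \<star> f) = c \<star> mat_apply A f"
  by (simp add: mat_apply_def fun_eq_iff sum_distrib_left mult.left_commute)

lemma mat_apply_zero [simp]: "mat_apply A 0 = 0"
  by (simp add: mat_apply_def fun_eq_iff)

lemma mat_apply_supported: "A \<in> carrier_mat n m \<Longrightarrow> mat_apply A f \<in> supported {..<n}"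
  by (auto simp: mat_apply_def supported_def)

lemma mat_apply_mult:
  assumes "A \<in> carrier_mat n m" "B \<in> carrier_mat m k"
  shows "mat_apply (A * B) f = mat_apply A (mat_apply B f)"
proof
  fix i
  show "mat_apply (A * B) f i = mat_apply A (mat_apply B f) i"
  proof (cases "i < n")
    case True
    have "mat_apply (A * B) f i = (\<Sum>j<k. (\<Sum>l<m. A $$ (i, l) * B $$ (l, j)) * f j)"
      using assms True by (simp add: mat_apply_def scalar_prod_def atLeast0LessThan)
    also have "\<dots> = (\<Sum>l<m. A $$ (i, l) * (\<Sum>j<k. B $$ (l, j) * f j))"
      by (simp add: sum_distrib_left sum_distrib_right mult.assoc) (rule sum.swap)
    also have "\<dots> = mat_apply A (mat_apply B f) i"
      using assms True by (simp add: mat_apply_def)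
    finally show ?thesis .
  qed (use assms in \<open>simp add: mat_apply_def\<close>)
qed

lemma mat_apply_scalar_mat:
  assumes "f \<in> supported {..<n}"
  shows "mat_apply (c \<cdot>\<^sub>m 1\<^sub>m n) f = c \<star> f"
proof
  fix i
  have "(\<Sum>j<n. (c \<cdot>\<^sub>m 1\<^sub>m n) $$ (i, j) * f j) = (\<Sum>j<n. if j = i then c * f j else 0)" if "i < n"
    using that by (intro sum.cong) auto
  then show "mat_apply (c \<cdot>\<^sub>m 1\<^sub>m n) f i = (c \<star> f) i"
    using assms by (auto simp: mat_apply_def supported_def sum.delta)
qed

lemma mat_apply_unit_fun: "j < dim_col A \<Longrightarrow> mat_apply A (unit_fun j) = col_fun A j"
proof
  fix i assume "j < dim_col A"
  have "(\<Sum>k<dim_col A. A $$ (i, k) * unit_fun j k) = (\<Sum>k<dim_col A. if k = j then A $$ (i, k) else 0)"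
    by (intro sum.cong) (auto simp: unit_fun_def)
  then show "mat_apply A (unit_fun j) i = col_fun A j i"
    using \<open>j < dim_col A\<close> by (simp add: mat_apply_def col_fun_def sum.delta)
qed

lemma mat_apply_eq_sum_cols: "mat_apply A f = (\<Sum>j<dim_col A. f j \<star> col_fun A j)"
proof -
  have sum_apply: "(\<Sum>j\<in>S. g j) i = (\<Sum>j\<in>S. g j i)" for S :: "nat set" and g :: "nat \<Rightarrow> nat \<Rightarrow> 'a" and i
    by (induction S rule: infinite_finite_induct) auto
  show ?thesis
    by (auto simp: fun_eq_iff sum_apply mat_apply_def col_fun_def mult.commute intro!: sum.cong)
qed

lemma submodule_mat_apply_image:
  assumes "submodule S"
  shows "submodule (mat_apply A ` S)"
proof (rule fvec.subspaceI)
  show "0 \<in> mat_apply A ` S"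
    using fvec.subspace_0[OF assms] by (metis imageI mat_apply_zero)
  show "x + y \<in> mat_apply A ` S" if "x \<in> mat_apply A ` S" "y \<in> mat_apply A ` S" for x y
  proof -
    obtain a b where "a \<in> S" "b \<in> S" "x = mat_apply A a" "y = mat_apply A b"
      using \<open>x \<in> mat_apply A ` S\<close> \<open>y \<in> mat_apply A ` S\<close> by auto
    then have "x + y = mat_apply A (a + b)" "a + b \<in> S"
      using assms by (simp_all add: mat_apply_add fvec.subspace_add)
    then show ?thesis by simp
  qed
  show "c \<star> x \<in> mat_apply A ` S" if "x \<in> mat_apply A ` S" for c x
  proof -
    obtain a where "a \<in> S" "x = mat_apply A a"
      using \<open>x \<in> mat_apply A ` S\<close> by auto
    then have "c \<star> x = mat_apply A (c \<star> a)" "c \<star> a \<in> S"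
      using assms by (simp_all add: mat_apply_scale fvec.subspace_scale)
    then show ?thesis by simp
  qed
qed

lemma mat_apply_adj_mat:
  assumes "A \<in> carrier_mat n n" "f \<in> supported {..<n}"
  shows "mat_apply A (mat_apply (adj_mat A) f) = det A \<star> f"
  using mat_apply_mult[OF assms(1) adj_mat(1)[OF assms(1)], of f] adj_mat(2)[OF assms(1)]
    mat_apply_scalar_mat[OF assms(2)] by simp

lemma replace_col_carrier: "A \<in> carrier_mat n n \<Longrightarrow> replace_col A b k \<in> carrier_mat n n"
  by (auto simp: replace_col_def)

lemma col_fun_replace_col:
  assumes "A \<in> carrier_mat n n" "j < n" "v \<in> supported {..<n}"
  shows "col_fun (replace_col A (vec n v) k) j = (if j = k then v else col_fun A j)"
  using assms by (auto simp: col_fun_def replace_col_def fun_eq_iff supported_def)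

lemma det_replace_col_mat_apply:
  assumes "A \<in> carrier_mat n n" "k < n"
  shows "det (replace_col A (vec n (mat_apply A f)) k) = f k * det A"
proof -
  have "A *\<^sub>v vec n f = vec n (mat_apply A f)"
    using assms by (auto simp: mat_apply_def scalar_prod_def atLeast0LessThan)
  then show ?thesis
    using cramer_lemma_mat[OF assms(1) vec_carrier assms(2), of f] assms(2) by simp
qed

text \<open>Linearity in one column is read off from Cramer's rule: for the matrix whose column k is
  v, the vector c v is the image of c times a unit vector.\<close>

lemma det_replace_col_scale:
  assumes A: "A \<in> carrier_mat n n" and k: "k < n" and v: "v \<in> supported {..<n}"
  shows "det (replace_col A (vec n (c \<star> v)) k) = c * det (replace_col A (vec n v) k)"
proof -
  let ?A = "replace_col A (vec n v) k"
  have A': "?A \<in> carrier_mat n n" using A by (rule replace_col_carrier)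
  have "mat_apply ?A (c \<star> unit_fun k) = c \<star> v"
    using A A' k v by (simp add: mat_apply_scale mat_apply_unit_fun col_fun_replace_col carrier_matD)
  moreover have "replace_col ?A b k = replace_col A b k" for b
    using A by (auto simp: replace_col_def)
  moreover have "det (replace_col ?A (vec n (mat_apply ?A (c \<star> unit_fun k))) k) = (c \<star> unit_fun k) k * det ?A"
    by (rule det_replace_col_mat_apply[OF A' k])
  ultimately show ?thesis by (simp add: unit_fun_def)
qed

lemma unit_fun_supported: "i \<in> I \<Longrightarrow> unit_fun i \<in> supported I"
  by (auto simp: unit_fun_def supported_def)

section \<open>Prime factors of determinants and the exchange of columns\<close>

lemma prime_dvd_laurent_mult_nat:
  "prime p \<Longrightarrow> of_nat p dvd (f * g :: laurent) \<Longrightarrow> of_nat p dvd f \<or> of_nat p dvd g"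
  using prime_dvd_laurent_mult[of "int p" f g] by simp

lemma prime_not_dvd_laurent_one:
  assumes "prime p"
  shows "\<not> of_nat p dvd (1 :: laurent)"
proof
  assume "of_nat p dvd (1 :: laurent)"
  then have "int p dvd lookup (1 :: laurent) 0"
    by (intro of_int_dvd_laurent_iff[THEN iffD1, rule_format]) simp
  then show False
    using assms by (simp add: lookup_one when_def)
qed

lemma of_nat_prime_nonzero: "prime p \<Longrightarrow> (of_nat p :: laurent) \<noteq> 0"
  by (simp add: prime_gt_0_nat)

text \<open>The vector is divided by p as long as p divides all entries. Saturation keeps the
  quotient in L, and a fixed nonzero coefficient shrinks in absolute value, so the process
  ends.\<close>

lemma primitive_element_exists:
  assumes p: "prime p" and sat: "\<And>v. v \<in> supported {..<N} \<Longrightarrow> of_nat p \<star> v \<in> L \<Longrightarrow> v \<in> L"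
    and I: "I \<subseteq> {..<N}" and w: "w \<in> L" "w \<in> supported I" "w \<noteq> 0"
  shows "\<exists>w\<in>L \<inter> supported I. \<exists>i. \<not> of_nat p dvd (w i :: laurent)"
proof -
  obtain i where "w i \<noteq> 0" using w(3) by (auto simp: fun_eq_iff)
  then obtain k where "lookup (w i) k \<noteq> 0"
    by (metis lookup_zero poly_mapping_eqI)
  then show ?thesis
    using w
  proof (induction "nat \<bar>lookup (w i) k\<bar>" arbitrary: w rule: less_induct)
    case less
    show ?case
    proof (cases "\<forall>j. of_nat p dvd w j")
      case True
      then obtain v where v: "\<And>j. w j = of_nat p * v j"
        unfolding dvd_def by metis
      then have w_eq: "w = of_nat p \<star> v" by (simp add: fun_eq_iff)
      have supp: "v \<in> supported I"
        using less.prems(3) v of_nat_prime_nonzero[OF p] by (auto simp: supported_def)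
      then have "v \<in> L" using sat[of v] supported_mono[OF I] less.prems(2) w_eq by auto
      have "lookup (w i) k = int p * lookup (v i) k"
        using lookup_of_int_mult[of "int p" "v i" k] v[of i] by simp
      then have 1: "lookup (v i) k \<noteq> 0" and 2: "nat \<bar>lookup (v i) k\<bar> < nat \<bar>lookup (w i) k\<bar>"
        using less.prems(1) prime_gt_1_nat[OF p] by (auto simp: abs_mult)
      have "v \<noteq> 0" using 1 by auto
      from less.hyps[OF 2 1 \<open>v \<in> L\<close> supp this] show ?thesis .
    next
      case False
      then show ?thesis using less.prems by auto
    qed
  qed
qed

text \<open>Unit vectors are exchanged for elements of \<open>L\<close> as long as \<open>L\<close> meets the span of the remaining
  ones.\<close>

lemma exchange_basis:
  fixes L :: "(nat \<Rightarrow> laurent) set"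
  assumes p: "prime p" and sat: "\<And>v. v \<in> supported {..<N} \<Longrightarrow> of_nat p \<star> v \<in> L \<Longrightarrow> v \<in> L"
    and L: "submodule L"
  obtains I B where "I \<subseteq> {..<N}" "B \<in> carrier_mat N N" "\<not> of_nat p dvd det B"
    "\<And>j. j \<in> I \<Longrightarrow> col_fun B j = unit_fun j" "\<And>j. j \<in> {..<N} - I \<Longrightarrow> col_fun B j \<in> L"
    "L \<inter> supported I = {0}"
proof -
  define Q where "Q I B \<longleftrightarrow> I \<subseteq> {..<N} \<and> B \<in> carrier_mat N N \<and> \<not> of_nat p dvd det B \<and>
    (\<forall>j\<in>I. col_fun B j = unit_fun j) \<and> (\<forall>j\<in>{..<N} - I. col_fun B j \<in> L)"
    for I and B :: "laurent mat"
  have "Q {..<N} (1\<^sub>m N)"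
    using prime_not_dvd_laurent_one[OF p] by (auto simp: Q_def col_fun_def unit_fun_def fun_eq_iff)
  then have "\<exists>B. Q {..<N} B" by blast
  \<comment> \<open>Among all partial exchanges one with the fewest remaining unit vectors is taken;
    a further exchange would contradict this choice.\<close>
  then have "\<exists>I. (\<exists>B. Q I B) \<and> (\<forall>I'. (\<exists>B. Q I' B) \<longrightarrow> card I \<le> card I')"
    by (rule ex_has_least_nat)
  then obtain I where QI: "(\<exists>B. Q I B) \<and> (\<forall>I'. (\<exists>B. Q I' B) \<longrightarrow> card I \<le> card I')"
    by (rule exE)
  note least = QI[THEN conjunct2]
  obtain B where Q: "Q I B" using QI by (elim conjE exE)
  then have I: "I \<subseteq> {..<N}" and B: "B \<in> carrier_mat N N" and det: "\<not> of_nat p dvd det B"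
    and unit: "\<And>j. j \<in> I \<Longrightarrow> col_fun B j = unit_fun j"
    and inL: "\<And>j. j \<in> {..<N} - I \<Longrightarrow> col_fun B j \<in> L"
    by (auto simp: Q_def)
  have "w = 0" if w: "w \<in> L" "w \<in> supported I" for w
  proof (rule ccontr)
    assume "w \<noteq> 0"
    obtain w' i where w': "w' \<in> L" "w' \<in> supported I" "\<not> of_nat p dvd w' i"
      using primitive_element_exists[OF p sat I w \<open>w \<noteq> 0\<close>] by auto
    have "i \<in> I" using w' by (auto simp: supported_def)
    then have "i < N" using I by auto
    have supp: "w' \<in> supported {..<N}" using w'(2) supported_mono[OF I] by blast
    \<comment> \<open>The columns of B indexed by I are still unit vectors, and w' is supported on
      I. By Cramer's rule the exchange then multiplies the determinant by the entry of w' at i,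
      which p does not divide.\<close>
    have "mat_apply B w' = w'"
    proof
      fix k
      have "B $$ (k, j) * w' j = (if j = k then w' k else 0)" if "j < N" "k < N" for j
        using w'(2) unit[of j] B that
        by (cases "j \<in> I") (auto simp: supported_def col_fun_def unit_fun_def fun_eq_iff split: if_splits)
      then show "mat_apply B w' k = w' k"
        using B supp by (auto simp: mat_apply_def supported_def sum.delta)
    qed
    then have "det (replace_col B (vec N w') i) = w' i * det B"
      using det_replace_col_mat_apply[OF B \<open>i < N\<close>, of w'] by simp
    then have nd: "\<not> of_nat p dvd det (replace_col B (vec N w') i)"
      using prime_dvd_laurent_mult_nat[OF p] w'(3) det by metis
    have cf: "col_fun (replace_col B (vec N w') i) j = (if j = i then w' else col_fun B j)" if "j < N" for j
      using col_fun_replace_col[OF B that supp] .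
    have "Q (I - {i}) (replace_col B (vec N w') i)"
      unfolding Q_def
    proof (intro conjI ballI)
      show "I - {i} \<subseteq> {..<N}" using I by auto
      show "replace_col B (vec N w') i \<in> carrier_mat N N" by (rule replace_col_carrier[OF B])
      show "\<not> of_nat p dvd det (replace_col B (vec N w') i)" by (rule nd)
      show "col_fun (replace_col B (vec N w') i) j = unit_fun j" if "j \<in> I - {i}" for j
        using that I unit cf[of j] by auto
      show "col_fun (replace_col B (vec N w') i) j \<in> L" if "j \<in> {..<N} - (I - {i})" for j
        using that w'(1) inL[of j] cf[of j] by (cases "j = i") auto
    qed
    then have "\<exists>B. Q (I - {i}) B" by (rule exI)
    then have "card I \<le> card (I - {i})" by (rule least[rule_format])
    moreover have "finite I" using I finite_subset by blast
    ultimately show False using card_Diff1_less[of I i] \<open>i \<in> I\<close> by linarith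
  qed
  then have zero: "L \<inter> supported I = {0}"
    using fvec.subspace_0[OF L] fvec.subspace_0[OF submodule_supported] by blast
  show ?thesis
    by (rule that[OF I B det]) (auto simp: unit inL zero)
qed

lemma mat_eq_mult_if_cols_in_image:
  fixes A :: "'a::comm_ring_1 mat"
  assumes A: "A \<in> carrier_mat n n" and B: "B \<in> carrier_mat n n"
    and cols: "\<And>j. j < n \<Longrightarrow> col_fun B j \<in> mat_apply A ` supported {..<n}"
  shows "\<exists>C \<in> carrier_mat n n. B = A * C"
proof -
  have "\<forall>j. \<exists>c. j < n \<longrightarrow> col_fun B j = mat_apply A c"
    using cols by auto
  then obtain c where c: "\<And>j. j < n \<Longrightarrow> col_fun B j = mat_apply A (c j)" by metis
  define C where "C = mat n n (\<lambda>(i, j). c j i)"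
  have "B = A * C"
  proof (rule eq_matI)
    fix i j assume ij: "i < dim_row (A * C)" "j < dim_col (A * C)"
    then have "B $$ (i, j) = mat_apply A (c j) i"
      using c[of j, THEN fun_cong, of i] A B by (auto simp: C_def col_fun_def)
    then show "B $$ (i, j) = (A * C) $$ (i, j)"
      using ij A by (simp add: C_def mat_apply_def scalar_prod_def atLeast0LessThan)
  qed (use A B in \<open>auto simp: C_def\<close>)
  then show ?thesis by (auto simp: C_def)
qed

text \<open>If no such vector existed, the exchange lemma would apply to the image of \<open>B\<close> and yield a multiple
  of \<open>B\<close> with determinant prime to \<open>p\<close>.\<close>

lemma kernel_vector_mod_prime:
  fixes B :: "laurent mat"
  assumes p: "prime p" and B: "B \<in> carrier_mat N N" and det: "det B \<noteq> 0" "of_nat p dvd det B"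
  shows "\<exists>c v i. v \<in> supported {..<N} \<and> i < N \<and> \<not> of_nat p dvd c i \<and>
    c \<in> supported {..<N} \<and> mat_apply B c = of_nat p \<star> v"
proof -
  let ?F = "supported {..<N} :: (nat \<Rightarrow> laurent) set" and ?P = "of_nat p :: laurent"
  let ?L = "mat_apply B ` ?F"
  have L: "submodule ?L" by (intro submodule_mat_apply_image submodule_supported)
  have "\<not> (\<forall>v\<in>?F. ?P \<star> v \<in> ?L \<longrightarrow> v \<in> ?L)"
  proof
    assume sat: "\<forall>v\<in>?F. ?P \<star> v \<in> ?L \<longrightarrow> v \<in> ?L"
    obtain I B' where I: "I \<subseteq> {..<N}" and B': "B' \<in> carrier_mat N N" "\<not> ?P dvd det B'"
      and cols: "\<And>j. j \<in> {..<N} - I \<Longrightarrow> col_fun B' j \<in> ?L" and zero: "?L \<inter> supported I = {0}"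
      using exchange_basis[OF p sat[rule_format] L] by metis
    show False
    proof (cases "I = {}")
      case True
      then obtain C where "C \<in> carrier_mat N N" "B' = B * C"
        using mat_eq_mult_if_cols_in_image[OF B B'(1)] cols by auto
      then have "?P dvd det B'"
        using det_mult[OF B, of C] det(2) by simp
      then show False using B' by blast
    next
      case False
      then obtain i where "i \<in> I" by blast
      then have "unit_fun i \<in> ?F" using I by (auto intro: unit_fun_supported)
      \<comment> \<open>By the adjugate, \<open>det B\<close> times a unit vector at i in I is a
        nonzero element of the image supported on I, which the exchange excludes. So I must be
        empty, and the exchanged matrix is a multiple of B.\<close>
      then have "mat_apply B (mat_apply (adj_mat B) (unit_fun i)) = det B \<star> unit_fun i"
        using mat_apply_adj_mat[OF B] by blast
      moreover have "mat_apply (adj_mat B) (unit_fun i) \<in> ?F"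
        using mat_apply_supported[OF adj_mat(1)[OF B]] .
      ultimately have "det B \<star> unit_fun i \<in> ?L" by (metis imageI)
      moreover have "det B \<star> unit_fun i \<in> supported I"
        using unit_fun_supported[OF \<open>i \<in> I\<close>] submodule_supported fvec.subspace_scale by blast
      ultimately have "det B \<star> unit_fun i = 0" using zero by blast
      then have "(det B \<star> unit_fun i) i = 0" by simp
      then show False using det(1) by (simp add: unit_fun_def)
    qed
  qed
  then obtain v where v: "v \<in> ?F" "?P \<star> v \<in> ?L" "v \<notin> ?L" by blast
  then obtain c where c: "c \<in> ?F" "mat_apply B c = ?P \<star> v" by auto
  \<comment> \<open>If p divided all of c, cancelling p would put v into the image of B.\<close>
  have "\<exists>i<N. \<not> ?P dvd c i"
  proof (rule ccontr)
    assume "\<not> (\<exists>i<N. \<not> ?P dvd c i)"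
    then have "\<forall>i. \<exists>d. c i = ?P * d"
      using c(1) by (auto simp: supported_def dvd_def) (metis mult_zero_right not_le_imp_less)
    then obtain d where d: "\<And>i. c i = ?P * d i" by metis
    then have "c = ?P \<star> d" by (simp add: fun_eq_iff)
    then have "?P \<star> mat_apply B d = ?P \<star> v"
      using c(2) by (simp add: mat_apply_scale)
    then have "mat_apply B d = v"
      using of_nat_prime_nonzero[OF p] by (auto simp: fun_eq_iff)
    moreover have "d \<in> ?F"
      using c(1) d of_nat_prime_nonzero[OF p] by (auto simp: supported_def)
    ultimately show False using v(3) by blast
  qed
  then show ?thesis using c v by blast
qed

section \<open>Indices of images of matrices modulo t^r - 1 and p^e\<close>

definition cong_module :: "nat \<Rightarrow> nat \<Rightarrow> nat \<Rightarrow> nat set \<Rightarrow> (nat \<Rightarrow> laurent) set" where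
  "cong_module p r e I =
    (\<star>) (laurent_t ^ r - 1) ` supported I \<boxplus> (\<star>) (of_nat p ^ e) ` supported I"

lemma submodule_cong_module: "submodule (cong_module p r e I)"
  unfolding cong_module_def by (intro submodule_set_sum submodule_scale_image submodule_supported)

lemma cong_module_subset: "cong_module p r e I \<subseteq> supported I"
  unfolding cong_module_def
  by (intro set_sum_least scale_image_subset submodule_supported add_subgroup_submodule)

lemma index_cong_module:
  assumes "prime p" "0 < r" "finite I"
  shows "finite_index (supported I) (cong_module p r e I)"
    "sub_index (supported I) (cong_module p r e I) = p ^ (e * card I * r)"
proof -
  have eq: "cong_module p r e I = {f \<in> supported I. \<forall>i. f i \<in> ideal2 (laurent_t ^ r - 1) (of_int (int p ^ e))}"
    unfolding cong_module_def scale_set_sum_supported by simp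
  have m: "0 < int p ^ e" using assms(1) by (simp add: prime_gt_0_nat)
  show "finite_index (supported I) (cong_module p r e I)"
    unfolding eq by (rule index_coordinatewise[OF add_subgroup_ideal2 assms(3) index_binomial_ideal2(1)[OF assms(2) m]])
  have "sub_index (supported I) (cong_module p r e I) = (nat (int p ^ e) ^ r) ^ card I"
    unfolding eq index_coordinatewise(2)[OF add_subgroup_ideal2 assms(3) index_binomial_ideal2(1)[OF assms(2) m]]
      index_binomial_ideal2(2)[OF assms(2) m] ..
  also have "\<dots> = p ^ (e * card I * r)"
    by (simp add: nat_power_eq power_mult[symmetric] mult.commute mult.left_commute)
  finally show "sub_index (supported I) (cong_module p r e I) = p ^ (e * card I * r)" .
qed

text \<open>Multiplication by q maps K modulo S + q^e K onto S + q K modulo S + q^(e+1) K. Raising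
  the exponent by one therefore costs at most one more factor, the index of S + q K.\<close>

lemma index_power_le:
  fixes q :: "'a::comm_ring_1"
  assumes K: "submodule K" and S: "submodule S" "S \<subseteq> K"
    and fin: "finite_index K (S \<boxplus> (\<star>) q ` K)"
  shows "finite_index K (S \<boxplus> (\<star>) (q ^ e) ` K) \<and>
    sub_index K (S \<boxplus> (\<star>) (q ^ e) ` K) \<le> sub_index K (S \<boxplus> (\<star>) q ` K) ^ e"
proof (induction e)
  case 0
  have "(\<star>) (1 :: 'a) ` K = K" by auto
  then have eq: "S \<boxplus> (\<star>) (q ^ 0) ` K = K"
    using set_sum_least[OF S(2) order_refl add_subgroup_submodule[OF K]]
      set_sum_upper2[OF fvec.subspace_0[OF S(1)], of K] by auto
  have "translate K x = translate K 0" if "x \<in> K" for x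
    using that by (simp add: translate_eq_iff[OF add_subgroup_submodule[OF K]])
  then have "translate K ` K \<subseteq> {translate K 0}" by auto
  then have "finite (translate K ` K)" "card (translate K ` K) \<le> 1"
    by (auto dest: finite_subset card_mono[rotated])
  then show ?case
    unfolding eq finite_index_def sub_index_def by simp
next
  case (Suc e)
  let ?S1 = "S \<boxplus> (\<star>) q ` K" and ?Se = "\<lambda>e. S \<boxplus> (\<star>) (q ^ e) ` K"
  note add = add_subgroup_submodule
  have sub: "submodule (?Se e)" for e by (intro submodule_set_sum submodule_scale_image K S)
  have sub1: "submodule ?S1" by (intro submodule_set_sum submodule_scale_image K S)
  have le1: "?S1 \<subseteq> K" by (rule set_sum_least[OF S(2) scale_image_subset[OF K] add[OF K]])
  have "(\<star>) (q ^ Suc e) ` K \<subseteq> (\<star>) q ` K"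
  proof
    fix x assume "x \<in> (\<star>) (q ^ Suc e) ` K"
    then obtain k where "k \<in> K" "x = q \<star> (q ^ e \<star> k)" by auto
    then show "x \<in> (\<star>) q ` K" using fvec.subspace_scale[OF K] by blast
  qed
  then have le: "?Se (Suc e) \<subseteq> ?S1" by (rule set_sum_mono[OF order_refl])
  have 1: "q \<star> x \<in> ?Se (Suc e)" if x: "x \<in> ?Se e" for x
  proof -
    obtain a k where ak: "a \<in> S" "k \<in> K" "x = a + q ^ e \<star> k"
      using x by (auto elim!: set_sumE)
    have "q \<star> x = q \<star> a + q ^ Suc e \<star> k" by (simp add: ak fvec.scale_right_distrib)
    then show ?thesis
      using ak fvec.subspace_scale[OF S(1)] by (simp only: set_sumI imageI)
  qed
  have 2: "?S1 \<subseteq> (\<star>) q ` K \<boxplus> ?Se (Suc e)"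
    by (subst set_sum_commute)
      (rule set_sum_mono[OF order_refl set_sum_upper1[OF fvec.subspace_0[OF submodule_scale_image[OF K]]]])
  have hom: "finite_index ?S1 (?Se (Suc e)) \<and> sub_index ?S1 (?Se (Suc e)) \<le> sub_index K (?Se e)"
    using index_hom_image[OF add[OF sub] add[OF sub] fvec.scale_right_diff_distrib 1 2] Suc by blast
  have tower: "sub_index K (?Se (Suc e)) = sub_index K ?S1 * sub_index ?S1 (?Se (Suc e))"
    "finite_index K (?Se (Suc e)) \<longleftrightarrow> finite_index K ?S1 \<and> finite_index ?S1 (?Se (Suc e))"
    by (rule index_tower[OF add[OF sub] add[OF sub1] add[OF K] le le1])+
  have "sub_index ?S1 (?Se (Suc e)) \<le> sub_index K ?S1 ^ e"
    using hom Suc by linarith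
  then have "sub_index K (?Se (Suc e)) \<le> sub_index K ?S1 ^ Suc e"
    unfolding tower(1) power_Suc[of "sub_index K ?S1"] by (rule mult_le_mono2)
  then show ?case
    using tower(2) fin hom by blast
qed

text \<open>This is the source of the constants C: a quotient annihilated by s prime to p
  contributes at most the e-th power of the index of s F + p F, whatever r is.\<close>

lemma index_killed_le:
  assumes p: "prime p" and s: "\<not> of_nat p dvd (s :: laurent)" and I: "finite I"
  shows "\<exists>C\<ge>1. \<forall>e. finite_index (supported I) ((\<star>) s ` supported I \<boxplus> (\<star>) (of_nat p ^ e) ` supported I) \<and>
    sub_index (supported I) ((\<star>) s ` supported I \<boxplus> (\<star>) (of_nat p ^ e) ` supported I) \<le> C ^ e"
proof -
  let ?F = "supported I :: (nat \<Rightarrow> laurent) set" and ?P = "of_nat p :: laurent"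
  have "finite_index UNIV (ideal2 s ?P)"
    using finite_index_prime_ideal2[of "int p" s] p s by simp
  then have fin: "finite_index ?F ((\<star>) s ` ?F \<boxplus> (\<star>) ?P ` ?F)"
    unfolding scale_set_sum_supported by (intro index_coordinatewise(1) add_subgroup_ideal2 I)
  define C where "C = sub_index ?F ((\<star>) s ` ?F \<boxplus> (\<star>) ?P ` ?F)"
  have "1 \<le> C"
    using sub_index_pos[OF fin fvec.subspace_0[OF submodule_supported]] by (simp add: C_def)
  moreover have "finite_index ?F ((\<star>) s ` ?F \<boxplus> (\<star>) (?P ^ e) ` ?F) \<and>
    sub_index ?F ((\<star>) s ` ?F \<boxplus> (\<star>) (?P ^ e) ` ?F) \<le> C ^ e" for e
    unfolding C_def
    by (rule index_power_le[OF submodule_supported submodule_scale_image[OF submodule_supported]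
          scale_image_subset[OF submodule_supported] fin])
  ultimately show ?thesis by blast
qed

lemma power_scale_image_mono:
  assumes "submodule K" "m \<le> n"
  shows "(\<star>) (q ^ n) ` K \<subseteq> (\<star>) (q ^ m) ` K"
proof
  fix x assume "x \<in> (\<star>) (q ^ n) ` K"
  then obtain k where "k \<in> K" "x = q ^ n \<star> k" by auto
  moreover have "q ^ n = q ^ m * q ^ (n - m)"
    using assms(2) by (simp add: power_add[symmetric])
  ultimately have "x = q ^ m \<star> (q ^ (n - m) \<star> k)" "q ^ (n - m) \<star> k \<in> K"
    using assms(1) by (simp_all add: fvec.subspace_scale)
  then show "x \<in> (\<star>) (q ^ m) ` K" by blast
qed

lemma mat_apply_cong_module:
  assumes "B \<in> carrier_mat N N" "f \<in> cong_module p r e {..<N}"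
  shows "mat_apply B f \<in> cong_module p r e {..<N}"
  using assms(2) unfolding cong_module_def
  by (auto elim!: set_sumE simp: mat_apply_add mat_apply_scale intro!: set_sumI imageI mat_apply_supported[OF assms(1)])

text \<open>Modulo D only the i-th coordinate matters, and only modulo p. The quotient is an image
  of R / (t^r - 1, p), which has p^r elements.\<close>

lemma index_coordinate_prime:
  assumes p: "prime p" and r: "0 < r" and i: "i < N"
  defines "D \<equiv> {f \<in> supported {..<N}. of_nat p dvd (f i :: laurent)}"
  shows "submodule D" "finite_index (supported {..<N}) (D \<boxplus> cong_module p r e {..<N})"
    "sub_index (supported {..<N}) (D \<boxplus> cong_module p r e {..<N}) \<le> p ^ r"
proof -
  let ?F = "supported {..<N} :: (nat \<Rightarrow> laurent) set"
  let ?J = "cong_module p r e {..<N}" and ?P = "of_nat p :: laurent"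
  let ?H = "ideal2 (laurent_t ^ r - 1) (of_int (int p))"
  show D: "submodule D"
    by (rule fvec.subspaceI) (auto simp: D_def supported_def)
  have fin: "finite_index UNIV ?H"
    using index_binomial_ideal2(1)[OF r, of "int p"] p by (simp add: prime_gt_0_nat)
  have 1: "a \<star> unit_fun i \<in> D \<boxplus> ?J" if a: "a \<in> ?H" for a
  proof -
    obtain u v where uv: "a = (laurent_t ^ r - 1) * u + ?P * v"
      using a unfolding ideal2_def by auto
    have "a \<star> unit_fun i = (?P * v) \<star> unit_fun i + ((laurent_t ^ r - 1) \<star> (u \<star> unit_fun i) + ?P ^ e \<star> 0)"
      by (simp add: uv fun_eq_iff algebra_simps)
    moreover have "(?P * v) \<star> unit_fun i \<in> D"
      using i by (auto simp: D_def supported_def unit_fun_def)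
    moreover have "(laurent_t ^ r - 1) \<star> (u \<star> unit_fun i) + ?P ^ e \<star> 0 \<in> ?J"
      unfolding cong_module_def using i
      by (intro set_sumI imageI fvec.subspace_scale submodule_supported unit_fun_supported fvec.subspace_0) simp
    ultimately show ?thesis by (simp only: set_sumI)
  qed
  have 2: "?F \<subseteq> range (\<lambda>a. a \<star> unit_fun i) \<boxplus> (D \<boxplus> ?J)"
  proof
    fix f assume f: "f \<in> ?F"
    have "f - f i \<star> unit_fun i \<in> D"
      using f i by (auto simp: D_def supported_def unit_fun_def)
    then have "f - f i \<star> unit_fun i \<in> D \<boxplus> ?J"
      using set_sum_upper1[OF fvec.subspace_0[OF submodule_cong_module]] by blast
    then have "f i \<star> unit_fun i + (f - f i \<star> unit_fun i) \<in> range (\<lambda>a. a \<star> unit_fun i) \<boxplus> (D \<boxplus> ?J)"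
      by (intro set_sumI rangeI)
    then show "f \<in> range (\<lambda>a. a \<star> unit_fun i) \<boxplus> (D \<boxplus> ?J)" by simp
  qed
  have hom: "finite_index ?F (D \<boxplus> ?J) \<and> sub_index ?F (D \<boxplus> ?J) \<le> sub_index UNIV ?H"
    using index_hom_image[OF add_subgroup_ideal2 add_subgroup_submodule[OF submodule_set_sum[OF D submodule_cong_module]]
        fvec.scale_left_diff_distrib 1 2 fin] by blast
  then show "finite_index ?F (D \<boxplus> ?J)" by blast
  show "sub_index ?F (D \<boxplus> ?J) \<le> p ^ r"
    using hom index_binomial_ideal2(2)[OF r, of "int p"] p by (simp add: prime_gt_0_nat)
qed

text \<open>A kernel vector modulo \<open>p\<close> is exchanged for a column of \<open>B\<close>, which divides the determinant by \<open>p\<close>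
  up to a factor prime to \<open>p\<close>.\<close>

lemma index_image_le:
  assumes p: "prime p" and B: "B \<in> carrier_mat N N"
    and det: "det B = of_nat p ^ l * s" "\<not> of_nat p dvd (s :: laurent)"
  shows "\<exists>C\<ge>1. \<forall>r>0. \<forall>e.
    finite_index (supported {..<N}) (mat_apply B ` supported {..<N} \<boxplus> cong_module p r e {..<N}) \<and>
    sub_index (supported {..<N}) (mat_apply B ` supported {..<N} \<boxplus> cong_module p r e {..<N}) \<le> p ^ (l * r) * C ^ e"
  using B det
proof (induction l arbitrary: B s)
  case (0 B)
  let ?F = "supported {..<N} :: (nat \<Rightarrow> laurent) set" and ?P = "of_nat p :: laurent"
  obtain C where C: "1 \<le> C" "\<And>e. finite_index ?F ((\<star>) s ` ?F \<boxplus> (\<star>) (?P ^ e) ` ?F)"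
    "\<And>e. sub_index ?F ((\<star>) s ` ?F \<boxplus> (\<star>) (?P ^ e) ` ?F) \<le> C ^ e"
    using index_killed_le[OF p 0(3), of "{..<N}"] by auto
  \<comment> \<open>With l = 0 the determinant is s itself, and the adjugate shows that the image of
    B contains s F.\<close>
  have "(\<star>) s ` ?F \<subseteq> mat_apply B ` ?F"
  proof
    fix x assume "x \<in> (\<star>) s ` ?F"
    then obtain f where "f \<in> ?F" "x = det B \<star> f" using 0 by auto
    then show "x \<in> mat_apply B ` ?F"
      using mat_apply_adj_mat[OF 0(1)] mat_apply_supported[OF adj_mat(1)[OF 0(1)]] by (metis imageI)
  qed
  then have le: "(\<star>) s ` ?F \<boxplus> (\<star>) (?P ^ e) ` ?F \<subseteq> mat_apply B ` ?F \<boxplus> cong_module p r e {..<N}" for r e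
    unfolding cong_module_def
    by (intro set_sum_mono set_sum_upper2 fvec.subspace_0 submodule_scale_image submodule_supported)
  have "finite_index ?F (mat_apply B ` ?F \<boxplus> cong_module p r e {..<N}) \<and>
    sub_index ?F (mat_apply B ` ?F \<boxplus> cong_module p r e {..<N}) \<le> C ^ e" for r e
  proof -
    have 1: "add_subgroup ((\<star>) s ` ?F \<boxplus> (\<star>) (?P ^ e) ` ?F)"
      by (intro add_subgroup_submodule submodule_set_sum submodule_scale_image submodule_supported)
    have 2: "add_subgroup (mat_apply B ` ?F \<boxplus> cong_module p r e {..<N})"
      by (intro add_subgroup_submodule submodule_set_sum submodule_mat_apply_image submodule_supported submodule_cong_module)
    show ?thesis
      using index_larger_sub[OF 1 2 le C(2)] C(3)[of e] by (meson le_trans)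
  qed
  then show ?case using C(1) by auto
next
  case (Suc l B)
  let ?F = "supported {..<N} :: (nat \<Rightarrow> laurent) set" and ?P = "of_nat p :: laurent"
  let ?J = "\<lambda>r e. cong_module p r e {..<N}"
  have "s \<noteq> 0" using Suc.prems(3) by auto
  then have "det B \<noteq> 0" "?P dvd det B"
    using Suc.prems(2) of_nat_prime_nonzero[OF p] by auto
  then obtain c v i where v: "v \<in> ?F" and i: "i < N" and ci: "\<not> ?P dvd c i"
    and c: "c \<in> ?F" and Bc: "mat_apply B c = ?P \<star> v"
    using kernel_vector_mod_prime[OF p Suc.prems(1)] by metis
  define B' where "B' = replace_col B (vec N v) i"
  have B': "B' \<in> carrier_mat N N" unfolding B'_def by (rule replace_col_carrier[OF Suc.prems(1)])
  \<comment> \<open>The determinant of B with column i replaced by B c = p v is evaluated twice, by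
    Cramer's rule and by linearity. So B' has one factor p less, and its remaining factor
    \<open>c i * s\<close> is still prime to p.\<close>
  have "c i * det B = ?P * det B'"
    using det_replace_col_mat_apply[OF Suc.prems(1) i, of c] det_replace_col_scale[OF Suc.prems(1) i v, of ?P]
    unfolding Bc B'_def by simp
  then have "?P * det B' = ?P * (?P ^ l * (c i * s))"
    unfolding Suc.prems(2) by (simp only: power_Suc ac_simps)
  then have det': "det B' = ?P ^ l * (c i * s)"
    by (rule mult_left_cancel[THEN iffD1, OF of_nat_prime_nonzero[OF p]])
  have "\<not> ?P dvd c i * s"
    using prime_dvd_laurent_mult_nat[OF p] ci Suc.prems(3) by blast
  from Suc.IH[OF B' det' this] obtain C where C: "1 \<le> C"
    "\<And>r e. 0 < r \<Longrightarrow> finite_index ?F (mat_apply B' ` ?F \<boxplus> ?J r e)"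
    "\<And>r e. 0 < r \<Longrightarrow> sub_index ?F (mat_apply B' ` ?F \<boxplus> ?J r e) \<le> p ^ (l * r) * C ^ e"
    by blast
  define D where "D = {f \<in> ?F. ?P dvd f i}"
  let ?L0 = "mat_apply B' ` D"
  have "finite_index ?F (mat_apply B ` ?F \<boxplus> ?J r e) \<and>
    sub_index ?F (mat_apply B ` ?F \<boxplus> ?J r e) \<le> p ^ (Suc l * r) * C ^ e" if r: "0 < r" for r e
  proof -
    note D = index_coordinate_prime(1)[OF p r i, folded D_def]
      index_coordinate_prime(2,3)[OF p r i, where e = e, folded D_def]
    note subs = submodule_set_sum submodule_mat_apply_image submodule_supported submodule_cong_module D(1)
    \<comment> \<open>For f in D the entry at i is p h, and p h v = B (h c); the other columns of B'
      are those of B. So B' maps D into the image of B.\<close>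
    have L0_B: "?L0 \<subseteq> mat_apply B ` ?F"
    proof
      fix x assume "x \<in> ?L0"
      then obtain f where f: "f \<in> ?F" "?P dvd f i" "x = mat_apply B' f" by (auto simp: D_def)
      then obtain h where h: "f i = ?P * h" by (auto elim: dvdE)
      have cols: "col_fun B' j = (if j = i then v else col_fun B j)" if "j < N" for j
        unfolding B'_def by (rule col_fun_replace_col[OF Suc.prems(1) that v])
      define f' where "f' = (\<lambda>j. if j = i then 0 else f j)"
      have "mat_apply B' f = (\<Sum>j<N. f j \<star> col_fun B' j)"
        using B' by (simp add: mat_apply_eq_sum_cols)
      also have "\<dots> = f i \<star> v + (\<Sum>j\<in>{..<N} - {i}. f j \<star> col_fun B' j)"
        using i by (subst sum.remove[of _ i]) (auto simp: cols)
      also have "(\<Sum>j\<in>{..<N} - {i}. f j \<star> col_fun B' j) = (\<Sum>j\<in>{..<N} - {i}. f' j \<star> col_fun B j)"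
        by (rule sum.cong) (auto simp: cols f'_def)
      also have "\<dots> = (\<Sum>j<N. f' j \<star> col_fun B j)"
        by (rule sum.mono_neutral_left) (auto simp: f'_def)
      also have "\<dots> = mat_apply B f'"
        using Suc.prems(1) by (simp add: mat_apply_eq_sum_cols)
      also have "f i \<star> v = mat_apply B (h \<star> c)"
        by (simp add: mat_apply_scale Bc h mult.commute)
      finally have "x = mat_apply B (h \<star> c + f')"
        by (simp add: f mat_apply_add fun_eq_iff)
      moreover have "h \<star> c + f' \<in> ?F"
        using c f(1) by (auto simp: supported_def f'_def)
      ultimately show "x \<in> mat_apply B ` ?F" by blast
    qed
    have s0: "add_subgroup (?L0 \<boxplus> ?J r e)" and sB: "add_subgroup (mat_apply B ` ?F \<boxplus> ?J r e)"
      and sB': "add_subgroup (mat_apply B' ` ?F \<boxplus> ?J r e)" and sF: "add_subgroup ?F"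
      and sD: "add_subgroup (D \<boxplus> ?J r e)"
      by (intro add_subgroup_submodule subs)+
    have le0: "?L0 \<boxplus> ?J r e \<subseteq> mat_apply B' ` ?F \<boxplus> ?J r e"
      by (rule set_sum_mono) (auto simp: D_def)
    have leB': "mat_apply B' ` ?F \<boxplus> ?J r e \<subseteq> ?F"
      by (rule set_sum_least[OF _ cong_module_subset sF]) (auto intro: mat_apply_supported[OF B'])
    \<comment> \<open>B' carries F modulo D + J onto the image of B' modulo the image of D, so
      passing from B' to B costs at most a factor p^r.\<close>
    have hom: "finite_index (mat_apply B' ` ?F \<boxplus> ?J r e) (?L0 \<boxplus> ?J r e) \<and>
      sub_index (mat_apply B' ` ?F \<boxplus> ?J r e) (?L0 \<boxplus> ?J r e) \<le> sub_index ?F (D \<boxplus> ?J r e)"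
    proof -
      have 1: "mat_apply B' x \<in> ?L0 \<boxplus> ?J r e" if "x \<in> D \<boxplus> ?J r e" for x
        using that by (auto elim!: set_sumE simp: mat_apply_add intro!: set_sumI mat_apply_cong_module[OF B'])
      have 2: "mat_apply B' ` ?F \<boxplus> ?J r e \<subseteq> mat_apply B' ` ?F \<boxplus> (?L0 \<boxplus> ?J r e)"
        by (rule set_sum_mono[OF order_refl set_sum_upper2])
          (intro fvec.subspace_0 subs)
      show ?thesis
        using index_hom_image[OF sD s0 mat_apply_diff 1 2 D(2)] by blast
    qed
    have "finite_index ?F (?L0 \<boxplus> ?J r e)"
      using index_tower(2)[OF s0 sB' sF le0 leB'] C(2)[OF r] hom by blast
    then have fin: "finite_index ?F (mat_apply B ` ?F \<boxplus> ?J r e)"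
      and "sub_index ?F (mat_apply B ` ?F \<boxplus> ?J r e) \<le> sub_index ?F (?L0 \<boxplus> ?J r e)"
      using index_larger_sub[OF s0 sB set_sum_mono[OF L0_B order_refl]] by blast+
    note this(2)
    also have "\<dots> = sub_index ?F (mat_apply B' ` ?F \<boxplus> ?J r e)
        * sub_index (mat_apply B' ` ?F \<boxplus> ?J r e) (?L0 \<boxplus> ?J r e)"
      by (rule index_tower(1)[OF s0 sB' sF le0 leB'])
    also have "\<dots> \<le> (p ^ (l * r) * C ^ e) * p ^ r"
      by (rule mult_le_mono[OF C(3)[OF r] le_trans[OF hom[THEN conjunct2] D(3)]])
    also have "\<dots> = p ^ (Suc l * r) * C ^ e"
      by (simp add: power_add)
    finally show ?thesis using fin by blast
  qed
  then show ?case using C(1) by blast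
qed

lemma prime_not_dvd_laurent_power:
  assumes "prime p" "\<not> of_nat p dvd (s :: laurent)"
  shows "\<not> of_nat p dvd s ^ n"
proof (induction n)
  case 0 then show ?case using prime_not_dvd_laurent_one[OF assms(1)] by simp
next
  case (Suc n) then show ?case using prime_dvd_laurent_mult_nat[OF assms(1)] assms(2) by auto
qed

lemma det_adj_mat:
  assumes "(A :: 'a::idom mat) \<in> carrier_mat n n" "det A \<noteq> 0" "0 < n"
  shows "det (adj_mat A) = det A ^ (n - 1)"
proof -
  have "det A * det (adj_mat A) = det (det A \<cdot>\<^sub>m 1\<^sub>m n)"
    using det_mult[OF assms(1) adj_mat(1)[OF assms(1)]] adj_mat(2)[OF assms(1)] by simp
  also have "\<dots> = det A * det A ^ (n - 1)"
    using assms(3) by (simp add: power_Suc[symmetric] del: power_Suc)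
  finally show ?thesis using assms(2) by simp
qed

text \<open>The bound for \<open>B\<close> from below is the bound for the adjugate of \<open>B\<close> from above.\<close>

lemma index_image_ge:
  assumes p: "prime p" and B: "B \<in> carrier_mat N N"
    and det: "det B = of_nat p ^ l * s" "\<not> of_nat p dvd (s :: laurent)"
  shows "\<exists>C\<ge>1. \<forall>r>0. \<forall>e\<ge>l.
    p ^ (l * r) \<le> sub_index (supported {..<N}) (mat_apply B ` supported {..<N} \<boxplus> cong_module p r e {..<N}) * C ^ e"
proof -
  let ?F = "supported {..<N} :: (nat \<Rightarrow> laurent) set" and ?P = "of_nat p :: laurent"
  let ?J = "\<lambda>r e. cong_module p r e {..<N}"
  obtain CB where CB: "\<And>r e. 0 < r \<Longrightarrow> finite_index ?F (mat_apply B ` ?F \<boxplus> ?J r e)"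
    using index_image_le[OF p B det] by blast
  have F0: "0 \<in> ?F" by (rule fvec.subspace_0[OF submodule_supported])
  show ?thesis
  proof (cases "l = 0")
    case True
    have "p ^ (l * r) \<le> sub_index ?F (mat_apply B ` ?F \<boxplus> ?J r e) * 1 ^ e" if "0 < r" for r e
      using sub_index_pos[OF CB[OF that] F0] True by (simp add: Suc_le_eq)
    then show ?thesis by (intro exI[of _ 1]) simp
  next
    case False
    have "0 < N"
    proof (rule ccontr)
      assume "\<not> 0 < N"
      then have "det B = 1" using B by (simp add: det_dim_zero)
      then have "?P dvd 1" using det(1) False by (metis dvd_mult2 dvd_power neq0_conv)
      then show False using prime_not_dvd_laurent_one[OF p] by blast
    qed
    let ?A = "adj_mat B"
    note A = adj_mat(1)[OF B]
    have "det B \<noteq> 0" using det of_nat_prime_nonzero[OF p] by auto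
    then have detA: "det ?A = ?P ^ (l * (N - 1)) * s ^ (N - 1)"
      using det_adj_mat[OF B _ \<open>0 < N\<close>] det(1) by (simp add: power_mult_distrib power_mult)
    obtain C where C: "1 \<le> C" "\<And>r e. 0 < r \<Longrightarrow> finite_index ?F (mat_apply ?A ` ?F \<boxplus> ?J r e)"
      "\<And>r e. 0 < r \<Longrightarrow> sub_index ?F (mat_apply ?A ` ?F \<boxplus> ?J r e) \<le> p ^ (l * (N - 1) * r) * C ^ e"
      using index_image_le[OF p A detA prime_not_dvd_laurent_power[OF p det(2)]] by blast
    have "p ^ (l * r) \<le> sub_index ?F (mat_apply B ` ?F \<boxplus> ?J r e) * C ^ e" if r: "0 < r" and e: "l \<le> e" for r e
    proof -
      let ?q = "?P ^ l * s"
      note subs = add_subgroup_submodule submodule_set_sum submodule_mat_apply_image submodule_scale_image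
        submodule_supported submodule_cong_module
      have sq: "add_subgroup ((\<star>) ?q ` ?F \<boxplus> ?J r e)" and sB: "add_subgroup (mat_apply B ` ?F \<boxplus> ?J r e)"
        and sA: "add_subgroup (mat_apply ?A ` ?F \<boxplus> ?J r e)" and sF: "add_subgroup ?F"
        and sJ: "add_subgroup (?J r l)"
        by (intro subs)+
      have BA: "mat_apply B (mat_apply ?A f) = ?q \<star> f" if "f \<in> ?F" for f
        using mat_apply_adj_mat[OF B that] det(1) by simp
      have "(\<star>) ?q ` ?F \<subseteq> mat_apply B ` ?F"
      proof
        fix x assume "x \<in> (\<star>) ?q ` ?F"
        then obtain f where "f \<in> ?F" "x = ?q \<star> f" by auto
        then show "x \<in> mat_apply B ` ?F"
          using BA[of f] mat_apply_supported[OF A, of f] by (metis imageI)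
      qed
      then have leq: "(\<star>) ?q ` ?F \<boxplus> ?J r e \<subseteq> mat_apply B ` ?F \<boxplus> ?J r e"
        by (rule set_sum_mono[OF _ order_refl])
      have leB: "mat_apply B ` ?F \<boxplus> ?J r e \<subseteq> ?F"
        by (rule set_sum_least[OF _ cong_module_subset sF]) (auto intro: mat_apply_supported[OF B])
      have 1: "mat_apply B x \<in> (\<star>) ?q ` ?F \<boxplus> ?J r e" if "x \<in> mat_apply ?A ` ?F \<boxplus> ?J r e" for x
        using that by (auto elim!: set_sumE simp: mat_apply_add BA intro!: set_sumI mat_apply_cong_module[OF B])
      have 2: "mat_apply B ` ?F \<boxplus> ?J r e \<subseteq> mat_apply B ` ?F \<boxplus> ((\<star>) ?q ` ?F \<boxplus> ?J r e)"
        by (rule set_sum_mono[OF order_refl set_sum_upper2]) (intro fvec.subspace_0 subs)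
      note hom = index_hom_image[OF sA sq mat_apply_diff 1 2 C(2)[OF r]]
      have fin: "finite_index ?F ((\<star>) ?q ` ?F \<boxplus> ?J r e)"
        using index_tower(2)[OF sq sB sF leq leB] CB[OF r] hom(1) by blast
      \<comment> \<open>Both q F, with q = p^l s, and J(r, e) lie in J(r, l), whose index p^(lNr) is
        known exactly; this uses l \<le> e. The adjugate accounts for at most p^(l(N-1)r) C^e of it,
        and p^(lr) remains for B.\<close>
      have "(\<star>) ?q ` ?F \<subseteq> ?J r l"
      proof
        fix x assume "x \<in> (\<star>) ?q ` ?F"
        then obtain f where "f \<in> ?F" "x = (laurent_t ^ r - 1) \<star> 0 + ?P ^ l \<star> (s \<star> f)" by auto
        then show "x \<in> ?J r l"
          unfolding cong_module_def
          by (auto simp only: intro!: set_sumI imageI fvec.subspace_scale submodule_supported F0)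
      qed
      moreover have "?J r e \<subseteq> ?J r l"
        unfolding cong_module_def
        by (rule set_sum_mono[OF order_refl power_scale_image_mono[OF submodule_supported e]])
      ultimately have "(\<star>) ?q ` ?F \<boxplus> ?J r e \<subseteq> ?J r l"
        by (rule set_sum_least[OF _ _ sJ])
      then have "sub_index ?F (?J r l) \<le> sub_index ?F ((\<star>) ?q ` ?F \<boxplus> ?J r e)"
        using index_larger_sub(2)[OF sq sJ _ fin] by blast
      then have "p ^ (l * N * r) \<le> sub_index ?F ((\<star>) ?q ` ?F \<boxplus> ?J r e)"
        using index_cong_module(2)[OF p r, of "{..<N}" l] by simp
      also have "\<dots> = sub_index ?F (mat_apply B ` ?F \<boxplus> ?J r e) * sub_index (mat_apply B ` ?F \<boxplus> ?J r e) ((\<star>) ?q ` ?F \<boxplus> ?J r e)"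
        by (rule index_tower(1)[OF sq sB sF leq leB])
      also have "\<dots> \<le> sub_index ?F (mat_apply B ` ?F \<boxplus> ?J r e) * (p ^ (l * (N - 1) * r) * C ^ e)"
        by (rule mult_le_mono2[OF le_trans[OF hom(2) C(3)[OF r]]])
      finally have "p ^ (l * (N - 1) * r) * p ^ (l * r)
          \<le> p ^ (l * (N - 1) * r) * (sub_index ?F (mat_apply B ` ?F \<boxplus> ?J r e) * C ^ e)"
        using \<open>0 < N\<close> by (cases N) (simp_all add: power_add[symmetric] algebra_simps)
      then show ?thesis using p by (simp add: prime_gt_0_nat)
    qed
    then show ?thesis using C(1) by blast
  qed
qed

subsection \<open>Torsion of a quotient and its primary part\<close>

text \<open>The preimage in the free module of the torsion subgroup of its quotient by D, so that
  torsion is counted by an index in the free module.\<close>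

definition saturation :: "nat \<Rightarrow> (nat \<Rightarrow> laurent) set \<Rightarrow> (nat \<Rightarrow> laurent) set" where
  "saturation N D = {x \<in> supported {..<N}. \<exists>k::nat. 0 < k \<and> of_nat k \<star> x \<in> D}"

definition prime_saturation :: "nat \<Rightarrow> nat \<Rightarrow> (nat \<Rightarrow> laurent) set \<Rightarrow> (nat \<Rightarrow> laurent) set" where
  "prime_saturation p N D = {x \<in> supported {..<N}. \<exists>b. of_nat p ^ b \<star> x \<in> D}"

lemma add_subgroup_of_int_scale:
  assumes "add_subgroup H" "x \<in> H"
  shows "of_int a \<star> (x :: nat \<Rightarrow> laurent) \<in> H"
proof (induction a rule: int_induct[of _ 0])
  case base
  have "of_int 0 \<star> x = 0" by (simp add: fun_eq_iff)
  then show ?case using add_subgroup_zero[OF assms(1)] by (simp only:)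
next
  case (step1 i)
  have "of_int (i + 1) \<star> x = of_int i \<star> x + x" by (simp add: fvec.scale_left_distrib)
  then show ?case using add_subgroup_add[OF assms(1) step1(2) assms(2)] by (simp only:)
next
  case (step2 i)
  have "of_int (i - 1) \<star> x = of_int i \<star> x - x" by (simp add: fvec.scale_left_diff_distrib)
  then show ?case using add_subgroup_diff[OF assms(1) step2(2) assms(2)] by (simp only:)
qed

text \<open>Adjoin to H an element x of K outside H: its order m modulo H divides k, and the index
  drops by the factor m. The index is thus a product of divisors of k.\<close>

lemma index_dvd_power:
  fixes K H :: "(nat \<Rightarrow> laurent) set"
  assumes H: "add_subgroup H" and K: "add_subgroup K" and "H \<subseteq> K" and fin: "finite_index K H"
    and k: "0 < k" "\<And>x. x \<in> K \<Longrightarrow> of_nat k \<star> x \<in> H"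
  shows "\<exists>j. sub_index K H dvd k ^ j"
  using assms
proof (induction "sub_index K H" arbitrary: H rule: less_induct)
  case less
  note H = less.prems(1) and k = less.prems(5,6)
  show ?case
  proof (cases "K = H")
    case True
    have "translate H x = translate H 0" if "x \<in> K" for x
      using that True by (simp add: translate_eq_iff[OF H])
    then have "translate H ` K \<subseteq> {translate H 0}" by auto
    then have "card (translate H ` K) \<le> 1"
      by (auto dest: card_mono[rotated])
    then have "sub_index K H = 1"
      using sub_index_pos[OF less.prems(4) add_subgroup_zero[OF K]] by (simp add: sub_index_def)
    then show ?thesis by simp
  next
    case False
    then obtain x where x: "x \<in> K" "x \<notin> H" using less.prems(3) by blast
    define Z where "Z = range (\<lambda>a. of_int a \<star> x)"
    define m where "m = (LEAST m. 0 < m \<and> of_nat m \<star> x \<in> H)"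
    have "0 < k \<and> of_nat k \<star> x \<in> H" using k x by simp
    then have m: "0 < m" "of_nat m \<star> x \<in> H"
      unfolding m_def by (rule LeastI2_ex[OF exI]; simp)+
    have m_least: "m \<le> n" if "0 < n" "of_nat n \<star> x \<in> H" for n
      unfolding m_def using that by (intro Least_le) simp
    have mem: "of_int a \<star> x \<in> H \<longleftrightarrow> int m dvd a" for a
    proof
      assume "int m dvd a"
      then obtain b where "a = b * int m" by (metis dvdE mult.commute)
      then have "of_int a \<star> x = of_int b \<star> (of_nat m \<star> x)" by simp
      then show "of_int a \<star> x \<in> H"
        using add_subgroup_of_int_scale[OF H m(2)] by (simp only:)
    next
      assume a: "of_int a \<star> x \<in> H"
      have "a mod int m = a - (a div int m) * int m" by (simp add: minus_div_mult_eq_mod)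
      then have "of_int (a mod int m) \<star> x = of_int a \<star> x - of_int (a div int m) \<star> (of_nat m \<star> x)"
        by (simp add: fvec.scale_left_diff_distrib)
      then have "of_int (a mod int m) \<star> x \<in> H"
        using add_subgroup_diff[OF H a add_subgroup_of_int_scale[OF H m(2)]] by (simp only:)
      moreover have "of_int (a mod int m) = (of_nat (nat (a mod int m)) :: laurent)"
        using m(1) by (simp add: of_nat_nat)
      ultimately have "of_nat (nat (a mod int m)) \<star> x \<in> H" by (simp only:)
      then have "\<not> 0 < nat (a mod int m)"
        using m_least[of "nat (a mod int m)"] m(1) pos_mod_bound[of "int m" a] by linarith
      then have "a mod int m = 0" using m(1) pos_mod_sign[of "int m" a] by linarith
      then show "int m dvd a" by (rule mod_0_imp_dvd)
    qed
    have Z: "add_subgroup Z"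
      unfolding add_subgroup_def
    proof (intro conjI ballI)
      show "0 \<in> Z" unfolding Z_def by (rule image_eqI[of _ _ 0]) auto
      fix y z assume "y \<in> Z" "z \<in> Z"
      then obtain a b where "y = of_int a \<star> x" "z = of_int b \<star> x" by (auto simp: Z_def)
      then have "y - z = of_int (a - b) \<star> x" by (simp add: fvec.scale_left_diff_distrib)
      then show "y - z \<in> Z" unfolding Z_def by blast
    qed
    define H1 where "H1 = Z \<boxplus> H"
    have H1: "add_subgroup H1" unfolding H1_def by (rule add_subgroup_set_sum[OF Z H])
    have "Z \<subseteq> K" unfolding Z_def using add_subgroup_of_int_scale[OF K x(1)] by blast
    then have le: "H \<subseteq> H1" "H1 \<subseteq> K"
      unfolding H1_def
      using set_sum_upper2[OF add_subgroup_zero[OF Z], of H] set_sum_least[OF _ less.prems(3) K, of Z] by simp_all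
    have "translate H ` H1 = (\<lambda>a. translate H (of_int a \<star> x)) ` {0..<int m}"
    proof (intro equalityI subsetI)
      fix C assume "C \<in> translate H ` H1"
      then obtain a h where a: "h \<in> H" "C = translate H (of_int a \<star> x + h)"
        unfolding H1_def Z_def by (auto elim!: set_sumE)
      have "of_int (a - a mod int m) \<star> x + h \<in> H"
        using mem[of "a - a mod int m"] add_subgroup_add[OF H _ a(1)] by (simp add: minus_mod_eq_mult_div)
      then have "(of_int a \<star> x + h) - of_int (a mod int m) \<star> x \<in> H"
        by (simp add: fvec.scale_left_diff_distrib algebra_simps)
      then have "C = translate H (of_int (a mod int m) \<star> x)"
        using a(2) translate_eq_iff[OF H] by blast
      then show "C \<in> (\<lambda>a. translate H (of_int a \<star> x)) ` {0..<int m}"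
        using m(1) by auto
    next
      fix C assume "C \<in> (\<lambda>a. translate H (of_int a \<star> x)) ` {0..<int m}"
      then obtain a where "C = translate H (of_int a \<star> x + 0)" by auto
      then show "C \<in> translate H ` H1"
        unfolding H1_def Z_def using add_subgroup_zero[OF H] by (blast intro: set_sumI)
    qed
    moreover have "inj_on (\<lambda>a. translate H (of_int a \<star> x)) {0..<int m}"
    proof (rule inj_onI)
      fix a b assume ab: "a \<in> {0..<int m}" "b \<in> {0..<int m}"
        "translate H (of_int a \<star> x) = translate H (of_int b \<star> x)"
      then have "of_int (a - b) \<star> x \<in> H"
        using translate_eq_iff[OF H] by (simp add: fvec.scale_left_diff_distrib)
      then have "int m dvd a - b" using mem by blast
      then have "a mod int m = b mod int m" by (simp add: mod_eq_dvd_iff)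
      then show "a = b" using ab(1,2) by simp
    qed
    ultimately have idx: "sub_index H1 H = m"
      by (simp add: sub_index_def card_image)
    have tower: "sub_index K H = sub_index K H1 * m" "finite_index K H1"
      using index_tower[OF H H1 K le] idx less.prems(4) by simp_all
    have "m \<noteq> 1" using m(2) x(2) by auto
    then have "1 < m" using m(1) by simp
    moreover have "0 < sub_index K H1" by (rule sub_index_pos[OF tower(2) x(1)])
    ultimately have "sub_index K H1 < sub_index K H" using tower(1) by simp
    then obtain j where "sub_index K H1 dvd k ^ j"
      using less.hyps[of H1] H1 K le(2) tower(2) k le(1) by blast
    moreover have "m dvd k"
      using mem[of "int k"] k(2)[OF x(1)] by simp
    ultimately have "sub_index K H dvd k ^ Suc j"
      unfolding tower(1) by (simp add: mult.commute mult_dvd_mono)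
    then show ?thesis by blast
  qed
qed

lemma submodule_saturation:
  assumes "submodule D"
  shows "submodule (saturation N D)"
proof (rule fvec.subspaceI)
  show "0 \<in> saturation N D"
    using fvec.subspace_0[OF assms] fvec.subspace_0[OF submodule_supported, of "{..<N}"]
    by (auto simp: saturation_def intro: exI[of _ 1])
  show "x + y \<in> saturation N D" if xy: "x \<in> saturation N D" "y \<in> saturation N D" for x y
  proof -
    obtain k l where kl: "0 < k" "of_nat k \<star> x \<in> D" "0 < l" "of_nat l \<star> y \<in> D"
      using xy by (auto simp: saturation_def)
    have "of_nat (k * l) \<star> (x + y) = of_nat l \<star> (of_nat k \<star> x) + of_nat k \<star> (of_nat l \<star> y)"
      by (simp add: fvec.scale_right_distrib mult.commute)
    then have "of_nat (k * l) \<star> (x + y) \<in> D"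
      using fvec.subspace_add[OF assms fvec.subspace_scale[OF assms kl(2)] fvec.subspace_scale[OF assms kl(4)]]
      by (simp only:)
    moreover have "0 < k * l" using kl by simp
    ultimately have "\<exists>n>0. of_nat n \<star> (x + y) \<in> D" by blast
    then show ?thesis
      using xy fvec.subspace_add[OF submodule_supported] by (auto simp: saturation_def)
  qed
  show "c \<star> x \<in> saturation N D" if x: "x \<in> saturation N D" for c x
  proof -
    obtain k where k: "0 < k" "of_nat k \<star> x \<in> D"
      using x by (auto simp: saturation_def)
    have "of_nat k \<star> (c \<star> x) = c \<star> (of_nat k \<star> x)" by (simp add: mult.commute)
    then have "of_nat k \<star> (c \<star> x) \<in> D"
      using fvec.subspace_scale[OF assms k(2)] by (simp only:)
    then show ?thesis
      using x k(1) fvec.subspace_scale[OF submodule_supported]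
      by (auto simp: saturation_def simp del: fvec.scale_scale)
  qed
qed

lemma submodule_prime_saturation:
  assumes "submodule D"
  shows "submodule (prime_saturation p N D)"
proof (rule fvec.subspaceI)
  show "0 \<in> prime_saturation p N D"
    using fvec.subspace_0[OF assms] fvec.subspace_0[OF submodule_supported, of "{..<N}"]
    by (auto simp: prime_saturation_def)
  show "x + y \<in> prime_saturation p N D" if xy: "x \<in> prime_saturation p N D" "y \<in> prime_saturation p N D" for x y
  proof -
    obtain k l where kl: "of_nat p ^ k \<star> x \<in> D" "of_nat p ^ l \<star> y \<in> D"
      using xy by (auto simp: prime_saturation_def)
    have "of_nat p ^ (k + l) \<star> (x + y) = of_nat p ^ l \<star> (of_nat p ^ k \<star> x) + of_nat p ^ k \<star> (of_nat p ^ l \<star> y)"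
      by (simp add: fvec.scale_right_distrib mult.commute power_add)
    then have "of_nat p ^ (k + l) \<star> (x + y) \<in> D"
      using fvec.subspace_add[OF assms fvec.subspace_scale[OF assms kl(1)] fvec.subspace_scale[OF assms kl(2)]]
      by (simp only:)
    then have "\<exists>n. of_nat p ^ n \<star> (x + y) \<in> D" by blast
    then show ?thesis
      using xy fvec.subspace_add[OF submodule_supported] by (auto simp: prime_saturation_def)
  qed
  show "c \<star> x \<in> prime_saturation p N D" if x: "x \<in> prime_saturation p N D" for c x
  proof -
    obtain k where k: "of_nat p ^ k \<star> x \<in> D"
      using x by (auto simp: prime_saturation_def)
    have "of_nat p ^ k \<star> (c \<star> x) = c \<star> (of_nat p ^ k \<star> x)" by (simp add: mult.commute)
    then have "of_nat p ^ k \<star> (c \<star> x) \<in> D"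
      using fvec.subspace_scale[OF assms k] by (simp only:)
    then show ?thesis
      using x fvec.subspace_scale[OF submodule_supported]
      by (auto simp: prime_saturation_def simp del: fvec.scale_scale)
  qed
qed

text \<open>The sets of x with n! x in D ascend with n, because factorials divide one another, and
  every k divides k!. The stationary stage gives one exponent for all torsion.\<close>

lemma saturation_exponent:
  assumes D: "submodule D"
  shows "\<exists>k>0. \<forall>x\<in>saturation N D. of_nat k \<star> x \<in> D"
proof -
  define S where "S n = {x \<in> supported {..<N}. of_nat (fact n) \<star> x \<in> D}" for n
  have "submodule (S n)" for n
  proof (rule fvec.subspaceI)
    show "0 \<in> S n"
      using fvec.subspace_0[OF D] fvec.subspace_0[OF submodule_supported, of "{..<N}"] by (simp add: S_def)
    show "x + y \<in> S n" if "x \<in> S n" "y \<in> S n" for x y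
      using that
      by (auto simp: S_def fvec.scale_right_distrib
          intro: fvec.subspace_add[OF D] fvec.subspace_add[OF submodule_supported])
    show "c \<star> x \<in> S n" if "x \<in> S n" for c x
    proof -
      have "of_nat (fact n) \<star> (c \<star> x) = c \<star> (of_nat (fact n) \<star> x)" by (simp add: mult.commute)
      then have "of_nat (fact n) \<star> (c \<star> x) \<in> D"
        using that fvec.subspace_scale[OF D] unfolding S_def by (auto simp only:)
      then show ?thesis
        using that fvec.subspace_scale[OF submodule_supported]
        unfolding S_def by blast
    qed
  qed
  moreover have "S n \<subseteq> supported {..<N}" for n by (auto simp: S_def)
  moreover have mono: "S n \<subseteq> S (Suc n)" for n
  proof
    fix x assume "x \<in> S n"
    moreover have "of_nat (fact (Suc n)) \<star> x = of_nat (Suc n) \<star> (of_nat (fact n) \<star> x)"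
      by (simp only: fact_Suc of_nat_mult fvec.scale_scale of_nat_id)
    ultimately show "x \<in> S (Suc n)"
      using fvec.subspace_scale[OF D] by (simp add: S_def del: fvec.scale_scale of_nat_fact fact_Suc of_nat_Suc)
  qed
  ultimately obtain n0 where n0: "\<forall>n\<ge>n0. S n = S n0"
    using ascending_chain_stabilizes[of S N] by auto
  have "of_nat (fact n0) \<star> x \<in> D" if "x \<in> saturation N D" for x
  proof -
    obtain k where k: "0 < k" "of_nat k \<star> x \<in> D" "x \<in> supported {..<N}"
      using \<open>x \<in> saturation N D\<close> by (auto simp: saturation_def)
    obtain m where m: "fact k = m * k"
      using k(1) dvd_fact[of k k] by (metis Suc_leI One_nat_def dvd_def mult.commute order_refl)
    have "of_nat (fact k) \<star> x = of_nat m \<star> (of_nat k \<star> x)"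
      unfolding m by simp
    then have "x \<in> S k"
      using fvec.subspace_scale[OF D k(2)] k(3) by (simp add: S_def del: fvec.scale_scale of_nat_fact)
    then have "x \<in> S (max k n0)" using lift_Suc_mono_le[of S k "max k n0", OF mono] by auto
    moreover have "S (max k n0) = S n0" by (rule n0[rule_format]) simp
    ultimately have "x \<in> S n0" by (simp only:)
    then show ?thesis by (simp add: S_def del: of_nat_fact)
  qed
  then show ?thesis by (intro exI[of _ "fact n0"]) simp
qed

text \<open>If k annihilates the torsion S / D, it embeds into F / (D + k F), which is finite
  because D contains (t^r - 1) F. The index of D in S splits at the p-primary part T into a factor
  prime to p and a power of p.\<close>

lemma torsion_index_prime_part:
  assumes p: "prime p" and r: "0 < r" and D: "submodule D" "D \<subseteq> supported {..<N}"
    and tD: "(\<star>) (laurent_t ^ r - 1) ` supported {..<N} \<subseteq> D"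
  shows "finite_index (saturation N D) D"
    "p ^ multiplicity p (sub_index (saturation N D) D) = sub_index (prime_saturation p N D) D"
proof -
  let ?F = "supported {..<N} :: (nat \<Rightarrow> laurent) set"
  let ?S = "saturation N D" and ?T = "prime_saturation p N D"
  note add = add_subgroup_submodule
  obtain k where k: "0 < k" "\<And>x. x \<in> ?S \<Longrightarrow> of_nat k \<star> x \<in> D"
    using saturation_exponent[OF D(1)] by blast
  define G where "G = D \<boxplus> (\<star>) (of_nat k) ` ?F"
  have G: "submodule G" unfolding G_def by (intro submodule_set_sum submodule_scale_image submodule_supported D)
  have GF: "G \<subseteq> ?F" unfolding G_def
    by (intro set_sum_least D scale_image_subset submodule_supported add)
  have SF: "?S \<subseteq> ?F" by (auto simp: saturation_def)
  have DS: "D \<subseteq> ?S"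
    using D(2) by (force simp: saturation_def intro: exI[of _ 1])
  have "finite_index UNIV (ideal2 (laurent_t ^ r - 1) (of_int (int k)))"
    using index_binomial_ideal2(1)[OF r, of "int k"] k(1) by simp
  then have "finite_index ?F ((\<star>) (laurent_t ^ r - 1) ` ?F \<boxplus> (\<star>) (of_int (int k)) ` ?F)"
    unfolding scale_set_sum_supported by (intro index_coordinatewise(1) add_subgroup_ideal2) auto
  then have "finite_index ?F G"
    unfolding G_def
    by (rule index_larger_sub(1)[rotated 3])
      (auto intro!: add submodule_set_sum submodule_scale_image submodule_supported D set_sum_mono[OF tD])
  moreover have "?S \<boxplus> G \<subseteq> ?F" by (rule set_sum_least[OF SF GF add[OF submodule_supported]])
  moreover have "G \<subseteq> ?S \<boxplus> G" by (rule set_sum_upper2[OF fvec.subspace_0[OF submodule_saturation[OF D(1)]]])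
  ultimately have "finite_index (?S \<boxplus> G) G"
    using index_tower(2)[OF add[OF G] add[OF submodule_set_sum[OF submodule_saturation[OF D(1)] G]] add[OF submodule_supported]]
    by blast
  \<comment> \<open>If d + k f is torsion modulo D, so is k f and hence f; then k f lies in
    D.\<close>
  moreover have "?S \<inter> G = D"
  proof (intro equalityI subsetI IntI)
    fix x assume x: "x \<in> ?S \<inter> G"
    then obtain d f where df: "d \<in> D" "f \<in> ?F" "x = d + of_nat k \<star> f"
      unfolding G_def by (auto elim!: set_sumE)
    have "of_nat k \<star> f = x - d" by (simp add: df)
    then have "of_nat k \<star> f \<in> ?S"
      using x df(1) DS fvec.subspace_diff[OF submodule_saturation[OF D(1)]] by auto
    then obtain l where "0 < l" "of_nat l \<star> (of_nat k \<star> f) \<in> D" by (auto simp: saturation_def)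
    then have "0 < l * k" "of_nat (l * k) \<star> f \<in> D" using k(1) by auto
    then have "f \<in> ?S" using df(2) unfolding saturation_def by blast
    then show "x \<in> D" using k(2) df fvec.subspace_add[OF D(1)] by auto
  next
    fix x assume "x \<in> D"
    then show "x \<in> ?S" using DS by blast
    show "x \<in> G" using \<open>x \<in> D\<close> set_sum_upper1[OF fvec.subspace_0[OF submodule_scale_image[OF submodule_supported]]]
      unfolding G_def by blast
  qed
  ultimately show fin: "finite_index ?S D"
    using index_second_iso(2)[OF add[OF submodule_saturation[OF D(1), of N]] add[OF G]] by simp
  have sT: "submodule ?T" by (rule submodule_prime_saturation[OF D(1)])
  have DT: "D \<subseteq> ?T"
    using D(2) by (force simp: prime_saturation_def intro: exI[of _ 0])
  have TS: "?T \<subseteq> ?S"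
  proof
    fix x assume "x \<in> ?T"
    then obtain b where "x \<in> ?F" "of_nat (p ^ b) \<star> x \<in> D" by (auto simp: prime_saturation_def)
    moreover have "0 < p ^ b" using p by (simp add: prime_gt_0_nat)
    ultimately show "x \<in> ?S" unfolding saturation_def by blast
  qed
  note tower = index_tower[OF add[OF D(1)] add[OF sT] add[OF submodule_saturation[OF D(1)]] DT TS]
  have finT: "finite_index ?T D" "finite_index ?S ?T" using tower(2) fin by auto
  obtain k' where k': "k = p ^ multiplicity p k * k'" "\<not> p dvd k'"
    using multiplicity_decompose'[of k p] p k(1) by (metis not_gr_zero not_prime_unit)
  \<comment> \<open>The part of k prime to p annihilates S / T, so p does not divide the index of T
    in S.\<close>
  have "of_nat k' \<star> x \<in> ?T" if "x \<in> ?S" for x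
  proof -
    have "of_nat k \<star> x = of_nat p ^ multiplicity p k \<star> (of_nat k' \<star> x)"
      by (subst k'(1)) simp
    then have "of_nat p ^ multiplicity p k \<star> (of_nat k' \<star> x) \<in> D" using k(2)[OF that] by (simp only:)
    moreover have "of_nat k' \<star> x \<in> ?F"
      using SF that fvec.subspace_scale[OF submodule_supported] by blast
    ultimately show ?thesis unfolding prime_saturation_def by blast
  qed
  moreover have "0 < k'" using k'(2) by (cases k') auto
  ultimately obtain j where "sub_index ?S ?T dvd k' ^ j"
    using index_dvd_power[OF add[OF sT] add[OF submodule_saturation[OF D(1)]] TS finT(2)] by blast
  then have "\<not> p dvd sub_index ?S ?T"
    using k'(2) p by (meson dvd_trans prime_dvd_power_nat)
  obtain c where c: "\<And>y b. y \<in> ?F \<Longrightarrow> of_nat p ^ b \<star> y \<in> D \<Longrightarrow> of_nat p ^ c \<star> y \<in> D"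
    using torsion_exponent_bounded[OF submodule_supported order_refl D(1), where q = "of_nat p"] by blast
  have "of_nat (p ^ c) \<star> x \<in> D" if "x \<in> ?T" for x
    using that c by (auto simp: prime_saturation_def)
  moreover have "0 < p ^ c" using p by (simp add: prime_gt_0_nat)
  ultimately obtain j where "sub_index ?T D dvd (p ^ c) ^ j"
    using index_dvd_power[OF add[OF D(1)] add[OF sT] DT finT(1)] by blast
  then obtain m where m: "sub_index ?T D = p ^ m"
    using divides_primepow_nat[OF p] by (metis power_mult)
  have "sub_index ?S ?T \<noteq> 0"
    using sub_index_pos[OF finT(2) fvec.subspace_0[OF submodule_saturation[OF D(1)]]] by simp
  moreover have "p ^ m \<noteq> 0" using p by auto
  ultimately have "multiplicity p (sub_index ?S D) = multiplicity p (sub_index ?S ?T) + multiplicity p (p ^ m)"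
    unfolding tower(1) m
    by (rule prime_elem_multiplicity_mult_distrib[OF prime_imp_prime_elem[OF p]])
  also have "multiplicity p (p ^ m) = m"
    using p by (simp add: multiplicity_same_power)
  also have "multiplicity p (sub_index ?S ?T) = 0"
    using \<open>\<not> p dvd sub_index ?S ?T\<close> by (rule not_dvd_imp_multiplicity_0)
  finally show "p ^ multiplicity p (sub_index ?S D) = sub_index ?T D"
    by (simp add: m)
qed

text \<open>Because p^e annihilates T / D, T meets D + p^e F only in D: if p^e f lies in T, so does
  f. The second isomorphism theorem then turns the index of D in T into one between submodules
  containing p^e F.\<close>

lemma prime_saturation_index:
  assumes p: "prime p" and D: "submodule D" "D \<subseteq> supported {..<N}"
    and e: "\<And>x b. x \<in> supported {..<N} \<Longrightarrow> of_nat p ^ b \<star> x \<in> D \<Longrightarrow> of_nat p ^ e \<star> x \<in> D"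
  defines "T \<equiv> prime_saturation p N D" and "Q \<equiv> (\<star>) (of_nat p ^ e) ` supported {..<N}"
  assumes fin: "finite_index (supported {..<N}) (D \<boxplus> Q)"
  shows "sub_index (supported {..<N}) (D \<boxplus> Q) = sub_index (supported {..<N}) (T \<boxplus> Q) * sub_index T D"
    "finite_index (supported {..<N}) (T \<boxplus> Q)"
proof -
  let ?F = "supported {..<N} :: (nat \<Rightarrow> laurent) set"
  note add = add_subgroup_submodule
  have T: "submodule T" unfolding T_def by (rule submodule_prime_saturation[OF D(1)])
  have Q: "submodule Q" unfolding Q_def by (intro submodule_scale_image submodule_supported)
  have G: "submodule (D \<boxplus> Q)" by (rule submodule_set_sum[OF D(1) Q])
  have TQ: "submodule (T \<boxplus> Q)" by (rule submodule_set_sum[OF T Q])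
  have DT: "D \<subseteq> T"
    using D(2) by (force simp: T_def prime_saturation_def intro: exI[of _ 0])
  have TF: "T \<subseteq> ?F" by (auto simp: T_def prime_saturation_def)
  have QF: "Q \<subseteq> ?F" unfolding Q_def by (rule scale_image_subset[OF submodule_supported])
  have sum: "T \<boxplus> (D \<boxplus> Q) = T \<boxplus> Q"
  proof
    show "T \<boxplus> (D \<boxplus> Q) \<subseteq> T \<boxplus> Q"
      unfolding set_sum_assoc[symmetric]
      by (rule set_sum_mono[OF set_sum_least[OF order_refl DT add[OF T]] order_refl])
    show "T \<boxplus> Q \<subseteq> T \<boxplus> (D \<boxplus> Q)"
      by (rule set_sum_mono[OF order_refl set_sum_upper2[OF fvec.subspace_0[OF D(1)]]])
  qed
  have inter: "T \<inter> (D \<boxplus> Q) = D"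
  proof (intro equalityI subsetI IntI)
    fix x assume x: "x \<in> T \<inter> (D \<boxplus> Q)"
    then obtain d f where df: "d \<in> D" "f \<in> ?F" "x = d + of_nat p ^ e \<star> f"
      unfolding Q_def by (auto elim!: set_sumE)
    have "of_nat p ^ e \<star> f = x - d" by (simp add: df)
    then have "of_nat p ^ e \<star> f \<in> T"
      using x df(1) DT fvec.subspace_diff[OF T] by auto
    then obtain b where "of_nat p ^ b \<star> (of_nat p ^ e \<star> f) \<in> D" by (auto simp: T_def prime_saturation_def)
    then have "of_nat p ^ (b + e) \<star> f \<in> D" by (simp add: power_add)
    then have "of_nat p ^ e \<star> f \<in> D" by (rule e[OF df(2)])
    then show "x \<in> D" using df fvec.subspace_add[OF D(1)] by auto
  next
    fix x assume "x \<in> D"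
    then show "x \<in> T" using DT by blast
    show "x \<in> D \<boxplus> Q" using \<open>x \<in> D\<close> set_sum_upper1[OF fvec.subspace_0[OF Q]] by blast
  qed
  have le: "D \<boxplus> Q \<subseteq> T \<boxplus> Q" by (rule set_sum_mono[OF DT order_refl])
  have leF: "T \<boxplus> Q \<subseteq> ?F" by (rule set_sum_least[OF TF QF add[OF submodule_supported]])
  note tower = index_tower[OF add[OF G] add[OF TQ] add[OF submodule_supported] le leF]
  have "sub_index T D = sub_index (T \<boxplus> Q) (D \<boxplus> Q)"
    using index_second_iso(1)[OF add[OF T] add[OF G]] unfolding sum inter .
  then show "sub_index ?F (D \<boxplus> Q) = sub_index ?F (T \<boxplus> Q) * sub_index T D"
    using tower(1) by simp
  show "finite_index ?F (T \<boxplus> Q)" using tower(2) fin by blast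
qed


subsection \<open>The growth of the primary part\<close>

text \<open>For the module F / L this is the kernel of the projection of F onto the quotient by t^r
  - 1; its index in F may be infinite.\<close>

abbreviation binomial_quot :: "nat \<Rightarrow> (nat \<Rightarrow> laurent) set \<Rightarrow> nat \<Rightarrow> (nat \<Rightarrow> laurent) set" where
  "binomial_quot N L r \<equiv> (\<star>) (laurent_t ^ r - 1) ` supported {..<N} \<boxplus> L"

lemma binomial_quot_add_power:
  "binomial_quot N L r \<boxplus> (\<star>) (of_nat p ^ e) ` supported {..<N} = L \<boxplus> cong_module p r e {..<N}"
  unfolding cong_module_def set_sum_commute[of _ L] set_sum_assoc ..

text \<open>Up to factors C^e, L may be replaced by the image of the square matrix B, since s
  annihilates L modulo that image. Likewise T contains s F, so T + p^e F has index at most C^e and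
  all growth falls to the index of D in T.\<close>

lemma prime_saturation_index_det:
  assumes p: "prime p" and B: "B \<in> carrier_mat N N" and A: "A \<in> carrier_mat N m"
    and det: "det B = of_nat p ^ l * s" "\<not> of_nat p dvd (s :: laurent)"
  defines "L \<equiv> mat_apply A ` supported {..<m}"
  assumes BL: "mat_apply B ` supported {..<N} \<subseteq> L"
    and sL: "\<And>x. x \<in> L \<Longrightarrow> s \<star> x \<in> mat_apply B ` supported {..<N}"
  shows "\<exists>c C. 1 \<le> C \<and> (\<forall>r>0.
    sub_index (prime_saturation p N (binomial_quot N L r)) (binomial_quot N L r) \<le> p ^ (l * r) * C ^ (c + multiplicity p r) \<and>
    p ^ (l * r) \<le> sub_index (prime_saturation p N (binomial_quot N L r)) (binomial_quot N L r) * C ^ (c + multiplicity p r))"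
proof -
  let ?F = "supported {..<N} :: (nat \<Rightarrow> laurent) set" and ?M = "supported {..<m} :: (nat \<Rightarrow> laurent) set"
  let ?P = "of_nat p :: laurent" and ?J = "\<lambda>r e. cong_module p r e {..<N}"
  let ?B = "mat_apply B ` ?F"
  note add = add_subgroup_submodule
  have L: "submodule L" unfolding L_def by (intro submodule_mat_apply_image submodule_supported)
  have LF: "L \<subseteq> ?F" unfolding L_def using mat_apply_supported[OF A] by auto
  have sB: "submodule ?B" by (intro submodule_mat_apply_image submodule_supported)
  have kill: "(?P ^ l * s) \<star> f \<in> L" if "f \<in> ?F" for f
  proof -
    have "(?P ^ l * s) \<star> f = mat_apply B (mat_apply (adj_mat B) f)"
      using mat_apply_adj_mat[OF B that] det(1) by simp
    then show ?thesis using BL mat_apply_supported[OF adj_mat(1)[OF B]] by auto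
  qed
  obtain c0 where c0: "\<And>r x b. 0 < r \<Longrightarrow> x \<in> ?F \<Longrightarrow> ?P ^ b \<star> x \<in> binomial_quot N L r \<Longrightarrow>
      ?P ^ (c0 + multiplicity p r) \<star> x \<in> binomial_quot N L r"
    using torsion_exponent_killed[OF p det(2) submodule_supported order_refl L LF kill] by blast
  \<comment> \<open>The summand l ensures l \<le> e, as \<open>index_image_ge\<close>
    requires.\<close>
  define c where "c = c0 + l"
  obtain C1 where C1: "1 \<le> C1"
    "\<And>r e. 0 < r \<Longrightarrow> finite_index ?F (?B \<boxplus> ?J r e)"
    "\<And>r e. 0 < r \<Longrightarrow> sub_index ?F (?B \<boxplus> ?J r e) \<le> p ^ (l * r) * C1 ^ e"
    using index_image_le[OF p B det] by blast
  obtain C2 where C2: "1 \<le> C2"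
    "\<And>r e. 0 < r \<Longrightarrow> l \<le> e \<Longrightarrow> p ^ (l * r) \<le> sub_index ?F (?B \<boxplus> ?J r e) * C2 ^ e"
    using index_image_ge[OF p B det] by blast
  obtain C3 where C3: "1 \<le> C3"
    "\<And>e. finite_index ?M ((\<star>) s ` ?M \<boxplus> (\<star>) (?P ^ e) ` ?M)"
    "\<And>e. sub_index ?M ((\<star>) s ` ?M \<boxplus> (\<star>) (?P ^ e) ` ?M) \<le> C3 ^ e"
    using index_killed_le[OF p det(2), of "{..<m}"] by blast
  obtain C4 where C4: "1 \<le> C4"
    "\<And>e. finite_index ?F ((\<star>) s ` ?F \<boxplus> (\<star>) (?P ^ e) ` ?F)"
    "\<And>e. sub_index ?F ((\<star>) s ` ?F \<boxplus> (\<star>) (?P ^ e) ` ?F) \<le> C4 ^ e"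
    using index_killed_le[OF p det(2), of "{..<N}"] by blast
  define C where "C = C1 * C2 * C3 * C4"
  have "sub_index (prime_saturation p N (binomial_quot N L r)) (binomial_quot N L r) \<le> p ^ (l * r) * C ^ (c + multiplicity p r)
    \<and> p ^ (l * r) \<le> sub_index (prime_saturation p N (binomial_quot N L r)) (binomial_quot N L r) * C ^ (c + multiplicity p r)"
    if r: "0 < r" for r
  proof -
    let ?e = "c + multiplicity p r" and ?D = "binomial_quot N L r"
    let ?T = "prime_saturation p N ?D" and ?Q = "(\<star>) (?P ^ (c + multiplicity p r)) ` ?F"
    have D: "submodule ?D" by (intro submodule_set_sum submodule_scale_image submodule_supported L)
    have DF: "?D \<subseteq> ?F"
      by (rule set_sum_least[OF scale_image_subset[OF submodule_supported] LF add[OF submodule_supported]])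
    have T: "submodule ?T" by (rule submodule_prime_saturation[OF D])
    have exp: "?P ^ ?e \<star> x \<in> ?D" if "x \<in> ?F" "?P ^ b \<star> x \<in> ?D" for x b
    proof -
      have "?P ^ ?e \<star> x = ?P ^ l \<star> (?P ^ (c0 + multiplicity p r) \<star> x)"
        by (simp add: c_def power_add mult.assoc mult.commute mult.left_commute)
      then show ?thesis
        using fvec.subspace_scale[OF D c0[OF r that]] by (simp only:)
    qed
    have DQ: "?D \<boxplus> ?Q = L \<boxplus> ?J r ?e" by (rule binomial_quot_add_power)
    note aB = add[OF submodule_set_sum[OF sB submodule_cong_module]]
      and aL = add[OF submodule_set_sum[OF L submodule_cong_module]]
    have leBL: "?B \<boxplus> ?J r ?e \<subseteq> L \<boxplus> ?J r ?e" by (rule set_sum_mono[OF BL order_refl])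
    have leF: "L \<boxplus> ?J r ?e \<subseteq> ?F" by (rule set_sum_least[OF LF cong_module_subset add[OF submodule_supported]])
    note tower = index_tower[OF aB aL add[OF submodule_supported] leBL leF]
    have finL: "finite_index ?F (L \<boxplus> ?J r ?e)" using tower(2) C1(2)[OF r] by blast
    have idx: "sub_index ?F (L \<boxplus> ?J r ?e) = sub_index ?F (?T \<boxplus> ?Q) * sub_index ?T ?D"
      by (rule prime_saturation_index(1)[OF p D DF, where e = ?e, unfolded DQ]) (auto intro: exp finL)
    have finTQ: "finite_index ?F (?T \<boxplus> ?Q)"
      by (rule prime_saturation_index(2)[OF p D DF, where e = ?e, unfolded DQ]) (auto intro: exp finL)
    have "1 \<le> sub_index ?F (?T \<boxplus> ?Q)"
      using sub_index_pos[OF finTQ fvec.subspace_0[OF submodule_supported]] by simp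
    then have "sub_index ?T ?D \<le> sub_index ?F (L \<boxplus> ?J r ?e)"
      unfolding idx by simp
    also have "\<dots> \<le> sub_index ?F (?B \<boxplus> ?J r ?e)"
      by (rule index_larger_sub(2)[OF aB aL leBL C1(2)[OF r]])
    also have "\<dots> \<le> p ^ (l * r) * C1 ^ ?e" by (rule C1(3)[OF r])
    also have "\<dots> \<le> p ^ (l * r) * C ^ ?e"
    proof (rule mult_le_mono2[OF power_mono])
      have "C1 * 1 \<le> C1 * (C2 * C3 * C4)"
        by (rule mult_le_mono2) (use C2(1) C3(1) C4(1) in simp)
      then show "C1 \<le> C" by (simp add: C_def mult.assoc)
    qed simp
    finally have upper: "sub_index ?T ?D \<le> p ^ (l * r) * C ^ ?e" .
    \<comment> \<open>The matrix A induces a map onto this quotient from the free module of rank m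
      modulo s and p^e, whose size has a bound independent of r.\<close>
    have LB: "sub_index (L \<boxplus> ?J r ?e) (?B \<boxplus> ?J r ?e) \<le> C3 ^ ?e"
    proof -
      have 1: "mat_apply A x \<in> ?B \<boxplus> ?J r ?e" if x: "x \<in> (\<star>) s ` ?M \<boxplus> (\<star>) (?P ^ ?e) ` ?M" for x
      proof -
        obtain f g where fg: "f \<in> ?M" "g \<in> ?M" "x = s \<star> f + ?P ^ ?e \<star> g"
          using x by (auto elim!: set_sumE)
        have "mat_apply A x = s \<star> mat_apply A f + ((laurent_t ^ r - 1) \<star> 0 + ?P ^ ?e \<star> mat_apply A g)"
          by (simp add: fg mat_apply_add mat_apply_scale)
        moreover have "s \<star> mat_apply A f \<in> ?B" using sL fg(1) unfolding L_def by blast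
        moreover have "(laurent_t ^ r - 1) \<star> 0 + ?P ^ ?e \<star> mat_apply A g \<in> ?J r ?e"
          unfolding cong_module_def
          by (intro set_sumI imageI fvec.subspace_0 submodule_supported mat_apply_supported[OF A])
        ultimately show ?thesis by (simp only: set_sumI)
      qed
      have 2: "L \<boxplus> ?J r ?e \<subseteq> mat_apply A ` ?M \<boxplus> (?B \<boxplus> ?J r ?e)"
        unfolding L_def by (rule set_sum_mono[OF order_refl set_sum_upper2[OF fvec.subspace_0[OF sB]]])
      show ?thesis
        using index_hom_image(2)[OF add[OF submodule_set_sum[OF submodule_scale_image[OF submodule_supported]
              submodule_scale_image[OF submodule_supported]]] aB mat_apply_diff 1 2 C3(2)] C3(3) le_trans by blast
    qed
    have TQ: "sub_index ?F (?T \<boxplus> ?Q) \<le> C4 ^ ?e"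
    proof -
      \<comment> \<open>p^l s maps F into L, so p^l sends s F into D.\<close>
      have "(\<star>) s ` ?F \<subseteq> ?T"
      proof
        fix x assume "x \<in> (\<star>) s ` ?F"
        then obtain f where f: "f \<in> ?F" "x = s \<star> f" by auto
        have "?P ^ l \<star> x = (laurent_t ^ r - 1) \<star> 0 + (?P ^ l * s) \<star> f" by (simp add: f)
        moreover have "(laurent_t ^ r - 1) \<star> 0 + (?P ^ l * s) \<star> f \<in> ?D"
          by (rule set_sumI[OF imageI[OF fvec.subspace_0[OF submodule_supported]] kill[OF f(1)]])
        ultimately have "?P ^ l \<star> x \<in> ?D" by (simp only:)
        then show "x \<in> ?T"
          unfolding prime_saturation_def f(2) using f fvec.subspace_scale[OF submodule_supported] by blast
      qed
      then have "(\<star>) s ` ?F \<boxplus> ?Q \<subseteq> ?T \<boxplus> ?Q" by (rule set_sum_mono[OF _ order_refl])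
      moreover have "add_subgroup ((\<star>) s ` ?F \<boxplus> ?Q)" "add_subgroup (?T \<boxplus> ?Q)"
        by (intro add submodule_set_sum submodule_scale_image submodule_supported T)+
      ultimately show ?thesis
        using index_larger_sub(2)[OF _ _ _ C4(2)] C4(3) le_trans by blast
    qed
    have "p ^ (l * r) \<le> sub_index ?F (?B \<boxplus> ?J r ?e) * C2 ^ ?e"
      by (rule C2(2)[OF r]) (simp add: c_def)
    also have "\<dots> = sub_index ?F (?T \<boxplus> ?Q) * sub_index ?T ?D * sub_index (L \<boxplus> ?J r ?e) (?B \<boxplus> ?J r ?e) * C2 ^ ?e"
      unfolding tower(1) idx ..
    also have "\<dots> \<le> C4 ^ ?e * sub_index ?T ?D * C3 ^ ?e * C2 ^ ?e"
      by (intro mult_le_mono TQ LB order_refl)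
    also have "\<dots> = sub_index ?T ?D * (C2 * C3 * C4) ^ ?e"
      by (simp add: power_mult_distrib algebra_simps)
    also have "\<dots> \<le> sub_index ?T ?D * C ^ ?e"
    proof (rule mult_le_mono2[OF power_mono])
      have "1 * (C2 * C3 * C4) \<le> C1 * (C2 * C3 * C4)"
        by (rule mult_le_mono1[OF C1(1)])
      then show "C2 * C3 * C4 \<le> C" by (simp add: C_def mult.assoc)
    qed simp
    finally show ?thesis using upper by blast
  qed
  moreover have "1 \<le> C" unfolding C_def using C1(1) C2(1) C3(1) C4(1) by simp
  ultimately show ?thesis by blast
qed

text \<open>The projection \<open>\<pi>\<close> below vanishes on \<open>L\<close> and is multiplication by \<open>s\<close> on the free part.\<close>

lemma prime_saturation_index_torsion_free:
  assumes p: "prime p" and L: "submodule L" "L \<subseteq> supported {..<N}"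
    and sat: "\<And>v. v \<in> supported {..<N} \<Longrightarrow> of_nat p \<star> v \<in> L \<Longrightarrow> v \<in> L"
  shows "\<exists>c C. 1 \<le> C \<and> (\<forall>r>0.
    sub_index (prime_saturation p N (binomial_quot N L r)) (binomial_quot N L r) \<le> C ^ (c + multiplicity p r))"
proof -
  obtain I B where I: "I \<subseteq> {..<N}" and B: "B \<in> carrier_mat N N" "\<not> of_nat p dvd det B"
    and unit: "\<And>j. j \<in> I \<Longrightarrow> col_fun B j = unit_fun j"
    and inL: "\<And>j. j \<in> {..<N} - I \<Longrightarrow> col_fun B j \<in> L" and zero: "L \<inter> supported I = {0}"
    using exchange_basis[OF p sat L(1)] by metis
  let ?F = "supported {..<N} :: (nat \<Rightarrow> laurent) set" and ?\<Phi> = "supported I :: (nat \<Rightarrow> laurent) set"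
  let ?P = "of_nat p :: laurent" and ?J = "\<lambda>r e. cong_module p r e {..<N}" and ?JI = "\<lambda>r e. cong_module p r e I"
  let ?B = "mat_apply B ` ?F"
  note add = add_subgroup_submodule
  have "finite I" using I finite_subset by blast
  have \<Phi>F: "?\<Phi> \<subseteq> ?F" by (rule supported_mono[OF I])
  define s where "s = det B"
  have s: "\<not> ?P dvd s" using B(2) by (simp add: s_def)
  define \<pi> where "\<pi> f = (\<lambda>i. if i \<in> I then mat_apply (adj_mat B) f i else 0)" for f
  have \<pi>_supp: "\<pi> f \<in> ?\<Phi>" for f by (simp add: \<pi>_def supported_def)
  have \<pi>_add: "\<pi> (f + g) = \<pi> f + \<pi> g" and \<pi>_diff: "\<pi> (f - g) = \<pi> f - \<pi> g"
    and \<pi>_scale: "\<pi> (c \<star> f) = c \<star> \<pi> f" for f g c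
    by (simp_all add: \<pi>_def fun_eq_iff mat_apply_add mat_apply_diff mat_apply_scale)
  have \<pi>_0: "\<pi> 0 = 0" by (simp add: \<pi>_def fun_eq_iff)
  \<comment> \<open>The columns of B outside I lie in L and those in I are unit vectors, so modulo L
    the image of g is the restriction of g to I. For g = adj(B) f this says that s f and \<pi> f
    agree modulo L.\<close>
  have B_split: "mat_apply B g - (\<lambda>i. if i \<in> I then g i else 0) \<in> L" if "g \<in> ?F" for g
  proof -
    have "mat_apply B g = (\<Sum>j<N. g j \<star> col_fun B j)"
      using B by (simp add: mat_apply_eq_sum_cols)
    also have "\<dots> = (\<Sum>j\<in>{..<N} - I. g j \<star> col_fun B j) + (\<Sum>j\<in>I. g j \<star> col_fun B j)"
      by (rule sum.subset_diff[OF I]) simp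
    also have "(\<Sum>j\<in>I. g j \<star> col_fun B j) = (\<lambda>i. if i \<in> I then g i else 0)"
    proof
      fix i
      have sum_apply: "(\<Sum>j\<in>S. h j) i = (\<Sum>j\<in>S. h j i)" for S :: "nat set" and h :: "nat \<Rightarrow> nat \<Rightarrow> laurent"
        by (induction S rule: infinite_finite_induct) auto
      have "(\<Sum>j\<in>I. g j \<star> col_fun B j) i = (\<Sum>j\<in>I. if j = i then g i else 0)"
        unfolding sum_apply by (rule sum.cong) (auto simp: unit unit_fun_def)
      then show "(\<Sum>j\<in>I. g j \<star> col_fun B j) i = (if i \<in> I then g i else 0)"
        using \<open>finite I\<close> by (simp add: sum.delta)
    qed
    finally have eq: "mat_apply B g = (\<Sum>j\<in>{..<N} - I. g j \<star> col_fun B j) + (\<lambda>i. if i \<in> I then g i else 0)" .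
    have "mat_apply B g - (\<lambda>i. if i \<in> I then g i else 0) = (\<Sum>j\<in>{..<N} - I. g j \<star> col_fun B j)"
      unfolding eq by (rule add_diff_cancel_right')
    also have "\<dots> \<in> L"
      using fvec.subspace_scale[OF L(1) inL] by (intro fvec.subspace_sum[OF L(1)]) simp
    finally show ?thesis .
  qed
  have \<pi>: "s \<star> f - \<pi> f \<in> L" if "f \<in> ?F" for f
    using B_split[OF mat_apply_supported[OF adj_mat(1)[OF B(1)]], of f] mat_apply_adj_mat[OF B(1) that]
    by (simp add: \<pi>_def s_def)
  have \<pi>_L: "\<pi> f = 0" if "f \<in> L" for f
  proof -
    have "\<pi> f = s \<star> f - (s \<star> f - \<pi> f)" by simp
    moreover have "s \<star> f - (s \<star> f - \<pi> f) \<in> L"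
      using fvec.subspace_diff[OF L(1) fvec.subspace_scale[OF L(1) that] \<pi>] that L(2) by blast
    ultimately have "\<pi> f \<in> L" by (simp only:)
    then show ?thesis using zero \<pi>_supp by blast
  qed
  have \<pi>_\<Phi>: "\<pi> f = s \<star> f" if "f \<in> ?\<Phi>" for f
  proof -
    have "s \<star> f - \<pi> f \<in> L" using \<pi> that \<Phi>F by blast
    moreover have "s \<star> f - \<pi> f \<in> ?\<Phi>"
      using that \<pi>_supp by (intro fvec.subspace_diff fvec.subspace_scale submodule_supported)
    ultimately have "s \<star> f - \<pi> f = 0" using zero by blast
    then show ?thesis by simp
  qed
  have \<pi>F: "submodule (\<pi> ` ?F)"
  proof (rule fvec.subspaceI)
    show "0 \<in> \<pi> ` ?F"
      using \<pi>_0 fvec.subspace_0[OF submodule_supported] by (rule image_eqI[OF sym])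
    fix x y c assume "x \<in> \<pi> ` ?F"
    then obtain a where a: "a \<in> ?F" "x = \<pi> a" by auto
    then have "c \<star> x = \<pi> (c \<star> a)" "c \<star> a \<in> ?F"
      by (simp_all add: \<pi>_scale fvec.subspace_scale submodule_supported)
    then show "c \<star> x \<in> \<pi> ` ?F" by blast
    assume "y \<in> \<pi> ` ?F"
    then obtain b where "b \<in> ?F" "y = \<pi> b" by auto
    then have "x + y = \<pi> (a + b)" "a + b \<in> ?F"
      using a by (simp_all add: \<pi>_add fvec.subspace_add submodule_supported)
    then show "x + y \<in> \<pi> ` ?F" by blast
  qed
  \<comment> \<open>Since \<pi> vanishes on L, p^b \<pi> x = (t^r - 1) \<pi> y. As p does not divide
    t^r - 1, p^b divides \<pi> y, and cancelling it leaves \<phi>: the free part of the quotient by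
    t^r - 1 has no p-torsion.\<close>
  have quot: "\<exists>\<phi>\<in>?\<Phi>. \<pi> y = ?P ^ b \<star> \<phi> \<and> \<pi> x = (laurent_t ^ r - 1) \<star> \<phi>"
    if r: "0 < r" and y: "?P ^ b \<star> x = (laurent_t ^ r - 1) \<star> y + l" "l \<in> L" for r b x y l
  proof -
    let ?b = "laurent_t ^ r - 1"
    have eq: "?P ^ b \<star> \<pi> x = ?b \<star> \<pi> y"
      using arg_cong[OF y(1), of \<pi>] \<pi>_L[OF y(2)] by (simp add: \<pi>_add \<pi>_scale)
    have nd: "\<not> of_int (int p) dvd ?b"
      by (rule not_prime_dvd_binomial) (use p r in auto)
    have "?P ^ b dvd \<pi> y i" for i
    proof -
      have "?P ^ b * \<pi> x i = ?b * \<pi> y i" using eq by (simp add: fun_eq_iff)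
      then have "of_int (int p) ^ b dvd ?b * \<pi> y i" by (metis dvd_triv_left of_int_of_nat_eq)
      then have "of_int (int p) ^ b dvd \<pi> y i"
        by (rule prime_power_dvd_laurent_mult[rotated]) (use p nd in auto)
      then show ?thesis by simp
    qed
    then obtain \<phi> where \<phi>: "\<And>i. \<pi> y i = ?P ^ b * \<phi> i" unfolding dvd_def by metis
    have nz: "?P ^ b \<noteq> 0" using of_nat_prime_nonzero[OF p] by simp
    have "\<phi> i = 0" if "i \<notin> I" for i
    proof -
      have "?P ^ b * \<phi> i = 0" using \<phi>[of i] that by (simp add: \<pi>_def)
      then show ?thesis using nz mult_eq_0_iff by blast
    qed
    then have "\<phi> \<in> ?\<Phi>" by (simp add: supported_def)
    moreover have "\<pi> x i = ?b * \<phi> i" for i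
    proof -
      have "?P ^ b * \<pi> x i = ?P ^ b * (?b * \<phi> i)"
        using fun_cong[OF eq, of i] by (simp add: \<phi> mult.left_commute)
      then show ?thesis using nz mult_left_cancel by blast
    qed
    ultimately show ?thesis using \<phi> by (intro bexI[of _ \<phi>]) (auto simp: fun_eq_iff)
  qed
  \<comment> \<open>\<phi> may lie outside the image of \<pi>; the chain condition, applied to
    submodules that do not involve r, bounds the power of p that brings it there.\<close>
  obtain c1 where c1: "\<And>y b. y \<in> ?\<Phi> \<Longrightarrow> ?P ^ b \<star> y \<in> \<pi> ` ?F \<Longrightarrow> ?P ^ c1 \<star> y \<in> \<pi> ` ?F"
    using torsion_exponent_bounded[OF submodule_supported \<Phi>F \<pi>F, where q = ?P] by blast
  define W where "W = {x \<in> ?F. \<pi> x = 0}"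
  have W: "submodule W"
    by (rule fvec.subspaceI)
      (simp_all add: W_def \<pi>_0 \<pi>_add \<pi>_scale fvec.subspace_0 fvec.subspace_add fvec.subspace_scale submodule_supported)
  have WF: "W \<subseteq> ?F" by (auto simp: W_def)
  have LW: "L \<subseteq> W" using L(2) \<pi>_L by (auto simp: W_def)
  have kill: "(?P ^ 0 * s) \<star> w \<in> L" if "w \<in> W" for w
    using \<pi>[of w] that by (simp add: W_def)
  obtain c2 where c2: "\<And>r x b. 0 < r \<Longrightarrow> x \<in> W \<Longrightarrow> ?P ^ b \<star> x \<in> (\<star>) (laurent_t ^ r - 1) ` W \<boxplus> L \<Longrightarrow>
      ?P ^ (c2 + multiplicity p r) \<star> x \<in> (\<star>) (laurent_t ^ r - 1) ` W \<boxplus> L"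
    using torsion_exponent_killed[OF p s W WF L(1) LW kill] by blast
  define c where "c = c2 + c1"
  have det: "det B = ?P ^ 0 * s" by (simp add: s_def)
  obtain C1 where C1: "1 \<le> C1"
    "\<And>r e. 0 < r \<Longrightarrow> finite_index ?F (?B \<boxplus> ?J r e)"
    "\<And>r e. 0 < r \<Longrightarrow> sub_index ?F (?B \<boxplus> ?J r e) \<le> p ^ (0 * r) * C1 ^ e"
    using index_image_le[OF p B(1) det s] by blast
  obtain C2 where C2: "1 \<le> C2"
    "\<And>e. finite_index ?\<Phi> ((\<star>) s ` ?\<Phi> \<boxplus> (\<star>) (?P ^ e) ` ?\<Phi>)"
    "\<And>e. sub_index ?\<Phi> ((\<star>) s ` ?\<Phi> \<boxplus> (\<star>) (?P ^ e) ` ?\<Phi>) \<le> C2 ^ e"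
    using index_killed_le[OF p s \<open>finite I\<close>] by blast
  have "sub_index (prime_saturation p N (binomial_quot N L r)) (binomial_quot N L r) \<le> (C1 * C2) ^ (c + multiplicity p r)"
    if r: "0 < r" for r
  proof -
    let ?e = "c + multiplicity p r" and ?D = "binomial_quot N L r" and ?b = "laurent_t ^ r - 1"
    let ?T = "prime_saturation p N ?D" and ?Q = "(\<star>) (?P ^ (c + multiplicity p r)) ` ?F"
    have D: "submodule ?D" by (intro submodule_set_sum submodule_scale_image submodule_supported L)
    have DF: "?D \<subseteq> ?F"
      by (rule set_sum_least[OF scale_image_subset[OF submodule_supported] L(2) add[OF submodule_supported]])
    have T: "submodule ?T" by (rule submodule_prime_saturation[OF D])
    have Q: "submodule ?Q" by (intro submodule_scale_image submodule_supported)
    have exp: "?P ^ ?e \<star> x \<in> ?D" if x: "x \<in> ?F" "?P ^ b \<star> x \<in> ?D" for x b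
    proof -
      obtain y l where y: "y \<in> ?F" "l \<in> L" "?P ^ b \<star> x = ?b \<star> y + l"
        using x(2) by (auto elim!: set_sumE)
      obtain \<phi> where \<phi>: "\<phi> \<in> ?\<Phi>" "\<pi> y = ?P ^ b \<star> \<phi>" "\<pi> x = ?b \<star> \<phi>"
        using quot[OF r y(3,2)] by blast
      have "?P ^ b \<star> \<phi> \<in> \<pi> ` ?F" using y(1) \<phi>(2) by (metis imageI)
      then have "?P ^ c1 \<star> \<phi> \<in> \<pi> ` ?F" by (rule c1[OF \<phi>(1)])
      then obtain x' where x': "x' \<in> ?F" "?P ^ c1 \<star> \<phi> = \<pi> x'" by auto
      \<comment> \<open>Subtracting (t^r - 1) x' moves p^c1 x into the kernel W of \<pi>. The
        matching correction of y to w keeps the whole relation inside (t^r - 1) W + L.\<close>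
      define z where "z = ?P ^ c1 \<star> x - ?b \<star> x'"
      have "\<pi> z = 0"
        by (simp add: z_def \<pi>_diff \<pi>_scale \<phi>(3) x'(2)[symmetric] mult.commute)
      moreover have "z \<in> ?F"
        unfolding z_def using x(1) x'(1) by (intro fvec.subspace_diff fvec.subspace_scale submodule_supported)
      ultimately have zW: "z \<in> W" by (simp add: W_def)
      define w where "w = ?P ^ c1 \<star> y - ?P ^ b \<star> x'"
      have "?P ^ b \<star> z = ?P ^ c1 \<star> (?P ^ b \<star> x) - ?b \<star> (?P ^ b \<star> x')"
        by (simp add: z_def fvec.scale_right_diff_distrib mult.commute)
      also have "\<dots> = ?b \<star> w + ?P ^ c1 \<star> l"
        unfolding y(3) by (simp add: w_def fvec.scale_right_diff_distrib fvec.scale_right_distrib mult.commute)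
      finally have eq: "?P ^ b \<star> z = ?b \<star> w + ?P ^ c1 \<star> l" .
      have "\<pi> w = 0"
        by (simp add: w_def \<pi>_diff \<pi>_scale \<phi>(2) x'(2)[symmetric] mult.commute)
      moreover have "w \<in> ?F"
        unfolding w_def using y(1) x'(1) by (intro fvec.subspace_diff fvec.subspace_scale submodule_supported)
      ultimately have "w \<in> W" by (simp add: W_def)
      have "?P ^ b \<star> z \<in> (\<star>) ?b ` W \<boxplus> L"
        unfolding eq by (rule set_sumI[OF imageI[OF \<open>w \<in> W\<close>] fvec.subspace_scale[OF L(1) y(2)]])
      then have "?P ^ (c2 + multiplicity p r) \<star> z \<in> (\<star>) ?b ` W \<boxplus> L" by (rule c2[OF r zW])
      then have 1: "?P ^ (c2 + multiplicity p r) \<star> z \<in> ?D"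
        using set_sum_mono[OF image_mono[OF WF] order_refl] by blast
      have "?b \<star> (?P ^ (c2 + multiplicity p r) \<star> x') + 0 \<in> ?D"
        by (intro set_sumI imageI fvec.subspace_scale submodule_supported x'(1) fvec.subspace_0 L(1))
      from fvec.subspace_add[OF D 1 this]
      have "?P ^ (c2 + multiplicity p r) \<star> z + (?b \<star> (?P ^ (c2 + multiplicity p r) \<star> x') + 0) \<in> ?D" .
      moreover have "?P ^ (c2 + multiplicity p r) \<star> z + (?b \<star> (?P ^ (c2 + multiplicity p r) \<star> x') + 0) = ?P ^ ?e \<star> x"
        by (simp add: z_def c_def fvec.scale_right_diff_distrib power_add mult.commute mult.left_commute)
      ultimately show ?thesis by simp
    qed
    have DQ: "?D \<boxplus> ?Q = L \<boxplus> ?J r ?e" by (rule binomial_quot_add_power)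
    \<comment> \<open>\<open>?G\<close> adds the free part \<Phi> to L + J. It contains the image of
      B, so its index in F is at most C1^e; the index of L + J in it is at most that of
      \<open>?JI\<close> in \<Phi>, the large factor that has to cancel.\<close>
    let ?LJ = "L \<boxplus> ?J r ?e" and ?G = "?\<Phi> \<boxplus> (L \<boxplus> ?J r ?e)"
    have LJ: "submodule ?LJ" by (rule submodule_set_sum[OF L(1) submodule_cong_module])
    have G: "submodule ?G" by (rule submodule_set_sum[OF submodule_supported LJ])
    have LJF: "?LJ \<subseteq> ?F" by (rule set_sum_least[OF L(2) cong_module_subset add[OF submodule_supported]])
    have GF: "?G \<subseteq> ?F" by (rule set_sum_least[OF \<Phi>F LJF add[OF submodule_supported]])
    have LJG: "?LJ \<subseteq> ?G" by (rule set_sum_upper2[OF fvec.subspace_0[OF submodule_supported]])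
    note tower = index_tower[OF add[OF LJ] add[OF G] add[OF submodule_supported] LJG GF]
    have BG: "?B \<boxplus> ?J r ?e \<subseteq> ?G"
    proof -
      have "?B \<subseteq> ?\<Phi> \<boxplus> L"
      proof
        fix x assume "x \<in> ?B"
        then obtain g where g: "g \<in> ?F" "x = mat_apply B g" by auto
        have "x = (\<lambda>i. if i \<in> I then g i else 0) + (mat_apply B g - (\<lambda>i. if i \<in> I then g i else 0))"
          by (simp add: g)
        moreover have "(\<lambda>i. if i \<in> I then g i else 0) \<in> ?\<Phi>" by (simp add: supported_def)
        moreover note B_split[OF g(1)]
        ultimately show "x \<in> ?\<Phi> \<boxplus> L" by (metis (no_types, lifting) set_sumI)
      qed
      then show ?thesis unfolding set_sum_assoc[symmetric] by (rule set_sum_mono[OF _ order_refl])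
    qed
    have aB: "add_subgroup (?B \<boxplus> ?J r ?e)"
      by (intro add submodule_set_sum submodule_mat_apply_image submodule_supported submodule_cong_module)
    have FG: "finite_index ?F ?G" "sub_index ?F ?G \<le> C1 ^ ?e"
      using index_larger_sub[OF aB add[OF G] BG C1(2)[OF r]] C1(3)[OF r, of ?e] by simp_all
    have GL: "finite_index ?G ?LJ" "sub_index ?G ?LJ \<le> sub_index ?\<Phi> (?JI r ?e)"
    proof -
      have JIJ: "?JI r ?e \<subseteq> ?J r ?e"
        unfolding cong_module_def by (intro set_sum_mono image_mono \<Phi>F)
      have 1: "x \<in> ?LJ" if "x \<in> ?JI r ?e" for x
        using that JIJ set_sum_upper2[OF fvec.subspace_0[OF L(1)]] by blast
      have 2: "?G \<subseteq> (\<lambda>x. x) ` ?\<Phi> \<boxplus> ?LJ" by simp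
      show "finite_index ?G ?LJ" "sub_index ?G ?LJ \<le> sub_index ?\<Phi> (?JI r ?e)"
        using index_hom_image[OF add[OF submodule_cong_module] add[OF LJ] _ 1 2 index_cong_module(1)[OF p r \<open>finite I\<close>]]
        by simp_all
    qed
    have finL: "finite_index ?F ?LJ" using tower(2) FG(1) GL(1) by blast
    have idx: "sub_index ?F ?LJ = sub_index ?F (?T \<boxplus> ?Q) * sub_index ?T ?D"
      by (rule prime_saturation_index(1)[OF p D DF, where e = ?e, unfolded DQ]) (auto intro: exp finL)
    have finTQ: "finite_index ?F (?T \<boxplus> ?Q)"
      by (rule prime_saturation_index(2)[OF p D DF, where e = ?e, unfolded DQ]) (auto intro: exp finL)
    have TQ: "submodule (?T \<boxplus> ?Q)" by (rule submodule_set_sum[OF T Q])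
    let ?S = "(\<star>) s ` ?\<Phi> \<boxplus> ?JI r ?e"
    have sS: "submodule ?S" by (intro submodule_set_sum submodule_scale_image submodule_supported submodule_cong_module)
    have S\<Phi>: "?S \<subseteq> ?\<Phi>"
      by (rule set_sum_least[OF scale_image_subset[OF submodule_supported] cong_module_subset add[OF submodule_supported]])
    have JS: "?JI r ?e \<subseteq> ?S"
      by (rule set_sum_upper2[OF fvec.subspace_0[OF submodule_scale_image[OF submodule_supported]]])
    have \<Phi>S: "sub_index ?\<Phi> ?S \<le> C2 ^ ?e"
    proof -
      have "(\<star>) s ` ?\<Phi> \<boxplus> (\<star>) (?P ^ ?e) ` ?\<Phi> \<subseteq> ?S"
        unfolding cong_module_def
        by (intro set_sum_mono order_refl set_sum_upper2 fvec.subspace_0 submodule_scale_image submodule_supported)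
      moreover have "add_subgroup ((\<star>) s ` ?\<Phi> \<boxplus> (\<star>) (?P ^ ?e) ` ?\<Phi>)"
        by (intro add submodule_set_sum submodule_scale_image submodule_supported)
      ultimately show ?thesis
        using index_larger_sub(2)[OF _ add[OF sS] _ C2(2)] C2(3) le_trans by blast
    qed
    \<comment> \<open>\<pi> maps T + p^e F into \<open>?JI\<close>, and its image on F contains s
      \<Phi>. So the index of T + p^e F is at least that of \<open>?JI\<close> in \<Phi> up to C2^e,
      which provides the cancellation.\<close>
    have SJ: "sub_index ?S (?JI r ?e) \<le> sub_index ?F (?T \<boxplus> ?Q)"
    proof -
      have 1: "\<pi> x \<in> ?JI r ?e" if x: "x \<in> ?T \<boxplus> ?Q" for x
      proof -
        obtain u f where u: "u \<in> ?T" "f \<in> ?F" "x = u + ?P ^ ?e \<star> f"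
          using x by (auto elim!: set_sumE)
        obtain b where "?P ^ b \<star> u \<in> ?D" using u(1) by (auto simp: prime_saturation_def)
        then obtain y l where "y \<in> ?F" "l \<in> L" "?P ^ b \<star> u = ?b \<star> y + l"
          by (auto elim!: set_sumE)
        then obtain \<phi> where \<phi>: "\<phi> \<in> ?\<Phi>" "\<pi> u = ?b \<star> \<phi>"
          using quot[OF r] by blast
        have "\<pi> x = ?b \<star> \<phi> + ?P ^ ?e \<star> \<pi> f"
          by (simp add: u(3) \<pi>_add \<pi>_scale \<phi>(2))
        then show ?thesis
          unfolding cong_module_def using \<phi>(1) \<pi>_supp by (simp only: set_sumI imageI)
      qed
      have 2: "?S \<subseteq> \<pi> ` ?F \<boxplus> ?JI r ?e"
      proof (rule set_sum_mono[OF _ order_refl])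
        show "(\<star>) s ` ?\<Phi> \<subseteq> \<pi> ` ?F"
          using \<pi>_\<Phi> \<Phi>F by (auto simp: image_iff) (metis subsetD)
      qed
      show ?thesis
        by (rule index_hom_image(2)[OF add[OF TQ] add[OF submodule_cong_module] \<pi>_diff 1 2 finTQ])
    qed
    have "sub_index ?F (?T \<boxplus> ?Q) * sub_index ?T ?D = sub_index ?F ?G * sub_index ?G ?LJ"
      using idx tower(1) by simp
    also have "\<dots> \<le> C1 ^ ?e * sub_index ?\<Phi> (?JI r ?e)"
      by (rule mult_le_mono[OF FG(2) GL(2)])
    also have "sub_index ?\<Phi> (?JI r ?e) = sub_index ?\<Phi> ?S * sub_index ?S (?JI r ?e)"
      by (rule index_tower(1)[OF add[OF submodule_cong_module] add[OF sS] add[OF submodule_supported] JS S\<Phi>])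
    also have "C1 ^ ?e * (sub_index ?\<Phi> ?S * sub_index ?S (?JI r ?e)) \<le> C1 ^ ?e * (C2 ^ ?e * sub_index ?F (?T \<boxplus> ?Q))"
      by (intro mult_le_mono \<Phi>S SJ order_refl)
    also have "C1 ^ ?e * (C2 ^ ?e * t) = t * (C1 * C2) ^ ?e" for t
      by (simp add: power_mult_distrib)
    finally have le: "sub_index ?F (?T \<boxplus> ?Q) * sub_index ?T ?D \<le> sub_index ?F (?T \<boxplus> ?Q) * (C1 * C2) ^ ?e" .
    have "0 < sub_index ?F (?T \<boxplus> ?Q)"
      by (rule sub_index_pos[OF finTQ fvec.subspace_0[OF submodule_supported]])
    from nat_mult_le_cancel1[OF this] le show ?thesis by (rule iffD1)
  qed
  moreover have "1 \<le> C1 * C2" using C1(1) C2(1) by simp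
  ultimately show ?thesis by blast
qed

subsection \<open>Presentations\<close>

text \<open>An isomorphism from F / L to M, stated through a map \<pi> on representatives. Only
  carrier, addition and scalar multiplication of M enter, as in
  \<open>module_isomorphic\<close>.\<close>

definition presentation ::
    "((nat \<Rightarrow> laurent) \<Rightarrow> 'm) \<Rightarrow> nat \<Rightarrow> (nat \<Rightarrow> laurent) set \<Rightarrow> (laurent, 'm, 'c) module_scheme \<Rightarrow> bool" where
  "presentation \<pi> N L M \<longleftrightarrow> \<pi> ` supported {..<N} = carrier M \<and>
    (\<forall>x\<in>supported {..<N}. \<forall>y\<in>supported {..<N}. \<pi> (x + y) = \<pi> x \<oplus>\<^bsub>M\<^esub> \<pi> y) \<and>
    (\<forall>a. \<forall>x\<in>supported {..<N}. \<pi> (a \<star> x) = a \<odot>\<^bsub>M\<^esub> \<pi> x) \<and>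
    (\<forall>x\<in>supported {..<N}. \<forall>y\<in>supported {..<N}. \<pi> x = \<pi> y \<longleftrightarrow> x - y \<in> L)"

lemma presentationD:
  assumes "presentation \<pi> N L M"
  shows "\<pi> ` supported {..<N} = carrier M"
    "\<And>x y. x \<in> supported {..<N} \<Longrightarrow> y \<in> supported {..<N} \<Longrightarrow> \<pi> (x + y) = \<pi> x \<oplus>\<^bsub>M\<^esub> \<pi> y"
    "\<And>a x. x \<in> supported {..<N} \<Longrightarrow> \<pi> (a \<star> x) = a \<odot>\<^bsub>M\<^esub> \<pi> x"
    "\<And>x y. x \<in> supported {..<N} \<Longrightarrow> y \<in> supported {..<N} \<Longrightarrow> \<pi> x = \<pi> y \<longleftrightarrow> x - y \<in> L"
  using assms unfolding presentation_def by auto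

text \<open>Dividing M by the image of S adds S to the relations. This is applied to the free
  module, giving cokernels, and to M, giving the quotient by t^r - 1.\<close>

lemma presentation_quot_module:
  assumes pres: "presentation \<pi> N L M" and L: "submodule L"
    and S: "submodule S" "S \<subseteq> supported {..<N}"
  shows "presentation (\<lambda>x. \<pi> ` S +>\<^bsub>M\<^esub> \<pi> x) N (S \<boxplus> L) (quot_module M (\<pi> ` S))"
proof -
  let ?F = "supported {..<N} :: (nat \<Rightarrow> laurent) set"
  note P = presentationD[OF pres]
  have F: "submodule ?F" by (rule submodule_supported)
  note Fadd = fvec.subspace_add[OF F] and Fscale = fvec.subspace_scale[OF F]
  have SF: "s \<in> ?F" if "s \<in> S" for s using S(2) that by blast
  define \<rho> where "\<rho> x = \<pi> ` S +>\<^bsub>M\<^esub> \<pi> x" for x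
  have \<rho>: "\<rho> x = (\<lambda>s. \<pi> (s + x)) ` S" if "x \<in> ?F" for x
    using that SF P(2) unfolding \<rho>_def a_r_coset_def' by auto
  have eq: "\<rho> x = \<rho> y \<longleftrightarrow> x - y \<in> S \<boxplus> L" if xy: "x \<in> ?F" "y \<in> ?F" for x y
  proof
    assume "\<rho> x = \<rho> y"
    moreover have "\<pi> (0 + x) \<in> \<rho> x"
      unfolding \<rho>[OF xy(1)] using fvec.subspace_0[OF S(1)] by (rule imageI)
    ultimately obtain s where s: "s \<in> S" "\<pi> x = \<pi> (s + y)"
      unfolding \<rho>[OF xy(2)] by auto
    then have "x - (s + y) \<in> L" using P(4) xy SF Fadd by blast
    then have "s + (x - (s + y)) \<in> S \<boxplus> L" by (rule set_sumI[OF s(1)])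
    then show "x - y \<in> S \<boxplus> L" by (simp add: algebra_simps)
  next
    have sub: "\<rho> a \<subseteq> \<rho> b" if ab: "a \<in> ?F" "b \<in> ?F" "a - b \<in> S \<boxplus> L" for a b
    proof
      fix z assume "z \<in> \<rho> a"
      then obtain s where s: "s \<in> S" "z = \<pi> (s + a)" unfolding \<rho>[OF ab(1)] by auto
      obtain s' l where sl: "s' \<in> S" "l \<in> L" "a - b = s' + l" using ab(3) by (rule set_sumE)
      have mem: "s + s' \<in> S" using fvec.subspace_add[OF S(1) s(1) sl(1)] .
      have "(s + a) - ((s + s') + b) = l" using sl(3) by (simp add: algebra_simps)
      then have "\<pi> (s + a) = \<pi> ((s + s') + b)"
        using P(4)[of "s + a" "(s + s') + b"] SF[OF s(1)] SF[OF mem] Fadd ab(1,2) sl(2) by simp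
      then show "z \<in> \<rho> b"
        unfolding \<rho>[OF ab(2)] s(2) using mem by simp
    qed
    assume xy': "x - y \<in> S \<boxplus> L"
    have "y - x = - (x - y)" by simp
    then have "y - x \<in> S \<boxplus> L"
      using fvec.subspace_neg[OF submodule_set_sum[OF S(1) L] xy'] by (simp only:)
    then show "\<rho> x = \<rho> y" using sub xy xy' by blast
  qed
  have "\<rho> ` ?F = carrier (quot_module M (\<pi> ` S))"
    unfolding quot_module_def A_RCOSETS_def' \<rho>_def using P(1)[symmetric] by auto
  moreover have "\<rho> (x + y) = \<rho> x <+>\<^bsub>M\<^esub> \<rho> y" if xy: "x \<in> ?F" "y \<in> ?F" for x y
  proof -
    have "\<rho> x <+>\<^bsub>M\<^esub> \<rho> y = (\<Union>s\<in>S. \<Union>s'\<in>S. {\<pi> (s + x) \<oplus>\<^bsub>M\<^esub> \<pi> (s' + y)})"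
      unfolding set_add_def' \<rho>[OF xy(1)] \<rho>[OF xy(2)] by auto
    also have "\<dots> = (\<Union>s\<in>S. \<Union>s'\<in>S. {\<pi> ((s + s') + (x + y))})"
    proof (intro SUP_cong refl)
      fix s s' assume "s \<in> S" "s' \<in> S"
      then have hom: "\<pi> ((s + x) + (s' + y)) = \<pi> (s + x) \<oplus>\<^bsub>M\<^esub> \<pi> (s' + y)"
        using P(2)[of "s + x" "s' + y"] SF Fadd xy by simp
      have "(s + x) + (s' + y) = (s + s') + (x + y)" by (simp only: ac_simps)
      then show "{\<pi> (s + x) \<oplus>\<^bsub>M\<^esub> \<pi> (s' + y)} = {\<pi> ((s + s') + (x + y))}"
        unfolding hom[symmetric] by (simp only:)
    qed
    also have "\<dots> = \<rho> (x + y)"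
    proof -
      have "(\<Union>s\<in>S. \<Union>s'\<in>S. {\<pi> ((s + s') + (x + y))}) \<subseteq> (\<lambda>s. \<pi> (s + (x + y))) ` S"
        using fvec.subspace_add[OF S(1)] by blast
      moreover have "(\<lambda>s. \<pi> (s + (x + y))) ` S \<subseteq> (\<Union>s\<in>S. \<Union>s'\<in>S. {\<pi> ((s + s') + (x + y))})"
      proof
        fix z assume "z \<in> (\<lambda>s. \<pi> (s + (x + y))) ` S"
        then obtain s where "s \<in> S" "z = \<pi> ((s + 0) + (x + y))" by auto
        then show "z \<in> (\<Union>s\<in>S. \<Union>s'\<in>S. {\<pi> ((s + s') + (x + y))})"
          using fvec.subspace_0[OF S(1)] by blast
      qed
      ultimately show ?thesis unfolding \<rho>[OF Fadd[OF xy]] by (rule subset_antisym)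
    qed
    finally show ?thesis by simp
  qed
  moreover have "\<rho> (a \<star> x) = (\<Union>c\<in>\<rho> x. \<pi> ` S +>\<^bsub>M\<^esub> (a \<odot>\<^bsub>M\<^esub> c))" if x: "x \<in> ?F" for a x
  proof -
    have "\<pi> ` S +>\<^bsub>M\<^esub> (a \<odot>\<^bsub>M\<^esub> \<pi> (s + x)) = \<rho> (a \<star> x)" if s: "s \<in> S" for s
    proof -
      have "\<pi> ` S +>\<^bsub>M\<^esub> (a \<odot>\<^bsub>M\<^esub> \<pi> (s + x)) = \<rho> (a \<star> (s + x))"
        using P(3)[OF Fadd[OF SF[OF s] x]] by (simp add: \<rho>_def)
      also have "\<dots> = \<rho> (a \<star> x)"
      proof (subst eq)
        have "a \<star> (s + x) - a \<star> x = a \<star> s + 0" by (simp add: fvec.scale_right_distrib)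
        then show "a \<star> (s + x) - a \<star> x \<in> S \<boxplus> L"
          using set_sumI[OF fvec.subspace_scale[OF S(1) s] fvec.subspace_0[OF L]] by (simp only:)
      qed (use Fscale Fadd SF s x in auto)
      finally show ?thesis .
    qed
    then have "(\<Union>c\<in>\<rho> x. \<pi> ` S +>\<^bsub>M\<^esub> (a \<odot>\<^bsub>M\<^esub> c)) = (\<Union>s\<in>S. \<rho> (a \<star> x))"
      unfolding \<rho>[OF x] by simp
    then show ?thesis using fvec.subspace_0[OF S(1)] by blast
  qed
  ultimately have "presentation \<rho> N (S \<boxplus> L) (quot_module M (\<pi> ` S))"
    unfolding presentation_def using eq by (simp add: quot_module_def)
  then show ?thesis by (simp add: \<rho>_def[abs_def])
qed

lemma presentation_coker_module:
  "\<exists>\<pi>. presentation \<pi> (dim_row A) (mat_apply A ` supported {..<dim_col A}) (coker_module A)"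
proof -
  let ?N = "dim_row A" and ?L = "mat_apply A ` supported {..<dim_col A}"
  have surj: "(vec n :: (nat \<Rightarrow> laurent) \<Rightarrow> laurent vec) ` supported {..<n} = carrier_vec n" for n
  proof (intro equalityI subsetI)
    fix v :: "laurent vec" assume v: "v \<in> carrier_vec n"
    define f where "f i = (if i < n then v $ i else 0)" for i
    have "vec n f = v" using v by (auto simp: f_def)
    moreover have "f \<in> supported {..<n}" by (simp add: f_def supported_def)
    ultimately show "v \<in> vec n ` supported {..<n}" by blast
  qed auto
  have 0: "presentation (vec ?N) ?N {0} (module_vec TYPE(laurent) ?N)"
    unfolding presentation_def module_vec_simps surj
    by (auto simp: supported_def fun_eq_iff vec_eq_iff) metis
  have L: "submodule ?L" "?L \<subseteq> supported {..<?N}"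
    by (intro submodule_mat_apply_image submodule_supported,
        rule image_subsetI[OF mat_apply_supported[OF carrier_matI[OF refl refl]]])
  have "A *\<^sub>v vec (dim_col A) f = vec ?N (mat_apply A f)" for f
    by (auto simp: mat_apply_def scalar_prod_def atLeast0LessThan)
  then have "(\<lambda>v. A *\<^sub>v v) ` carrier_vec (dim_col A) = vec ?N ` ?L"
    unfolding surj[symmetric] image_image by simp
  then have "presentation (\<lambda>x. vec ?N ` ?L +>\<^bsub>module_vec TYPE(laurent) ?N\<^esub> vec ?N x) ?N (?L \<boxplus> {0}) (coker_module A)"
    using presentation_quot_module[OF 0 _ L] unfolding coker_module_def by simp
  moreover have "?L \<boxplus> {0} = ?L" by (auto simp: set_sum_def)
  ultimately show ?thesis by auto
qed

text \<open>The isomorphism is used backwards. Its inverse respects an operation only where the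
  result lies in the carrier of M, hence the closure assumptions.\<close>

lemma presentation_isomorphic:
  assumes pres: "presentation \<pi> N L M'" and iso: "module_isomorphic laurent_ring M M'"
    and closed: "\<And>x y. x \<in> carrier M \<Longrightarrow> y \<in> carrier M \<Longrightarrow> x \<oplus>\<^bsub>M\<^esub> y \<in> carrier M"
      "\<And>a x. x \<in> carrier M \<Longrightarrow> a \<odot>\<^bsub>M\<^esub> x \<in> carrier M"
  shows "\<exists>\<pi>. presentation \<pi> N L M"
proof -
  obtain h where h: "bij_betw h (carrier M) (carrier M')"
    "\<And>u v. u \<in> carrier M \<Longrightarrow> v \<in> carrier M \<Longrightarrow> h (u \<oplus>\<^bsub>M\<^esub> v) = h u \<oplus>\<^bsub>M'\<^esub> h v"
    "\<And>r u. u \<in> carrier M \<Longrightarrow> h (r \<odot>\<^bsub>M\<^esub> u) = r \<odot>\<^bsub>M'\<^esub> h u"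
    using iso unfolding module_isomorphic_def laurent_ring_def by auto
  note P = presentationD[OF pres]
  let ?F = "supported {..<N} :: (nat \<Rightarrow> laurent) set"
  define g where "g = inv_into (carrier M) h"
  have g: "g u \<in> carrier M" "h (g u) = u" if "u \<in> carrier M'" for u
    using that h(1) unfolding g_def bij_betw_def by (auto simp: inv_into_into f_inv_into_f)
  have gh: "g (h u) = u" if "u \<in> carrier M" for u
    using that h(1) unfolding g_def bij_betw_def by auto
  have in': "\<pi> x \<in> carrier M'" if "x \<in> ?F" for x using P(1) that by blast
  have "presentation (\<lambda>x. g (\<pi> x)) N L M"
    unfolding presentation_def
  proof (intro conjI ballI allI)
    have "(\<lambda>x. g (\<pi> x)) ` ?F = g ` carrier M'" unfolding P(1)[symmetric] image_image ..
    also have "\<dots> = carrier M"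
      using bij_betw_inv_into[OF h(1)] by (simp add: g_def bij_betw_def)
    finally show "(\<lambda>x. g (\<pi> x)) ` ?F = carrier M" .
    show "g (\<pi> (x + y)) = g (\<pi> x) \<oplus>\<^bsub>M\<^esub> g (\<pi> y)" if "x \<in> ?F" "y \<in> ?F" for x y
      using gh[OF closed(1)[OF g(1)[OF in'] g(1)[OF in']]] h(2)[OF g(1)[OF in'] g(1)[OF in']] P(2) g(2) in' that
      by metis
    show "g (\<pi> (a \<star> x)) = a \<odot>\<^bsub>M\<^esub> g (\<pi> x)" if "x \<in> ?F" for a x
      using gh[OF closed(2)[OF g(1)[OF in']]] h(3)[OF g(1)[OF in']] P(3) g(2) in' that by metis
    show "g (\<pi> x) = g (\<pi> y) \<longleftrightarrow> x - y \<in> L" if "x \<in> ?F" "y \<in> ?F" for x y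
      using P(4)[OF that] g(2) in' that by metis
  qed
  then show ?thesis by blast
qed

text \<open>\<open>presentation\<close> says nothing about the zero field of M, from which multiples
  start; the assumption \<open>zero\<close> ties it to \<pi>.\<close>

lemma presentation_nat_multiple:
  assumes pres: "presentation \<pi> N L M" and zero: "\<zero>\<^bsub>M\<^esub> = \<pi> 0" and x: "x \<in> supported {..<N}"
  shows "[k] \<cdot>\<^bsub>M\<^esub> \<pi> x = \<pi> (of_nat k \<star> x)"
proof (induction k)
  case 0
  have "of_nat 0 \<star> x = 0" by (simp add: fun_eq_iff)
  moreover have "[(0 :: nat)] \<cdot>\<^bsub>M\<^esub> \<pi> x = \<zero>\<^bsub>M\<^esub>"
    by (simp add: add_pow_def nat_pow_def)
  ultimately show ?case using zero by (simp only:)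
next
  case (Suc k)
  have "[Suc k] \<cdot>\<^bsub>M\<^esub> \<pi> x = [k] \<cdot>\<^bsub>M\<^esub> \<pi> x \<oplus>\<^bsub>M\<^esub> \<pi> x"
    by (simp add: add_pow_def nat_pow_def)
  also have "\<dots> = \<pi> (of_nat k \<star> x + x)"
    unfolding Suc by (rule presentationD(2)[OF pres fvec.subspace_scale[OF submodule_supported x] x, symmetric])
  also have "of_nat k \<star> x + x = of_nat (Suc k) \<star> x"
    by (simp add: fvec.scale_left_distrib add.commute)
  finally show ?case .
qed

lemma torsion_number_eq_index:
  assumes pres: "presentation \<pi> N L M" and L: "submodule L"
  shows "torsion_number M r = sub_index (saturation N (binomial_quot N L r)) (binomial_quot N L r)"
proof -
  let ?F = "supported {..<N} :: (nat \<Rightarrow> laurent) set" and ?b = "laurent_t ^ r - 1"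
  let ?S = "(\<star>) ?b ` ?F" and ?D = "binomial_quot N L r"
  note P = presentationD[OF pres]
  have S: "submodule ?S" "?S \<subseteq> ?F"
    by (intro submodule_scale_image submodule_supported, rule scale_image_subset[OF submodule_supported])
  have D: "submodule ?D" by (rule submodule_set_sum[OF S(1) L])
  have "(\<lambda>m. ?b \<odot>\<^bsub>M\<^esub> m) ` carrier M = \<pi> ` ?S"
    unfolding P(1)[symmetric] image_image using P(3) by (intro image_cong) auto
  then have R: "reduced_module M r = quot_module M (\<pi> ` ?S)"
    by (simp add: reduced_module_def)
  define \<rho> where "\<rho> = (\<lambda>x. \<pi> ` ?S +>\<^bsub>M\<^esub> \<pi> x)"
  have pres': "presentation \<rho> N ?D (quot_module M (\<pi> ` ?S))"
    unfolding \<rho>_def by (rule presentation_quot_module[OF pres L S])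
  note P' = presentationD[OF pres']
  have F0: "0 \<in> ?F" by (rule fvec.subspace_0[OF submodule_supported])
  have "\<rho> 0 = (\<lambda>s. \<pi> (s + 0)) ` ?S"
    unfolding \<rho>_def a_r_coset_def' using P(2)[OF _ F0] S(2) by auto
  then have zero: "\<zero>\<^bsub>quot_module M (\<pi> ` ?S)\<^esub> = \<rho> 0"
    by (simp add: quot_module_def)
  have "torsion_part (reduced_module M r) = \<rho> ` saturation N ?D"
  proof -
    have "[k] \<cdot>\<^bsub>quot_module M (\<pi> ` ?S)\<^esub> \<rho> x = \<zero>\<^bsub>quot_module M (\<pi> ` ?S)\<^esub> \<longleftrightarrow> of_nat k \<star> x \<in> ?D"
      if "x \<in> ?F" for x and k :: nat
      unfolding presentation_nat_multiple[OF pres' zero that] zero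
      using P'(4)[OF fvec.subspace_scale[OF submodule_supported that] F0] by simp
    then show ?thesis
      unfolding torsion_part_def R P'(1)[symmetric] saturation_def by blast
  qed
  moreover have "card (\<rho> ` saturation N ?D) = sub_index (saturation N ?D) ?D"
    by (rule translate_classifier(1)[OF add_subgroup_submodule[OF D], symmetric])
      (rule P'(4); simp add: saturation_def)
  ultimately show ?thesis by (simp add: torsion_number_def)
qed

lemma torsion_free_presentation_saturated:
  assumes pres: "presentation \<pi> N L M" and tf: "abelian_torsion_free M"
    and zero: "\<zero>\<^bsub>M\<^esub> \<oplus>\<^bsub>M\<^esub> \<zero>\<^bsub>M\<^esub> = \<zero>\<^bsub>M\<^esub>"
    and v: "v \<in> supported {..<N}" "of_nat k \<star> v \<in> L" "0 < k"
  shows "v \<in> L"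
proof -
  let ?F = "supported {..<N} :: (nat \<Rightarrow> laurent) set"
  note P = presentationD[OF pres]
  have F0: "0 \<in> ?F" by (rule fvec.subspace_0[OF submodule_supported])
  have "\<zero>\<^bsub>M\<^esub> \<in> torsion_part M" using tf by (simp add: abelian_torsion_free_def)
  then have "\<zero>\<^bsub>M\<^esub> \<in> carrier M" by (simp add: torsion_part_def)
  then obtain z where z: "z \<in> ?F" "\<zero>\<^bsub>M\<^esub> = \<pi> z" using P(1) by auto
  \<comment> \<open>The zero field is idempotent under addition, which forces it to be the class of
    0.\<close>
  then have "\<pi> (z + z) = \<pi> z" using zero P(2) by metis
  then have "z \<in> L" using P(4)[OF fvec.subspace_add[OF submodule_supported z(1) z(1)] z(1)] by simp
  then have zero': "\<zero>\<^bsub>M\<^esub> = \<pi> 0" using P(4)[OF z(1) F0] z(2) by simp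
  have "[k] \<cdot>\<^bsub>M\<^esub> \<pi> v = \<zero>\<^bsub>M\<^esub>"
    unfolding presentation_nat_multiple[OF pres zero' v(1)] zero'
    using P(4)[OF fvec.subspace_scale[OF submodule_supported v(1)] F0] v(2) by simp
  then have "\<pi> v \<in> torsion_part M"
    using v P(1) unfolding torsion_part_def by blast
  then have "\<pi> v = \<pi> 0" using tf zero' by (simp add: abelian_torsion_free_def)
  then show ?thesis using P(4)[OF v(1) F0] by simp
qed

subsection \<open>The module of an augmented group\<close>

text \<open>Module laws are inherited from the presentation; what the group itself must provide is
  closure under the operations, so that the presentation can be transported along the inverse
  isomorphism.\<close>

lemma augmentation_module_closed:
  assumes aug: "augmented_group G \<chi>" and x: "x \<in> carrier G"
  defines "M \<equiv> augmentation_module G \<chi> x"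
  shows "\<zero>\<^bsub>M\<^esub> \<oplus>\<^bsub>M\<^esub> \<zero>\<^bsub>M\<^esub> = \<zero>\<^bsub>M\<^esub>"
    "\<And>u v. u \<in> carrier M \<Longrightarrow> v \<in> carrier M \<Longrightarrow> u \<oplus>\<^bsub>M\<^esub> v \<in> carrier M"
    "\<And>a u. u \<in> carrier M \<Longrightarrow> a \<odot>\<^bsub>M\<^esub> u \<in> carrier M"
proof -
  interpret G: group G using aug by (simp add: augmented_group_def)
  interpret hom: group_hom G integer_group \<chi>
    using aug by (auto simp: augmented_group_def epi_def group_hom_def group_hom_axioms_def)
  define K where "K = kernel G integer_group \<chi>"
  have K: "K \<lhd> G" unfolding K_def by (rule hom.normal_kernel)
  define GK where "GK = G\<lparr>carrier := K\<rparr>"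
  define A where "A = kernel_abelianization G \<chi>"
  define H where "H = derived G K"
  have sub: "subgroup K G" using K by (simp add: normal_imp_subgroup)
  interpret GK: group GK unfolding GK_def by (rule subgroup.subgroup_is_group[OF sub G.group_axioms])
  have "derived GK K = H" unfolding GK_def H_def by (rule G.derived_consistent[OF order_refl sub])
  then have "A = GK Mod (derived GK (carrier GK))"
    by (simp add: A_def kernel_abelianization_def GK_def K_def H_def)
  then interpret A: comm_group A using GK.derived_quot_is_comm_group by simp
  interpret H: normal H G unfolding H_def by (rule G.derived_is_normal[OF K])
  have KG: "K \<subseteq> carrier G" using sub subgroup.subset by blast
  have carrier_A: "carrier A = (\<lambda>k. H #>\<^bsub>G\<^esub> k) ` K"
    by (auto simp: A_def kernel_abelianization_def carrier_FactGroup K_def H_def r_coset_def)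
  \<comment> \<open>The kernel is normal in G, and so is its derived subgroup H; conjugation by g
    therefore maps the coset of k onto the coset of the conjugate of k.\<close>
  have conj: "conj_image G g C \<in> carrier A" if g: "g \<in> carrier G" and C: "C \<in> carrier A" for g C
  proof -
    obtain k where k: "k \<in> K" "C = H #>\<^bsub>G\<^esub> k" using C carrier_A by auto
    have kG: "k \<in> carrier G" using k KG by blast
    have HG: "h \<in> carrier G" if "h \<in> H" for h using H.subset that by blast
    let ?k = "g \<otimes>\<^bsub>G\<^esub> k \<otimes>\<^bsub>G\<^esub> inv\<^bsub>G\<^esub> g"
    have "?k \<in> K" using K k(1) g by (simp add: normal.inv_op_closed2)
    have "conj_image G g C = H #>\<^bsub>G\<^esub> ?k"
    proof (intro equalityI subsetI)
      fix z assume "z \<in> conj_image G g C"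
      then obtain h where h: "h \<in> H" "z = g \<otimes>\<^bsub>G\<^esub> (h \<otimes>\<^bsub>G\<^esub> k) \<otimes>\<^bsub>G\<^esub> inv\<^bsub>G\<^esub> g"
        by (auto simp: conj_image_def k(2) r_coset_def)
      have "z = (g \<otimes>\<^bsub>G\<^esub> h \<otimes>\<^bsub>G\<^esub> inv\<^bsub>G\<^esub> g) \<otimes>\<^bsub>G\<^esub> ?k"
        using h HG[OF h(1)] g kG by (simp add: G.m_assoc G.inv_solve_left G.inv_solve_left')
      moreover have "g \<otimes>\<^bsub>G\<^esub> h \<otimes>\<^bsub>G\<^esub> inv\<^bsub>G\<^esub> g \<in> H" using h(1) g by (rule H.inv_op_closed2[rotated])
      ultimately show "z \<in> H #>\<^bsub>G\<^esub> ?k" by (auto simp: r_coset_def)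
    next
      fix z assume "z \<in> H #>\<^bsub>G\<^esub> ?k"
      then obtain h where h: "h \<in> H" "z = h \<otimes>\<^bsub>G\<^esub> ?k" by (auto simp: r_coset_def)
      let ?h = "inv\<^bsub>G\<^esub> g \<otimes>\<^bsub>G\<^esub> h \<otimes>\<^bsub>G\<^esub> g"
      have "?h \<in> H" using h(1) g by (rule H.inv_op_closed1[rotated])
      moreover have "z = g \<otimes>\<^bsub>G\<^esub> (?h \<otimes>\<^bsub>G\<^esub> k) \<otimes>\<^bsub>G\<^esub> inv\<^bsub>G\<^esub> g"
        using h HG[OF h(1)] g kG by (simp add: G.m_assoc[symmetric])
      ultimately show "z \<in> conj_image G g C"
        by (auto simp: conj_image_def k(2) r_coset_def)
    qed
    then show ?thesis using carrier_A \<open>?k \<in> K\<close> by auto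
  qed
  have M: "carrier M = carrier A" "zero M = \<one>\<^bsub>A\<^esub>" "add M = (\<otimes>\<^bsub>A\<^esub>)"
    "\<And>f C. module.smult M f C = (\<Otimes>\<^bsub>A\<^esub>n\<in>Poly_Mapping.keys f.
        conj_image G (x [^]\<^bsub>G\<^esub> n) C [^]\<^bsub>A\<^esub> Poly_Mapping.lookup f n)"
    by (simp_all add: M_def augmentation_module_def A_def Let_def)
  show "\<zero>\<^bsub>M\<^esub> \<oplus>\<^bsub>M\<^esub> \<zero>\<^bsub>M\<^esub> = \<zero>\<^bsub>M\<^esub>" by (simp add: M)
  show "u \<oplus>\<^bsub>M\<^esub> v \<in> carrier M" if "u \<in> carrier M" "v \<in> carrier M" for u v
    using that by (simp add: M)
  show "a \<odot>\<^bsub>M\<^esub> u \<in> carrier M" if "u \<in> carrier M" for a u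
    using that unfolding M
    by (intro A.finprod_closed) (auto intro!: A.int_pow_closed conj G.int_pow_closed x)
qed

subsection \<open>Minors and the characteristic polynomial\<close>

abbreviation column_minor :: "laurent mat \<Rightarrow> (nat \<Rightarrow> nat) \<Rightarrow> laurent" where
  "column_minor A f \<equiv> det (mat (dim_row A) (dim_row A) (\<lambda>(i, j). A $$ (i, f j)))"

text \<open>Cramer's rule replaces columns and so yields minors with columns repeated or out of
  order, while \<open>maximal_minors\<close> admits increasing selections only. Repetition gives 0,
  and sorting changes at most the sign.\<close>

lemma column_minor_cases:
  assumes h: "h ` {..<dim_row A} \<subseteq> {..<dim_col A}"
  shows "column_minor A h = 0 \<or> column_minor A h \<in> maximal_minors A \<or> - column_minor A h \<in> maximal_minors A"
proof -
  let ?N = "dim_row A" and ?X = "\<lambda>f. mat (dim_row A) (dim_row A) (\<lambda>(i, j). A $$ (i, f j))"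
  show ?thesis
  proof (cases "inj_on h {..<?N}")
    case False
    then obtain i j where ij: "i < ?N" "j < ?N" "i \<noteq> j" "h i = h j" by (auto simp: inj_on_def)
    then have "col (?X h) i = col (?X h) j" by (intro eq_vecI) auto
    then have "column_minor A h = 0"
      using det_identical_columns[of "?X h" ?N i j] ij by simp
    then show ?thesis by simp
  next
    case True
    let ?S = "h ` {..<?N}"
    have card: "card ?S = ?N" using card_image[OF True] by simp
    define f where "f j = sorted_list_of_set ?S ! j" for j
    have len: "length (sorted_list_of_set ?S) = ?N" using card by simp
    have "set (sorted_list_of_set ?S) = ?S" by simp
    then have f_im: "f ` {..<?N} = ?S"
      unfolding f_def set_conv_nth len by auto
    have mono: "strict_mono_on {..<?N} f"
      using strict_sorted_list_of_set[of ?S] len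
      by (auto simp: strict_mono_on_def f_def sorted_wrt_iff_nth_less)
    have inj_f: "inj_on f {..<?N}"
      by (rule strict_mono_on_imp_inj_on[OF mono])
    \<comment> \<open>\<sigma> is the permutation that composed with the sorted selection f gives h;
      fixing the indices outside the range is part of \<open>permutes\<close>.\<close>
    define \<sigma> where "\<sigma> i = (if i < ?N then inv_into {..<?N} f (h i) else i)" for i
    have f\<sigma>: "f (\<sigma> i) = h i" "\<sigma> i < ?N" if "i < ?N" for i
    proof -
      have "h i \<in> f ` {..<?N}" unfolding f_im using that by blast
      then show "f (\<sigma> i) = h i" "\<sigma> i < ?N"
        using inv_into_into[of "h i" f "{..<?N}"] f_inv_into_f[of "h i" f "{..<?N}"] that
        by (auto simp: \<sigma>_def)
    qed
    have "inj_on \<sigma> {..<?N}"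
    proof (rule inj_onI)
      fix i j assume ij: "i \<in> {..<?N}" "j \<in> {..<?N}" "\<sigma> i = \<sigma> j"
      then have "h i = h j" using f\<sigma>(1) by (metis lessThan_iff)
      then show "i = j" using True ij by (auto dest: inj_onD)
    qed
    moreover have "\<sigma> ` {..<?N} \<subseteq> {..<?N}" using f\<sigma>(2) by auto
    ultimately have "bij_betw \<sigma> {..<?N} {..<?N}"
      by (simp add: bij_betw_def endo_inj_surj)
    then have \<sigma>: "\<sigma> permutes {0..<?N}"
      unfolding atLeast0LessThan by (rule bij_imp_permutes) (auto simp: \<sigma>_def)
    have "mat ?N ?N (\<lambda>(i, j). (?X f)\<^sup>T $$ (\<sigma> i, j)) = (?X h)\<^sup>T"
      using f\<sigma> by (intro eq_matI) auto
    then have "column_minor A h = signof \<sigma> * column_minor A f"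
      using det_permute_rows[of "(?X f)\<^sup>T" ?N \<sigma>] \<sigma> det_transpose[of "?X f" ?N] det_transpose[of "?X h" ?N] by simp
    moreover have "column_minor A f \<in> maximal_minors A"
      unfolding maximal_minors_def using mono f_im h by blast
    moreover have "signof \<sigma> = (1 :: laurent) \<or> signof \<sigma> = (- 1 :: laurent)"
      by (cases "evenperm \<sigma>") (auto simp: sign_def)
    ultimately show ?thesis by auto
  qed
qed

text \<open>A power of p divides all maximal minors exactly if it divides their greatest common
  divisor, that is, the content of \<Delta>. So some minor attains the p-adic valuation of the
  content.\<close>

lemma minor_with_content_valuation:
  fixes \<Delta> :: "int poly"
  assumes p: "prime p" and \<Delta>: "\<Delta> \<noteq> 0" and gcd: "is_gcd_of (laurent_of_poly \<Delta>) (maximal_minors A)"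
  defines "l \<equiv> multiplicity p (nat (content \<Delta>))"
  shows "\<And>m. m \<in> maximal_minors A \<Longrightarrow> of_nat p ^ l dvd m"
    "\<exists>m\<in>maximal_minors A. \<exists>s. m = of_nat p ^ l * s \<and> \<not> of_nat p dvd s"
proof -
  let ?P = "of_nat p :: laurent"
  have c: "content \<Delta> \<noteq> 0" "0 \<le> content \<Delta>"
    using \<Delta> normalize_content[of \<Delta>] by (simp, metis abs_ge_zero normalize_int_def)
  have dvd_iff: "?P ^ k dvd laurent_of_poly \<Delta> \<longleftrightarrow> p ^ k dvd nat (content \<Delta>)" for k
  proof -
    have "?P ^ k dvd laurent_of_poly \<Delta> \<longleftrightarrow> of_int (int p ^ k) dvd laurent_of_poly \<Delta>" by simp
    also have "\<dots> \<longleftrightarrow> int p ^ k dvd content \<Delta>"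
      unfolding of_int_dvd_laurent_of_poly by (rule const_poly_dvd_iff_dvd_content)
    also have "\<dots> \<longleftrightarrow> int (p ^ k) dvd int (nat (content \<Delta>))" using c by simp
    also have "\<dots> \<longleftrightarrow> p ^ k dvd nat (content \<Delta>)" by (rule int_dvd_int_iff)
    finally show ?thesis .
  qed
  have fin: "nat (content \<Delta>) \<noteq> 0" "\<not> is_unit p" using c p by auto
  have "?P ^ l dvd laurent_of_poly \<Delta>"
    unfolding dvd_iff l_def by (rule multiplicity_dvd)
  then show all: "\<And>m. m \<in> maximal_minors A \<Longrightarrow> ?P ^ l dvd m"
    using gcd unfolding is_gcd_of_def by (meson dvd_trans)
  have "\<not> p ^ Suc l dvd nat (content \<Delta>)"
    using fin by (simp add: power_dvd_iff_le_multiplicity l_def del: power_Suc)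
  then have "\<not> ?P ^ Suc l dvd laurent_of_poly \<Delta>" unfolding dvd_iff .
  then obtain m where m: "m \<in> maximal_minors A" "\<not> ?P ^ Suc l dvd m"
    using gcd unfolding is_gcd_of_def by blast
  then obtain s where s: "m = ?P ^ l * s" using all by (auto elim: dvdE)
  have "\<not> ?P dvd s"
  proof
    assume "?P dvd s"
    then have "?P ^ l * ?P dvd ?P ^ l * s" by (rule mult_dvd_mono[OF dvd_refl])
    then show False using m(2) s by (simp add: mult.commute)
  qed
  then show "\<exists>m\<in>maximal_minors A. \<exists>s. m = ?P ^ l * s \<and> \<not> ?P dvd s" using m(1) s by blast
qed

text \<open>By Cramer's rule the columns of \<open>A\<close> are combinations of the columns of a maximal minor,
  with minors of \<open>A\<close> as numerators.\<close>

lemma cramer_columns: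
  assumes p: "prime p" and f: "f ` {..<dim_row A} \<subseteq> {..<dim_col A}"
    and det: "column_minor A f = of_nat p ^ l * s" "\<not> of_nat p dvd (s :: laurent)"
    and all: "\<And>m. m \<in> maximal_minors A \<Longrightarrow> of_nat p ^ l dvd m"
  defines "B \<equiv> mat (dim_row A) (dim_row A) (\<lambda>(i, j). A $$ (i, f j))"
  shows "mat_apply B ` supported {..<dim_row A} \<subseteq> mat_apply A ` supported {..<dim_col A}"
    "\<And>x. x \<in> mat_apply A ` supported {..<dim_col A} \<Longrightarrow> s \<star> x \<in> mat_apply B ` supported {..<dim_row A}"
proof -
  let ?N = "dim_row A" and ?m = "dim_col A" and ?P = "of_nat p :: laurent"
  let ?F = "supported {..<dim_row A} :: (nat \<Rightarrow> laurent) set"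
  have B: "B \<in> carrier_mat ?N ?N" by (simp add: B_def)
  have L: "submodule (mat_apply A ` supported {..<?m})" and BF: "submodule (mat_apply B ` ?F)"
    by (intro submodule_mat_apply_image submodule_supported)+
  have A_col: "col_fun A k \<in> mat_apply A ` supported {..<?m}" if "k < ?m" for k
    using mat_apply_unit_fun[OF that] unit_fun_supported[of k "{..<?m}"] that by (metis imageI lessThan_iff)
  show "mat_apply B ` ?F \<subseteq> mat_apply A ` supported {..<?m}"
  proof
    fix x assume "x \<in> mat_apply B ` ?F"
    then obtain g where "x = mat_apply B g" by auto
    then have "x = (\<Sum>j<?N. g j \<star> col_fun B j)" using B by (simp add: mat_apply_eq_sum_cols)
    also have "\<dots> \<in> mat_apply A ` supported {..<?m}"
    proof (rule fvec.subspace_sum[OF L])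
      fix j assume "j \<in> {..<?N}"
      then have "col_fun B j = col_fun A (f j)" "f j < ?m"
        using f by (auto simp: B_def col_fun_def fun_eq_iff)
      then show "g j \<star> col_fun B j \<in> mat_apply A ` supported {..<?m}"
        using fvec.subspace_scale[OF L A_col] by simp
    qed
    finally show "x \<in> mat_apply A ` supported {..<?m}" .
  qed
  have det_B: "det B = ?P ^ l * s" using det(1) by (simp add: B_def)
  have nz: "det B \<noteq> 0" "?P ^ l \<noteq> 0" using det_B det(2) of_nat_prime_nonzero[OF p] by auto
  have col: "s \<star> col_fun A k \<in> mat_apply B ` ?F" if k: "k < ?m" for k
  proof -
    have a: "col_fun A k \<in> ?F" by (simp add: col_fun_def supported_def)
    define y where "y = mat_apply (adj_mat B) (col_fun A k)"
    have y: "y \<in> ?F" unfolding y_def by (rule mat_apply_supported[OF adj_mat(1)[OF B]])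
    have By: "mat_apply B y = det B \<star> col_fun A k" unfolding y_def by (rule mat_apply_adj_mat[OF B a])
    \<comment> \<open>By Cramer's rule y_i is, on its range, the minor with column i of B replaced
      by column k of A. It is a multiple of p^l, so p^l cancels from B y = p^l s a, where a is
      column k, and only s remains.\<close>
    have "?P ^ l dvd y i" for i
    proof (cases "i < ?N")
      case True
      have "y i * det B = det B * det (replace_col B (vec ?N (col_fun A k)) i)"
        by (rule trans[OF det_replace_col_mat_apply[OF B True, of y, unfolded By, symmetric]
              det_replace_col_scale[OF B True a]])
      then have "det B * y i = det B * det (replace_col B (vec ?N (col_fun A k)) i)"
        by (simp only: mult.commute)
      then have "y i = det (replace_col B (vec ?N (col_fun A k)) i)"
        by (rule mult_left_cancel[THEN iffD1, OF nz(1)])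
      also have "replace_col B (vec ?N (col_fun A k)) i
        = mat ?N ?N (\<lambda>(i', j). A $$ (i', (f(i := k)) j))"
        by (rule eq_matI) (auto simp: replace_col_def B_def col_fun_def)
      finally have yi: "y i = column_minor A (f(i := k))" .
      have "(f(i := k)) ` {..<?N} \<subseteq> {..<?m}" using f k by auto
      from column_minor_cases[OF this] show ?thesis
        unfolding yi using all by (metis dvd_0_right dvd_minus_iff)
    next
      case False
      then show ?thesis using y by (simp add: supported_def)
    qed
    then obtain y' where y': "\<And>i. y i = ?P ^ l * y' i" unfolding dvd_def by metis
    then have "y = ?P ^ l \<star> y'" by (simp add: fun_eq_iff)
    then have "?P ^ l \<star> mat_apply B y' = ?P ^ l \<star> (s \<star> col_fun A k)"
      using By by (simp add: mat_apply_scale[symmetric] det_B)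
    then have "?P ^ l * mat_apply B y' i = ?P ^ l * (s * col_fun A k i)" for i
      by (metis scale_apply)
    then have "mat_apply B y' = s \<star> col_fun A k"
      using nz(2) mult_left_cancel[OF nz(2)] by (simp add: fun_eq_iff)
    moreover have "y' \<in> ?F"
      unfolding supported_def
    proof (intro CollectI allI impI)
      fix i assume "i \<notin> {..<?N}"
      then have "?P ^ l * y' i = 0" using y y'[of i] by (simp add: supported_def)
      then show "y' i = 0" using nz(2) mult_eq_0_iff by blast
    qed
    ultimately show ?thesis by (metis imageI)
  qed
  show "s \<star> x \<in> mat_apply B ` ?F" if x: "x \<in> mat_apply A ` supported {..<?m}" for x
  proof -
    obtain g where "x = mat_apply A g" using x by auto
    then have x_eq: "x = (\<Sum>k<?m. g k \<star> col_fun A k)" by (simp add: mat_apply_eq_sum_cols)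
    have "s \<star> x = (\<Sum>k<?m. g k \<star> (s \<star> col_fun A k))"
      unfolding x_eq fvec.scale_sum_right by (simp add: mult.commute)
    also have "\<dots> \<in> mat_apply B ` ?F"
      by (rule fvec.subspace_sum[OF BF], rule fvec.subspace_scale[OF BF col]) simp
    finally show ?thesis .
  qed
qed

subsection \<open>The limit\<close>

text \<open>2^v \<le> p^v \<le> r bounds the multiplicity v of p in r by the binary logarithm of
  r.\<close>

lemma multiplicity_over_index_tendsto:
  assumes p: "prime p"
  shows "(\<lambda>r. real (c + multiplicity p r) / real r) \<longlonglongrightarrow> 0"
proof (rule tendsto_sandwich)
  show "\<forall>\<^sub>F r in sequentially. 0 \<le> real (c + multiplicity p r) / real r" by simp
  show "\<forall>\<^sub>F r in sequentially. real (c + multiplicity p r) / real r \<le> (real c + log 2 (real r)) / real r"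
  proof (rule eventually_mono[OF eventually_gt_at_top[of 0]])
    fix r :: nat assume r: "0 < r"
    have "2 ^ multiplicity p r \<le> p ^ multiplicity p r"
      by (rule power_mono) (use prime_ge_2_nat[OF p] in auto)
    also have "\<dots> \<le> r" using multiplicity_dvd[of p r] r by (rule dvd_imp_le)
    finally have "real (2 ^ multiplicity p r) \<le> real r" by (simp only: of_nat_le_iff)
    then have "(2 :: real) ^ multiplicity p r \<le> real r" by simp
    then have "real (multiplicity p r) \<le> log 2 (real r)"
      using r by (simp add: le_log_iff powr_realpow)
    then show "real (c + multiplicity p r) / real r \<le> (real c + log 2 (real r)) / real r"
      by (intro divide_right_mono) auto
  qed
  show "(\<lambda>r. (real c + log 2 (real r)) / real r) \<longlonglongrightarrow> 0" by real_asymp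
qed simp

lemma root_tendsto_of_bounds:
  assumes p: "prime p" and C: "1 \<le> C"
    and upper: "\<And>r. 0 < r \<Longrightarrow> a r \<le> p ^ (l * r) * C ^ (c + multiplicity p r)"
    and lower: "\<And>r. 0 < r \<Longrightarrow> p ^ (l * r) \<le> a r * C ^ (c + multiplicity p r)"
  shows "(\<lambda>r. real (a r) powr (1 / real r)) \<longlonglongrightarrow> real (p ^ l)"
proof -
  define g where "g r = real C powr (real (c + multiplicity p r) / real r)" for r
  have "g \<longlonglongrightarrow> real C powr 0"
    unfolding g_def using C by (intro tendsto_powr tendsto_const multiplicity_over_index_tendsto[OF p]) auto
  then have g: "g \<longlonglongrightarrow> 1" using C by simp
  have root: "real (p ^ (l * r)) powr (1 / real r) = real (p ^ l)"
    "real (C ^ (c + multiplicity p r)) powr (1 / real r) = g r" if "0 < r" for r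
  proof -
    have "real (p ^ (l * r)) = real (p ^ l) powr real r"
      using p by (simp add: power_mult powr_realpow prime_gt_0_nat)
    then show "real (p ^ (l * r)) powr (1 / real r) = real (p ^ l)"
      using that p by (simp add: powr_powr prime_gt_0_nat)
    have "real (C ^ (c + multiplicity p r)) = real C powr real (c + multiplicity p r)"
      using C by (simp add: powr_realpow[symmetric])
    then show "real (C ^ (c + multiplicity p r)) powr (1 / real r) = g r"
      by (simp add: g_def powr_powr)
  qed
  have pos: "0 < g r" for r using C by (simp add: g_def)
  show ?thesis
  proof (rule tendsto_sandwich)
    show "\<forall>\<^sub>F r in sequentially. real (p ^ l) / g r \<le> real (a r) powr (1 / real r)"
    proof (rule eventually_mono[OF eventually_gt_at_top[of 0]])
      fix r :: nat assume r: "0 < r"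
      have "real (p ^ l) = real (p ^ (l * r)) powr (1 / real r)" using root(1)[OF r] by simp
      also have "\<dots> \<le> (real (a r) * real (C ^ (c + multiplicity p r))) powr (1 / real r)"
        using lower[OF r] unfolding of_nat_mult[symmetric] by (intro powr_mono2 of_nat_mono) simp_all
      also have "\<dots> = real (a r) powr (1 / real r) * g r"
        by (simp only: powr_mult of_nat_0_le_iff root(2)[OF r])
      finally show "real (p ^ l) / g r \<le> real (a r) powr (1 / real r)"
        using pos[of r] by (simp add: pos_divide_le_eq)
    qed
    show "\<forall>\<^sub>F r in sequentially. real (a r) powr (1 / real r) \<le> real (p ^ l) * g r"
    proof (rule eventually_mono[OF eventually_gt_at_top[of 0]])
      fix r :: nat assume r: "0 < r"
      have "real (a r) powr (1 / real r) \<le> (real (p ^ (l * r)) * real (C ^ (c + multiplicity p r))) powr (1 / real r)"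
        using upper[OF r] unfolding of_nat_mult[symmetric] by (intro powr_mono2 of_nat_mono) simp_all
      also have "\<dots> = real (p ^ l) * g r"
        by (simp only: powr_mult of_nat_0_le_iff root[OF r])
      finally show "real (a r) powr (1 / real r) \<le> real (p ^ l) * g r" .
    qed
    show "(\<lambda>r. real (p ^ l) / g r) \<longlonglongrightarrow> real (p ^ l)"
      using tendsto_divide[OF tendsto_const g, of "real (p ^ l)"] by simp
    show "(\<lambda>r. real (p ^ l) * g r) \<longlonglongrightarrow> real (p ^ l)"
      using tendsto_mult[OF tendsto_const g, of "real (p ^ l)"] by simp
  qed
qed

lemma p_component_torsion_number:
  assumes p: "prime p" and pres: "presentation \<pi> N L M" and L: "submodule L" "L \<subseteq> supported {..<N}" and r: "0 < r"
  shows "p_component p (torsion_number M r)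
    = sub_index (prime_saturation p N (binomial_quot N L r)) (binomial_quot N L r)"
    "0 < p_component p (torsion_number M r)"
proof -
  let ?F = "supported {..<N} :: (nat \<Rightarrow> laurent) set"
  have S: "submodule ((\<star>) (laurent_t ^ r - 1) ` ?F)" "(\<star>) (laurent_t ^ r - 1) ` ?F \<subseteq> ?F"
    by (intro submodule_scale_image submodule_supported, rule scale_image_subset[OF submodule_supported])
  have D: "submodule (binomial_quot N L r)" by (rule submodule_set_sum[OF S(1) L(1)])
  have DF: "binomial_quot N L r \<subseteq> ?F"
    by (rule set_sum_least[OF S(2) L(2) add_subgroup_submodule[OF submodule_supported]])
  have tD: "(\<star>) (laurent_t ^ r - 1) ` ?F \<subseteq> binomial_quot N L r"
    by (rule set_sum_upper1[OF fvec.subspace_0[OF L(1)]])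
  show "p_component p (torsion_number M r)
    = sub_index (prime_saturation p N (binomial_quot N L r)) (binomial_quot N L r)"
    unfolding p_component_def torsion_number_eq_index[OF pres L(1)]
    by (rule torsion_index_prime_part(2)[OF p r D DF tD])
  show "0 < p_component p (torsion_number M r)"
    using p by (simp add: p_component_def prime_gt_0_nat)
qed

theorem theorem4p2:
  fixes G :: "('a, 'b) monoid_scheme" and \<chi> :: "'a \<Rightarrow> int" and x :: 'a
    and M :: "(laurent, 'a set) module" and \<Delta> :: "int poly" and p :: nat
  assumes "augmented_group G \<chi>"
    and "x \<in> carrier G" and "\<chi> x = 1"
    and "M = augmentation_module G \<chi> x"
    and "zeroth_char_poly M \<Delta>"
    and "prime p"
  shows
    "(has_square_presentation M \<and> \<Delta> \<noteq> 0 \<longrightarrow>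
       ((\<lambda>r. real (p_component p (torsion_number M r)) powr (1 / real r))
         \<longlongrightarrow> real (p_component p (nat (content \<Delta>)))) (pure_indices M))
     \<and> (direct_sum_of_cyclics laurent_ring M \<and> \<Delta> \<noteq> 0 \<longrightarrow>
       (\<lambda>r. real (p_component p (torsion_number M r)) powr (1 / real r))
         \<longlonglongrightarrow> real (p_component p (nat (content \<Delta>))))
     \<and> (abelian_torsion_free M \<longrightarrow>
       (\<lambda>r. real (p_component p (torsion_number M r)) powr (1 / real r))
         \<longlonglongrightarrow> 1)"
proof -
  note p = \<open>prime p\<close>
  let ?a = "\<lambda>r. real (p_component p (torsion_number M r)) powr (1 / real r)"
  obtain A where A: "dim_row A \<le> dim_col A" "presents A M"
    "is_gcd_of (laurent_of_poly \<Delta>) (maximal_minors A)"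
    using assms(5) unfolding zeroth_char_poly_def by blast
  define N where "N = dim_row A"
  define L where "L = mat_apply A ` supported {..<dim_col A}"
  have A': "A \<in> carrier_mat N (dim_col A)" by (simp add: N_def)
  have L: "submodule L" "L \<subseteq> supported {..<N}"
    unfolding L_def
    by (intro submodule_mat_apply_image submodule_supported,
        rule image_subsetI[OF mat_apply_supported[OF A']])
  note closed = augmentation_module_closed[OF assms(1,2), folded assms(4)]
  obtain \<pi>0 where "presentation \<pi>0 N L (coker_module A)"
    using presentation_coker_module[of A] by (auto simp: N_def L_def)
  then obtain \<pi> where pres: "presentation \<pi> N L M"
    using presentation_isomorphic[OF _ A(2)[unfolded presents_def] closed(2,3)] by blast
  note comp = p_component_torsion_number[OF p pres L]
  have nonzero: "?a \<longlonglongrightarrow> real (p_component p (nat (content \<Delta>)))" if \<Delta>: "\<Delta> \<noteq> 0"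
  proof -
    \<comment> \<open>p^l is the claimed limit, and the minor chosen below contains exactly this
      power of p.\<close>
    let ?l = "multiplicity p (nat (content \<Delta>))"
    note minors = minor_with_content_valuation[OF p \<Delta> A(3)]
    obtain m s where m: "m \<in> maximal_minors A" "m = of_nat p ^ ?l * s" "\<not> of_nat p dvd s"
      using minors(2) by blast
    obtain f where f: "m = column_minor A f" "f ` {..<dim_row A} \<subseteq> {..<dim_col A}"
      using m(1) unfolding maximal_minors_def by auto
    have det: "column_minor A f = of_nat p ^ ?l * s" using f(1) m(2) by simp
    define B where "B = mat (dim_row A) (dim_row A) (\<lambda>(i, j). A $$ (i, f j))"
    note cramer = cramer_columns[OF p f(2) det m(3) minors(1), folded B_def N_def]
    have B: "B \<in> carrier_mat N N" by (simp add: B_def N_def)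
    have detB: "det B = of_nat p ^ ?l * s" unfolding B_def by (rule det)
    obtain c C where "1 \<le> C"
      "\<forall>r>0. sub_index (prime_saturation p N (binomial_quot N L r)) (binomial_quot N L r) \<le> p ^ (?l * r) * C ^ (c + multiplicity p r) \<and>
       p ^ (?l * r) \<le> sub_index (prime_saturation p N (binomial_quot N L r)) (binomial_quot N L r) * C ^ (c + multiplicity p r)"
      using prime_saturation_index_det[OF p B A' detB m(3) cramer] unfolding L_def by blast
    then show ?thesis
      unfolding p_component_def[of p "nat (content \<Delta>)"]
      by (intro root_tendsto_of_bounds[OF p, of C]) (auto simp: comp(1))
  qed
  have torsion_free: "?a \<longlonglongrightarrow> 1" if tf: "abelian_torsion_free M"
  proof -
    have sat: "v \<in> L" if "v \<in> supported {..<N}" "of_nat p \<star> v \<in> L" for v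
      using torsion_free_presentation_saturated[OF pres tf closed(1) that] p by (simp add: prime_gt_0_nat)
    obtain c C where C: "1 \<le> C"
      "\<forall>r>0. sub_index (prime_saturation p N (binomial_quot N L r)) (binomial_quot N L r) \<le> C ^ (c + multiplicity p r)"
      using prime_saturation_index_torsion_free[OF p L sat] by blast
    have "?a \<longlonglongrightarrow> real (p ^ 0)"
    proof (rule root_tendsto_of_bounds[OF p C(1)])
      fix r :: nat assume r: "0 < r"
      show "p_component p (torsion_number M r) \<le> p ^ (0 * r) * C ^ (c + multiplicity p r)"
        using C(2) r by (simp add: comp(1)[OF r])
      \<comment> \<open>With l = 0 the bound from below follows from the p-component being
        positive.\<close>
      have "1 * 1 \<le> p_component p (torsion_number M r) * C ^ (c + multiplicity p r)"
        by (rule mult_le_mono) (use comp(2)[OF r] C(1) in simp_all)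
      then show "p ^ (0 * r) \<le> p_component p (torsion_number M r) * C ^ (c + multiplicity p r)" by simp
    qed
    then show ?thesis by simp
  qed
  \<comment> \<open>The filter of pure indices is finer than \<open>sequentially\<close>, so the
    limit over all r restricts to it.\<close>
  have "pure_indices M \<le> sequentially" by (simp add: pure_indices_def)
  then show ?thesis using nonzero torsion_free tendsto_mono by blast
qed

end
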